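(* Let $n\geq3$, let $m\geq 1$ be an integer, let $1\leq k\leq m$, and put $a^k_1=\Delta_1A_k$, $a^k_2=\Delta_2A_k$, where $A_k=\eta_1\cdots\eta_n\partial_x^{k-1}\in\mathcal{D}^n_{\lambda_k,\mu_k}$, $\lambda_k=-\frac{k+n-2}{2}$, $\mu_k=\frac k2$. Then, as cochains on $\mathfrak{osp}(n|2)$, $$a^k_2=h_k,\qquad a^k_1=-\bigl(h_k+\widetilde h_k\bigr),$$ i.e. for every $F$ such that $X_F\in\mathfrak{osp}(n|2)$, $$h_k(X_F)=(-1)^{n|F|}F'A_k,\qquad h_k(X_F)+\widetilde h_k(X_F)=A_k\circ(F'\cdot).$$ In particular $a^k_1$ and $a^k_2$ are $1$-cocycles whose classes form a basis of $\mathrm{H}^1(\mathfrak{osp}(n|2),\mathcal{D}^n_{\lambda_k,\mu_k})\simeq\mathbb{R}^2$, and, for formal parameters $\sigma,\tau$, $$\delta^{\sigma,\tau}A_k=\sigma a^k_1+\tau a^k_2.$$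
   Context: Setting. $\mathbb{R}^{1|n}$ has even coordinate $x$ and odd coordinates $\theta_1,\dots,\theta_n$; $C^\infty(\mathbb{R}^{1|n})=C^\infty(\mathbb{R})\otimes\Lambda(\theta_1,\dots,\theta_n)$; $F'=\partial_xF$; $(-1)^F$, $(-1)^{AF}$ mean $(-1)^{|F|}$, $(-1)^{|A||F|}$. Put $\eta_i=\partial_{\theta_i}-\theta_i\partial_x$, so $\eta_i\eta_j+\eta_j\eta_i=-2\delta_{ij}\partial_x$. Contact vector fields: $X_F=F\partial_x-\frac12(-1)^F\sum_i\eta_i(F)\eta_i$, $[X_F,X_G]=X_{\{F,G\}}$ with $\{F,G\}=FG'-F'G-\frac12(-1)^F\sum_i\eta_i(F)\eta_i(G)$. $\mathfrak{osp}(n|2)=\mathrm{Span}(X_1,X_x,X_{x^2},X_{\theta_i},X_{x\theta_i},X_{\theta_i\theta_j})$, $1\le i<j\le n$. $\mathcal{F}^n_\lambda$ is $C^\infty(\mathbb{R}^{1|n})$ with action $L^\lambda_{X_F}=X_F+\lambda F'$. $\mathcal{D}^n_{\lambda,\mu}$: linear differential operators $\mathcal{F}^n_\lambda\to\mathcal{F}^n_\mu$ with $X_F\cdot A=L^\mu_{X_F}\circ A-(-1)^{AF}A\circ L^\lambda_{X_F}$. Cohomology. $C^p(\mathfrak g,V)=\mathrm{Hom}(\Lambda^p\mathfrak g,V)$ (super sense); $\delta u(x)=(-1)^{ux}x\cdot u$ on $0$-cochains, $\delta f(u,v)=(-1)^{uf}u\cdot f(v)-(-1)^{v(u+f)}v\cdot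 f(u)-f([u,v])$ on $1$-cochains. Operators $\Delta_i$. $\delta^{\sigma,\tau}$ is the coboundary operator of the module $\mathcal{D}^n_{\lambda_k+\sigma,\mu_k+\tau}$; as the action is affine in the weights, $\delta^{\sigma,\tau}=\delta+\sigma\Delta_1+\tau\Delta_2$ with $\delta=\delta^{0,0}$. On a $0$-cochain $A$: $(\Delta_1A)(X_F)=-A\circ(F'\cdot)$ and $(\Delta_2A)(X_F)=(-1)^{AF}F'A$, where $(F'\cdot)$ is multiplication by $F'$. Cocycles. With values in $\mathcal{D}^n_{\lambda_k,\mu_k}$ ($\check{\eta_i}$ means omitted): $$h_k(X_F)=(-1)^{nF}F'\eta_1\cdots\eta_n\partial_x^{k-1},$$ $$\widetilde h_k(X_F)=(k-1)F''\eta_1\cdots\eta_n\partial_x^{k-2}+(-1)^{(n-1)F}\sum_{i=1}^n(-1)^{i-1}\eta_i(F')\,\eta_1\cdots\check{\eta_i}\cdots\eta_n\partial_x^{k-1}.$$ Known (Ben Fraj–Jabeur–Safi), $n\ge3$: $h_k,\widetilde h_k$ are $1$-cocycles whose classes form a basis of $\mathrm{H}^1(\mathfrak{osp}(n|2),\mathcal{D}^n_{\lambda_k,\mu_k})\simeq\mathbb{R}^2$. *)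

theory Defs
  imports "HOL-Analysis.Analysis" "HOL-Library.Function_Algebras"
begin

section \<open>Smooth functions on the line\<close>

definition smooth :: "(real \<Rightarrow> real) \<Rightarrow> bool" where
  "smooth f \<longleftrightarrow> (\<forall>k x. (deriv ^^ k) f field_differentiable at x)"

lemma smooth_differentiable: "smooth f \<Longrightarrow> f field_differentiable at x"
  unfolding smooth_def by (metis funpow_0)

lemma smooth_deriv: "smooth f \<Longrightarrow> smooth (deriv f)"
  unfolding smooth_def by (metis comp_apply funpow_Suc_right)

lemma smooth_coinduct:
  assumes "P f"
    and step: "\<And>g. P g \<Longrightarrow> (\<forall>x. g field_differentiable at x) \<and> P (deriv g)"
  shows "smooth f"
proof -
  have "P ((deriv ^^ k) f)" for k
    by (induction k) (use assms in auto)
  then show ?thesis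
    using step unfolding smooth_def by blast
qed

lemma smooth_const: "smooth (\<lambda>x. c)"
  by (rule smooth_coinduct[where P = "\<lambda>f. \<exists>c. f = (\<lambda>x. c)"]) auto

lemma smooth_ident: "smooth (\<lambda>x. x)"
proof (rule smooth_coinduct[where P = "\<lambda>f. f = (\<lambda>x. x) \<or> smooth f"])
  fix g :: "real \<Rightarrow> real"
  assume "g = (\<lambda>x. x) \<or> smooth g"
  then show "(\<forall>x. g field_differentiable at x) \<and> (deriv g = (\<lambda>x. x) \<or> smooth (deriv g))"
  proof
    assume "g = (\<lambda>x. x)"
    then show ?thesis
      by (simp add: smooth_const)
  qed (simp add: smooth_differentiable smooth_deriv)
qed simp

lemma smooth_add:
  assumes "smooth f" "smooth g"
  shows "smooth (\<lambda>x. f x + g x)"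
proof (rule smooth_coinduct[where P = "\<lambda>h. \<exists>f g. smooth f \<and> smooth g \<and> h = (\<lambda>x. f x + g x)"])
  fix h :: "real \<Rightarrow> real"
  assume "\<exists>f g. smooth f \<and> smooth g \<and> h = (\<lambda>x. f x + g x)"
  then obtain f g where fg: "smooth f" "smooth g" and h: "h = (\<lambda>x. f x + g x)"
    by blast
  have "deriv h = (\<lambda>x. deriv f x + deriv g x)"
    unfolding h by (rule ext) (simp add: deriv_add fg smooth_differentiable)
  then show "(\<forall>x. h field_differentiable at x) \<and>
      (\<exists>f g. smooth f \<and> smooth g \<and> deriv h = (\<lambda>x. f x + g x))"
    using fg h smooth_deriv smooth_differentiable field_differentiable_add by blast
qed (use assms in blast)

lemma smooth_sum: "(\<And>i. i \<in> S \<Longrightarrow> smooth (f i)) \<Longrightarrow> smooth (\<lambda>x. \<Sum>i\<in>S. f i x)"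
  by (induction S rule: infinite_finite_induct) (simp_all add: smooth_const smooth_add)

inductive product_sum :: "(real \<Rightarrow> real) \<Rightarrow> bool" where
  product: "smooth f \<Longrightarrow> smooth g \<Longrightarrow> product_sum (\<lambda>x. f x * g x)"
| add: "product_sum f \<Longrightarrow> product_sum g \<Longrightarrow> product_sum (\<lambda>x. f x + g x)"

lemma product_sum_step:
  "product_sum h \<Longrightarrow> (\<forall>x. h field_differentiable at x) \<and> product_sum (deriv h)"
proof (induction rule: product_sum.induct)
  case (product f g)
  have "deriv (\<lambda>x. f x * g x) = (\<lambda>x. f x * deriv g x + deriv f x * g x)"
    by (rule ext) (simp add: deriv_mult product smooth_differentiable)
  with product show ?case
    by (auto intro!: product_sum.intros smooth_deriv field_differentiable_mult
        simp: smooth_differentiable)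
next
  case (add f g)
  have "deriv (\<lambda>x. f x + g x) = (\<lambda>x. deriv f x + deriv g x)"
    by (rule ext) (simp add: deriv_add add)
  with add show ?case
    by (auto intro!: product_sum.add field_differentiable_add)
qed

lemma smooth_mult: "smooth f \<Longrightarrow> smooth g \<Longrightarrow> smooth (\<lambda>x. f x * g x)"
  by (rule smooth_coinduct[where P = product_sum])
    (simp_all add: product_sum.product product_sum_step)

lemma smooth_cmult: "smooth f \<Longrightarrow> smooth (\<lambda>x. c * f x)"
  by (simp add: smooth_mult smooth_const)

lemma smooth_minus: "smooth f \<Longrightarrow> smooth (\<lambda>x. - f x)"
  using smooth_cmult[of f "-1"] by simp

lemma smooth_diff: "smooth f \<Longrightarrow> smooth g \<Longrightarrow> smooth (\<lambda>x. f x - g x)"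
  using smooth_add[of f "\<lambda>x. - g x"] by (simp add: smooth_minus)


section \<open>The superalgebra of smooth functions on the superline with n odd coordinates\<close>

text \<open>
  The odd coordinates are indexed by a finite linearly ordered type \<^typ>\<open>'n\<close>, so
  n is \<open>CARD('n)\<close>. An element \<open>F\<close> is the family of its coefficients: it stands for the
  sum over \<open>I\<close> of \<open>F I \<theta>\<^sub>I\<close>, where \<open>\<theta>\<^sub>I\<close> is the product of the \<open>\<theta>\<^sub>i\<close>, \<open>i \<in> I\<close>,
  in increasing order.
\<close>

typedef (overloaded) ('n::"{finite,linorder}") sfun =
  "{F :: 'n set \<Rightarrow> real \<Rightarrow> real. \<forall>I. smooth (F I)}"
  morphisms coef Abs_sfun
  by (rule exI[where x = "\<lambda>I x. 0"]) (simp add: smooth_const)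

setup_lifting type_definition_sfun

text \<open>Sign in \<open>\<theta>\<^sub>I \<theta>\<^sub>J = gsign I J \<theta>\<^sub>I\<^sub>\<union>\<^sub>J\<close> for disjoint \<open>I\<close> and \<open>J\<close>.\<close>

definition gsign :: "'n::{finite,linorder} set \<Rightarrow> 'n set \<Rightarrow> real" where
  "gsign I J = (-1) ^ card {(i, j). i \<in> I \<and> j \<in> J \<and> j < i}"

lemma gsign_empty [simp]: "gsign {} J = 1" "gsign I {} = 1"
  by (simp_all add: gsign_def)

lemma gsign_Un_left:
  assumes "I \<inter> J = {}"
  shows "gsign (I \<union> J) K = gsign I K * gsign J K"
proof -
  have "{(i, j). i \<in> I \<union> J \<and> j \<in> K \<and> j < i} =
      {(i, j). i \<in> I \<and> j \<in> K \<and> j < i} \<union> {(i, j). i \<in> J \<and> j \<in> K \<and> j < i}"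
    by auto
  moreover have "{(i, j). i \<in> I \<and> j \<in> K \<and> j < i} \<inter> {(i, j). i \<in> J \<and> j \<in> K \<and> j < i} = {}"
    using assms by auto
  ultimately show ?thesis
    by (simp add: gsign_def card_Un_disjoint power_add)
qed

lemma gsign_Un_right:
  assumes "J \<inter> K = {}"
  shows "gsign I (J \<union> K) = gsign I J * gsign I K"
proof -
  have "{(i, j). i \<in> I \<and> j \<in> J \<union> K \<and> j < i} =
      {(i, j). i \<in> I \<and> j \<in> J \<and> j < i} \<union> {(i, j). i \<in> I \<and> j \<in> K \<and> j < i}"
    by auto
  moreover have "{(i, j). i \<in> I \<and> j \<in> J \<and> j < i} \<inter> {(i, j). i \<in> I \<and> j \<in> K \<and> j < i} = {}"
    using assms by auto
  ultimately show ?thesis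
    by (simp add: gsign_def card_Un_disjoint power_add)
qed

instantiation sfun :: ("{finite,linorder}") real_algebra_1
begin

lift_definition zero_sfun :: "'a sfun" is "\<lambda>I x. 0"
  by (simp add: smooth_const)

lift_definition one_sfun :: "'a sfun" is "\<lambda>I x. if I = {} then 1 else 0"
  by (simp add: smooth_const)

lift_definition plus_sfun :: "'a sfun \<Rightarrow> 'a sfun \<Rightarrow> 'a sfun" is "\<lambda>F G I x. F I x + G I x"
  by (simp add: smooth_add)

lift_definition minus_sfun :: "'a sfun \<Rightarrow> 'a sfun \<Rightarrow> 'a sfun" is "\<lambda>F G I x. F I x - G I x"
  by (simp add: smooth_diff)

lift_definition uminus_sfun :: "'a sfun \<Rightarrow> 'a sfun" is "\<lambda>F I x. - F I x"
  by (simp add: smooth_minus)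

lift_definition scaleR_sfun :: "real \<Rightarrow> 'a sfun \<Rightarrow> 'a sfun" is "\<lambda>c F I x. c * F I x"
  by (simp add: smooth_cmult)

lift_definition times_sfun :: "'a sfun \<Rightarrow> 'a sfun \<Rightarrow> 'a sfun" is
  "\<lambda>F G K x. \<Sum>I\<in>Pow K. gsign I (K - I) * F I x * G (K - I) x"
  by (intro smooth_sum smooth_mult smooth_const) auto

instance
proof
  fix F G H :: "'a sfun" and a b :: real
  show "F + G + H = F + (G + H)"
    by transfer (simp add: fun_eq_iff)
  show "F + G = G + F"
    by transfer (simp add: fun_eq_iff)
  show "0 + F = F"
    by transfer simp
  show "- F + F = 0"
    by transfer simp
  show "F - G = F + - G"
    by transfer simp
  show "a *\<^sub>R (F + G) = a *\<^sub>R F + a *\<^sub>R G"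
    by transfer (simp add: fun_eq_iff algebra_simps)
  show "(a + b) *\<^sub>R F = a *\<^sub>R F + b *\<^sub>R F"
    by transfer (simp add: fun_eq_iff algebra_simps)
  show "a *\<^sub>R b *\<^sub>R F = (a * b) *\<^sub>R F"
    by transfer (simp add: fun_eq_iff algebra_simps)
  show "1 *\<^sub>R F = F"
    by transfer simp
  show "(F + G) * H = F * H + G * H"
    by transfer (simp add: fun_eq_iff algebra_simps sum.distrib)
  show "F * (G + H) = F * G + F * H"
    by transfer (simp add: fun_eq_iff algebra_simps sum.distrib)
  show "a *\<^sub>R F * G = a *\<^sub>R (F * G)"
    by transfer (simp add: fun_eq_iff algebra_simps sum_distrib_left)
  show "F * a *\<^sub>R G = a *\<^sub>R (F * G)"
    by transfer (simp add: fun_eq_iff algebra_simps sum_distrib_left)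
  show "(0::'a sfun) \<noteq> 1"
    by transfer (auto simp: fun_eq_iff)
  show "1 * F = F"
  proof (transfer, intro ext)
    fix F :: "'a set \<Rightarrow> real \<Rightarrow> real" and K x
    have "(\<Sum>I\<in>Pow K. gsign I (K - I) * (if I = {} then 1 else 0) * F (K - I) x) =
        (\<Sum>I\<in>Pow K. if I = {} then F K x else 0)"
      by (rule sum.cong) auto
    then show "(\<Sum>I\<in>Pow K. gsign I (K - I) * (if I = {} then 1 else 0) * F (K - I) x) = F K x"
      by simp
  qed
  show "F * 1 = F"
  proof (transfer, intro ext)
    fix F :: "'a set \<Rightarrow> real \<Rightarrow> real" and K x
    have "(\<Sum>I\<in>Pow K. gsign I (K - I) * F I x * (if K - I = {} then 1 else 0)) =
        (\<Sum>I\<in>Pow K. if I = K then F K x else 0)"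
      by (rule sum.cong) auto
    then show "(\<Sum>I\<in>Pow K. gsign I (K - I) * F I x * (if K - I = {} then 1 else 0)) = F K x"
      by simp
  qed
  show "F * G * H = F * (G * H)"
  proof (transfer, intro ext)
    fix F G H :: "'a set \<Rightarrow> real \<Rightarrow> real" and K x
    have "(\<Sum>I\<in>Pow K. gsign I (K - I) *
          (\<Sum>J\<in>Pow I. gsign J (I - J) * F J x * G (I - J) x) * H (K - I) x) =
        (\<Sum>(I, J)\<in>(SIGMA I:Pow K. Pow I).
          gsign I (K - I) * gsign J (I - J) * F J x * G (I - J) x * H (K - I) x)"
      by (simp add: sum.Sigma sum_distrib_left sum_distrib_right mult.assoc)
    also have "\<dots> = (\<Sum>(I, J)\<in>(SIGMA I:Pow K. Pow (K - I)).
          gsign I (K - I) * gsign J (K - I - J) * F I x * G J x * H (K - I - J) x)"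
    proof (rule sum.reindex_bij_witness[where i = "\<lambda>(I, J). (I \<union> J, I)"
          and j = "\<lambda>(I, J). (J, I - J)"], goal_cases)
      case (5 P)
      then obtain I J where P: "P = (I, J)" and IK: "I \<subseteq> K" and JI: "J \<subseteq> I"
        by auto
      have 1: "K - J - (I - J) = K - I" using JI by blast
      have 2: "K - J = (I - J) \<union> (K - I)" using IK JI by blast
      have "gsign J (K - J) = gsign J (I - J) * gsign J (K - I)"
        unfolding 2 by (rule gsign_Un_right) blast
      moreover have "gsign I (K - I) = gsign J (K - I) * gsign (I - J) (K - I)"
        using gsign_Un_left[of J "I - J" "K - I"] JI by (simp add: Un_absorb1)
      ultimately show ?case
        by (simp add: P 1)
    qed auto
    also have "\<dots> = (\<Sum>I\<in>Pow K. gsign I (K - I) * F I x *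
          (\<Sum>J\<in>Pow (K - I). gsign J (K - I - J) * G J x * H (K - I - J) x))"
      by (simp add: sum.Sigma sum_distrib_left mult.assoc mult.left_commute)
    finally show "(\<Sum>I\<in>Pow K. gsign I (K - I) *
          (\<Sum>J\<in>Pow I. gsign J (I - J) * F J x * G (I - J) x) * H (K - I) x) =
        (\<Sum>I\<in>Pow K. gsign I (K - I) * F I x *
          (\<Sum>J\<in>Pow (K - I). gsign J (K - I - J) * G J x * H (K - I - J) x))" .
  qed
qed

end

lift_definition xcoord :: "'n::{finite,linorder} sfun" is "\<lambda>I x. if I = {} then x else 0"
proof -
  show "smooth (\<lambda>x. if I = {} then x else 0)" for I :: "'n set"
    by (cases "I = {}") (simp_all add: smooth_const smooth_ident)
qed

lift_definition theta :: "'n::{finite,linorder} \<Rightarrow> 'n sfun" is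
  "\<lambda>i I x. if I = {i} then 1 else 0"
  by (simp add: smooth_const)

lift_definition dx :: "'n::{finite,linorder} sfun \<Rightarrow> 'n sfun" is "\<lambda>F I. deriv (F I)"
  by (simp add: smooth_deriv)

text \<open>The left derivative \<open>\<partial>\<close> with respect to \<open>\<theta>\<^sub>i\<close>.\<close>

lift_definition dtheta :: "'n::{finite,linorder} \<Rightarrow> 'n sfun \<Rightarrow> 'n sfun" is
  "\<lambda>i F I x. if i \<in> I then 0 else (-1) ^ card {j \<in> I. j < i} * F (insert i I) x"
proof -
  fix i I and F :: "'n set \<Rightarrow> real \<Rightarrow> real"
  assume "\<And>I. smooth (F I)"
  then show "smooth (\<lambda>x. if i \<in> I then 0 else (-1) ^ card {j \<in> I. j < i} * F (insert i I) x)"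
    by (cases "i \<in> I") (simp_all add: smooth_const smooth_cmult)
qed

text \<open>
  Homogeneous component of parity \<open>p\<close>; only \<open>p\<close> modulo 2 matters. Formulas with signs such
  as \<open>(-1)\<^sup>F\<close> are given in the literature for homogeneous arguments; here they are
  extended (multi)linearly by summing over the components of parity 0 and 1.
\<close>

lift_definition hpart :: "nat \<Rightarrow> 'n::{finite,linorder} sfun \<Rightarrow> 'n sfun" is
  "\<lambda>p F I x. if even (card I + p) then F I x else 0"
proof -
  fix p I and F :: "'n set \<Rightarrow> real \<Rightarrow> real"
  assume "\<And>I. smooth (F I)"
  then show "smooth (\<lambda>x. if even (card I + p) then F I x else 0)"
    by (cases "even (card I + p)") (simp_all add: smooth_const)
qed

definition eta :: "'n::{finite,linorder} \<Rightarrow> 'n sfun \<Rightarrow> 'n sfun" where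
  "eta i F = dtheta i F - theta i * dx F"


section \<open>Operators\<close>

text \<open>
  Operators form a real vector space pointwise. Note that \<open>*\<close> on operators would be the
  pointwise product, which is never used; composition is \<open>\<circ>\<close>.
\<close>

instantiation "fun" :: (type, real_vector) real_vector
begin

definition scaleR_fun :: "real \<Rightarrow> ('a \<Rightarrow> 'b) \<Rightarrow> 'a \<Rightarrow> 'b" where
  "scaleR_fun c f = (\<lambda>x. c *\<^sub>R f x)"

instance
  by standard (auto simp: scaleR_fun_def fun_eq_iff algebra_simps)

end

type_synonym 'n operator = "'n sfun \<Rightarrow> 'n sfun"

definition mult_op :: "'n::{finite,linorder} sfun \<Rightarrow> 'n operator" where
  "mult_op F = (\<lambda>G. F * G)"

text \<open>Composition \<open>D i\<^sub>1 \<circ> D i\<^sub>2 \<circ> \<dots>\<close> over a set of indices \<open>i\<^sub>1 < i\<^sub>2 < \<dots>\<close>.\<close>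

definition ordered_comp :: "('n::{finite,linorder} \<Rightarrow> 'n operator) \<Rightarrow> 'n set \<Rightarrow> 'n operator" where
  "ordered_comp D I = foldr (\<lambda>i A. D i \<circ> A) (sorted_list_of_set I) id"

definition diff_ops :: "'n::{finite,linorder} operator set" where
  "diff_ops = {A. \<exists>(N::nat) a. A = (\<Sum>j<N. \<Sum>I\<in>UNIV. mult_op (a j I) \<circ> (dx ^^ j) \<circ> ordered_comp dtheta I)}"

definition op_part :: "nat \<Rightarrow> 'n::{finite,linorder} operator \<Rightarrow> 'n operator" where
  "op_part p A = (\<Sum>q\<in>{0,1}. hpart (p + q) \<circ> A \<circ> hpart q)"


section \<open>Contact vector fields, osp(n|2) and the modules of densities and operators\<close>

definition contact_field :: "'n::{finite,linorder} sfun \<Rightarrow> 'n operator" where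
  "contact_field F = (mult_op F \<circ> dx)
     - (1/2) *\<^sub>R (\<Sum>p\<in>{0,1}. (-1) ^ p *\<^sub>R (\<Sum>i\<in>UNIV. mult_op (eta i (hpart p F)) \<circ> eta i))"

definition contact_bracket :: "'n::{finite,linorder} sfun \<Rightarrow> 'n sfun \<Rightarrow> 'n sfun" where
  "contact_bracket F G = F * dx G - dx F * G
     - (1/2) *\<^sub>R (\<Sum>p\<in>{0,1}. (-1) ^ p *\<^sub>R (\<Sum>i\<in>UNIV. eta i (hpart p F) * eta i G))"

definition osp :: "'n::{finite,linorder} operator set" where
  "osp = span (contact_field ` ({1, xcoord, xcoord ^ 2} \<union> range theta
     \<union> range (\<lambda>i. xcoord * theta i) \<union> {theta i * theta j |i j. i < j}))"

text \<open>
  \<open>F \<mapsto> X\<^sub>F\<close> is an injective homomorphism from the contact bracket to the supercommutator.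
  Cochains on osp(n|2) are therefore written as functions of \<open>F\<close>, where \<open>F\<close> runs over the
  following set, and \<open>[X\<^sub>F, X\<^sub>G]\<close> is entered as the contact bracket.
\<close>

definition osp_fun :: "'n::{finite,linorder} sfun set" where
  "osp_fun = {F. contact_field F \<in> osp}"

definition lie_density :: "real \<Rightarrow> 'n::{finite,linorder} sfun \<Rightarrow> 'n operator" where
  "lie_density l F = contact_field F + l *\<^sub>R mult_op (dx F)"

definition op_action ::
  "real \<Rightarrow> real \<Rightarrow> 'n::{finite,linorder} sfun \<Rightarrow> 'n operator \<Rightarrow> 'n operator" where
  "op_action l m F A = (\<Sum>p\<in>{0,1}. \<Sum>q\<in>{0,1}.
     (lie_density m (hpart p F) \<circ> op_part q A)
       - (-1) ^ (p * q) *\<^sub>R (op_part q A \<circ> lie_density l (hpart p F)))"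


section \<open>Cohomology of osp(n|2) with values in differential operators\<close>

type_synonym 'n cochain = "'n sfun \<Rightarrow> 'n operator"

definition cochain_part :: "nat \<Rightarrow> 'n::{finite,linorder} cochain \<Rightarrow> 'n cochain" where
  "cochain_part p f F = (\<Sum>q\<in>{0,1}. op_part (p + q) (f (hpart q F)))"

definition delta0 :: "real \<Rightarrow> real \<Rightarrow> 'n::{finite,linorder} operator \<Rightarrow> 'n cochain" where
  "delta0 l m A F = (\<Sum>p\<in>{0,1}. \<Sum>q\<in>{0,1}.
     (-1) ^ (q * p) *\<^sub>R op_action l m (hpart q F) (op_part p A))"

definition delta1 ::
  "real \<Rightarrow> real \<Rightarrow> 'n::{finite,linorder} cochain \<Rightarrow> 'n sfun \<Rightarrow> 'n sfun \<Rightarrow> 'n operator" where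
  "delta1 l m f F G = (\<Sum>p\<in>{0,1}. \<Sum>q\<in>{0,1}. \<Sum>r\<in>{0,1}.
       (-1) ^ (q * p) *\<^sub>R op_action l m (hpart q F) (cochain_part p f (hpart r G))
       - (-1) ^ (r * (q + p)) *\<^sub>R op_action l m (hpart r G) (cochain_part p f (hpart q F)))
     - f (contact_bracket F G)"

text \<open>
  Only the values of a cochain on \<^const>\<open>osp_fun\<close> are meaningful; the relation
  \<open>cohomologous\<close> below ignores all other values.
\<close>

definition cochains1 :: "'n::{finite,linorder} cochain set" where
  "cochains1 = {f. (\<forall>F\<in>osp_fun. f F \<in> diff_ops) \<and>
     (\<forall>F\<in>osp_fun. \<forall>G\<in>osp_fun. f (F + G) = f F + f G) \<and>
     (\<forall>c. \<forall>F\<in>osp_fun. f (c *\<^sub>R F) = c *\<^sub>R f F)}"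

definition cocycles1 :: "real \<Rightarrow> real \<Rightarrow> 'n::{finite,linorder} cochain set" where
  "cocycles1 l m = {f \<in> cochains1. \<forall>F\<in>osp_fun. \<forall>G\<in>osp_fun. delta1 l m f F G = 0}"

definition cohomologous :: "real \<Rightarrow> real \<Rightarrow> ('n::{finite,linorder} cochain \<times> 'n cochain) set" where
  "cohomologous l m = {(f, g). f \<in> cocycles1 l m \<and> g \<in> cocycles1 l m \<and>
     (\<exists>B\<in>diff_ops. \<forall>F\<in>osp_fun. f F - g F = delta0 l m B F)}"

definition H1 :: "real \<Rightarrow> real \<Rightarrow> 'n::{finite,linorder} cochain set set" where
  "H1 l m = cocycles1 l m // cohomologous l m"

definition cohomology_class ::
  "real \<Rightarrow> real \<Rightarrow> 'n::{finite,linorder} cochain \<Rightarrow> 'n cochain set" where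
  "cohomology_class l m f = cohomologous l m `` {f}"

text \<open>
  Linear combinations of classes are the classes of the linear combinations of cocycles, so
  the bijection below is the linear isomorphism from the plane onto \<open>H1\<close> given by the basis.
\<close>

definition classes_form_basis ::
  "real \<Rightarrow> real \<Rightarrow> 'n::{finite,linorder} cochain \<Rightarrow> 'n cochain \<Rightarrow> bool" where
  "classes_form_basis l m f g \<longleftrightarrow> f \<in> cocycles1 l m \<and> g \<in> cocycles1 l m \<and>
     bij_betw (\<lambda>(a, b). cohomology_class l m (a *\<^sub>R f + b *\<^sub>R g)) (UNIV :: (real \<times> real) set) (H1 l m)"


section \<open>The operators and cocycles at the resonant weights\<close>

definition lambda_wt :: "nat \<Rightarrow> nat \<Rightarrow> real" where
  "lambda_wt n k = - ((real k + real n - 2) / 2)"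

definition mu_wt :: "nat \<Rightarrow> real" where
  "mu_wt k = real k / 2"

definition A_op :: "nat \<Rightarrow> 'n::{finite,linorder} operator" where
  "A_op k = ordered_comp eta UNIV \<circ> (dx ^^ (k - 1))"

definition Delta1 :: "'n::{finite,linorder} operator \<Rightarrow> 'n cochain" where
  "Delta1 A F = - (A \<circ> mult_op (dx F))"

definition Delta2 :: "'n::{finite,linorder} operator \<Rightarrow> 'n cochain" where
  "Delta2 A F = (\<Sum>p\<in>{0,1}. \<Sum>q\<in>{0,1}.
     (-1) ^ (p * q) *\<^sub>R (mult_op (dx (hpart q F)) \<circ> op_part p A))"

definition h :: "nat \<Rightarrow> 'n::{finite,linorder} cochain" where
  "h k F = (\<Sum>p\<in>{0,1}. (-1) ^ (CARD('n) * p) *\<^sub>R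
     (mult_op (dx (hpart p F)) \<circ> ordered_comp eta UNIV \<circ> (dx ^^ (k - 1))))"

text \<open>
  The exponent \<open>card {j. j < i}\<close> is \<open>i - 1\<close> for the \<open>i\<close>-th index. For \<open>k = 1\<close> the first
  term vanishes because of its coefficient, so the truncation of \<open>k - 2\<close> does no harm.
\<close>

definition h_tilde :: "nat \<Rightarrow> 'n::{finite,linorder} cochain" where
  "h_tilde k F =
     (real k - 1) *\<^sub>R (mult_op (dx (dx F)) \<circ> ordered_comp eta UNIV \<circ> (dx ^^ (k - 2)))
     + (\<Sum>p\<in>{0,1}. (-1) ^ ((CARD('n) - 1) * p) *\<^sub>R (\<Sum>i\<in>UNIV. (-1) ^ card {j. j < i} *\<^sub>R
         (mult_op (eta i (dx (hpart p F))) \<circ> ordered_comp eta (UNIV - {i}) \<circ> (dx ^^ (k - 1)))))"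

end

theory Submission
  imports Defs
begin

text \<open>
  All operators live in the associative algebra of linear endomorphisms of the superfunctions, and
  signs are absorbed by conjugation with the parity operator. A cocycle can be made to vanish on the
  fields of \<open>1\<close> and \<open>\<theta>\<^sub>i\<close> (a Poincare lemma). Its values on the stabiliser of the origin are then
  determined by their composition with evaluation at the origin, that is by linear forms on
  polynomials. For these forms the Euler field confines everything to one weight, the Casimir operator of
  so(n) kills the restriction to so(n), which needs n at least 3, and only two parameters survive;
  they are realised by the two given cocycles. The same description shows that \<open>A\<^sub>k\<close> is invariant.
  Differentiating its coboundary with respect to the weights then gives the cocycles and the formula
  for \<open>\<delta>\<^sup>\<sigma>\<^sup>,\<^sup>\<tau>A\<^sub>k\<close>.
\<close>

section \<open>Monomials, parity and the derivation rules\<close>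

text \<open>Two coincidences at the weights of index k shape the argument. The Euler field acts on
  the form dual to x^j theta_I by \<open>wt\<close> = m - l - j - |I|/2, and x theta_i multiplies by
  theta_i with the factor (j + |I|)/2 + l. At l = -(k+n-2)/2 and m = k/2 the first number vanishes
  on x^(k-1) times the product of all theta_a, the second on x^(k-1) times the product of all
  theta_a with a \<noteq> i. Hence the form dual to the top monomial is invariant, which gives A_k,
  and no coboundary changes the value of a cocycle on the Euler field at the first monomial or on x
  theta_i at the second: these are the two parameters. The obstacle for so(n) is that its Casimir
  operator vanishes on the empty and on the full product of the theta_a. There the form is zero for
  another reason: theta_c theta_d is, up to a factor, the bracket of two rotations through a third
  index, and this uses n \<ge> 3. Operators supercommuting with the fields of 1 and theta_i have
  coboundaries that respect the normalisation, and they correspond to forms of finite order on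
  monomials. So after the normalisation every primitive is found by prescribing such a form.\<close>

lemma smooth_power: "smooth f \<Longrightarrow> smooth (\<lambda>x. f x ^ p)"
  by (induction p) (simp_all add: smooth_const smooth_mult)

text \<open>The sign of carrying theta_i from the left to its place in theta_I. It is
  \<open>gsign {i} I\<close>, and the same sign governs the left derivative.\<close>

definition isgn :: "'n::linorder \<Rightarrow> 'n set \<Rightarrow> real" where
  "isgn i I = (-1) ^ card {j \<in> I. j < i}"

lemma isgn_square [simp]: "isgn i I * isgn i I = 1"
  by (simp add: isgn_def flip: power_add)

lemma isgn_square_left [simp]: "isgn i I * (isgn i I * a) = a"
  by (simp flip: mult.assoc)

lemma isgn_nonzero [simp]: "isgn i I \<noteq> 0"
  by (simp add: isgn_def)

lemma isgn_empty [simp]: "isgn i {} = 1"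
  by (simp add: isgn_def)

lemma isgn_insert [simp]: "isgn i (insert i I) = isgn i I"
  unfolding isgn_def by (rule arg_cong[where f = "\<lambda>S. (-1) ^ card S"]) auto

lemma isgn_remove [simp]: "isgn i (I - {i}) = isgn i I"
  unfolding isgn_def by (rule arg_cong[where f = "\<lambda>S. (-1) ^ card S"]) auto

lemma isgn_insert_notin:
  fixes i :: "'n::{finite,linorder}"
  assumes "j \<notin> I"
  shows "isgn i (insert j I) = (if j < i then - isgn i I else isgn i I)"
proof -
  have "{a \<in> insert j I. a < i} = (if j < i then insert j {a \<in> I. a < i} else {a \<in> I. a < i})"
    by auto
  then show ?thesis
    using assms by (simp add: isgn_def)
qed

lemma isgn_Un:
  fixes i :: "'n::{finite,linorder}"
  assumes "I \<inter> J = {}"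
  shows "isgn i (I \<union> J) = isgn i I * isgn i J"
proof -
  have "{j \<in> I \<union> J. j < i} = {j \<in> I. j < i} \<union> {j \<in> J. j < i}"
    by auto
  moreover have "{j \<in> I. j < i} \<inter> {j \<in> J. j < i} = {}"
    using assms by auto
  ultimately show ?thesis
    by (simp add: isgn_def card_Un_disjoint power_add)
qed

lemma gsign_singleton_left: "gsign {i} J = isgn i J"
proof -
  have "{(a, j). a \<in> {i} \<and> j \<in> J \<and> j < a} = Pair i ` {j \<in> J. j < i}"
    by auto
  then show ?thesis
    by (simp add: gsign_def isgn_def card_image inj_on_def)
qed

text \<open>Each pair in I x J is an inversion in exactly one of the two orders, so the two
  inversion numbers add up to card I * card J.\<close>

lemma gsign_swap:
  assumes "I \<inter> J = {}"
  shows "gsign J I = (-1) ^ (card I * card J) * gsign I J"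
proof -
  let ?A = "{(i, j). i \<in> I \<and> j \<in> J \<and> j < i}" and ?B = "{(i, j). i \<in> I \<and> j \<in> J \<and> i < j}"
  have "?A \<union> ?B = I \<times> J"
    using assms by (auto simp: not_less_iff_gr_or_eq)
  moreover have "?A \<inter> ?B = {}"
    by auto
  ultimately have "card I * card J = card ?A + card ?B"
    using card_Un_disjoint[of ?A ?B] by (simp add: card_cartesian_product)
  moreover have "card {(j, i). j \<in> J \<and> i \<in> I \<and> i < j} = card ?B"
    by (rule bij_betw_same_card[where f = prod.swap]) (auto simp: bij_betw_def inj_on_def image_iff)
  ultimately show ?thesis
    by (simp add: gsign_def power_add)
qed

lemma gsign_singleton_right:
  assumes "i \<notin> I"
  shows "gsign I {i} = (-1) ^ card I * isgn i I"
  using gsign_swap[of "{i}" I] assms by (simp add: gsign_singleton_left)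

lemma gsign_insert_left:
  assumes "i \<notin> I"
  shows "gsign (insert i I) J = isgn i J * gsign I J"
  using gsign_Un_left[of "{i}" I J] assms by (simp add: gsign_singleton_left)

lemma gsign_insert_right:
  assumes "i \<notin> I" "i \<notin> J"
  shows "gsign I (insert i J) = (-1) ^ card I * isgn i I * gsign I J"
  using gsign_Un_right[of "{i}" J I] assms by (simp add: gsign_singleton_right)

section \<open>Coefficients, monomials and the grading automorphism\<close>

lemma sfun_eqI: "(\<And>I x. coef F I x = coef G I x) \<Longrightarrow> F = G"
  by (metis coef_inject ext)

lemma smooth_coef: "smooth (coef F I)"
  using coef by blast

lemma coef_zero [simp]: "coef 0 I x = 0"
  and coef_one: "coef 1 I x = (if I = {} then 1 else 0)"
  and coef_add [simp]: "coef (F + G) I x = coef F I x + coef G I x"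
  and coef_diff [simp]: "coef (F - G) I x = coef F I x - coef G I x"
  and coef_minus [simp]: "coef (- F) I x = - coef F I x"
  and coef_scaleR [simp]: "coef (c *\<^sub>R F) I x = c * coef F I x"
  and coef_mult: "coef (F * G) I x = (\<Sum>J\<in>Pow I. gsign J (I - J) * coef F J x * coef G (I - J) x)"
  by (transfer, simp)+

lemma coef_sum [simp]: "coef (\<Sum>a\<in>S. F a) I x = (\<Sum>a\<in>S. coef (F a) I x)"
  by (induction S rule: infinite_finite_induct) simp_all

lemma coef_xcoord: "coef xcoord I x = (if I = {} then x else 0)"
  by transfer simp

lemma coef_theta: "coef (theta i) I x = (if I = {i} then 1 else 0)"
  by transfer simp

lemma coef_dx: "coef (dx F) I = deriv (coef F I)"
  by transfer simp

lemma coef_dtheta: "coef (dtheta i F) I x = (if i \<in> I then 0 else isgn i I * coef F (insert i I) x)"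
  unfolding isgn_def by transfer simp

lemma coef_hpart: "coef (hpart p F) I x = (if even (card I + p) then coef F I x else 0)"
  by transfer simp

text \<open>The monomial x^p theta_J. Differential operators are determined by their values on
  monomials (\<open>dops_zeroI\<close>), invariant ones even by the values at the origin
  (\<open>invar_zeroI\<close>), so cocycles are computed there.\<close>

lift_definition smon :: "nat \<Rightarrow> 'n::{finite,linorder} set \<Rightarrow> 'n sfun" is
  "\<lambda>p J I x. if I = J then x ^ p else 0"
proof -
  show "smooth (\<lambda>x. if I = J then x ^ p else 0)" for p and I J :: "'n set"
    by (cases "I = J") (simp_all add: smooth_const smooth_power smooth_ident)
qed

lemma coef_smon: "coef (smon p J) I x = (if I = J then x ^ p else 0)"
  by transfer simp

text \<open>The grading automorphism (-1)^F. The parity components are its spectral projections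
  (\<open>hpart_eq\<close>), so sums over parities turn into expressions in one operator.\<close>

lift_definition par :: "'n::{finite,linorder} sfun \<Rightarrow> 'n sfun" is "\<lambda>F I x. (-1) ^ card I * F I x"
  by (simp add: smooth_cmult)

lemma coef_par: "coef (par F) I x = (-1) ^ card I * coef F I x"
  by transfer simp

lemma par_simps [simp]:
  "par (F + G) = par F + par G" "par (F - G) = par F - par G" "par (- F) = - par F"
  "par (c *\<^sub>R F) = c *\<^sub>R par F" "par 0 = 0" "par 1 = 1"
  by (rule sfun_eqI; simp add: coef_par coef_one algebra_simps)+

lemma par_par [simp]: "par (par F) = F"
  by (rule sfun_eqI) (simp add: coef_par flip: mult.assoc power_add)

lemma par_sum [simp]: "par (\<Sum>a\<in>S. F a) = (\<Sum>a\<in>S. par (F a))"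
  by (induction S rule: infinite_finite_induct) simp_all

lemma par_mult [simp]: "par (F * G) = par F * par G"
proof (rule sfun_eqI)
  fix I x
  have "(-1) ^ card I * (gsign J (I - J) * coef F J x * coef G (I - J) x) =
      gsign J (I - J) * ((-1) ^ card J * coef F J x) * ((-1) ^ card (I - J) * coef G (I - J) x)"
    if "J \<subseteq> I" for J
  proof -
    have "card I = card J + card (I - J)"
      using that by (simp add: card_Diff_subset card_mono)
    then show ?thesis
      by (simp add: power_add)
  qed
  then show "coef (par (F * G)) I x = coef (par F * par G) I x"
    unfolding coef_par coef_mult sum_distrib_left by (intro sum.cong) auto
qed

lemma hpart_eq: "hpart p F = (1/2) *\<^sub>R (F + (-1) ^ p *\<^sub>R par F)"
  by (rule sfun_eqI) (auto simp: coef_hpart coef_par uminus_power_if)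

lemma par_theta [simp]: "par (theta i) = - theta i"
  by (rule sfun_eqI) (simp add: coef_par coef_theta)

lemma par_xcoord [simp]: "par xcoord = xcoord"
  by (rule sfun_eqI) (simp add: coef_par coef_xcoord)

lemma par_smon [simp]: "par (smon p J) = (-1) ^ card J *\<^sub>R smon p J"
  by (rule sfun_eqI) (simp add: coef_par coef_smon)

text \<open>Substituting complements J to I - J in the product formula brings both orders to the
  same summation; the sign of supercommutativity is then the exponent card J * card (I - J), which
  is easily read off when one factor is even or odd.\<close>

lemma mult_reorder:
  "coef (G * F) I x =
    (\<Sum>J\<in>Pow I. (-1) ^ (card J * card (I - J)) * gsign J (I - J) * coef F J x * coef G (I - J) x)"
  unfolding coef_mult
proof (rule sum.reindex_bij_witness[where i = "\<lambda>J. I - J" and j = "\<lambda>J. I - J"], goal_cases)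
  case (5 J)
  then have "I - (I - J) = J" "gsign J (I - J) = (-1) ^ (card (I - J) * card J) * gsign (I - J) J"
    using gsign_swap[of "I - J" J] by auto
  then show ?case
    by (simp flip: mult.assoc power_add)
qed auto

lemma even_mult_commute: "par F = F \<Longrightarrow> F * G = G * F"
proof (rule sfun_eqI)
  fix I x
  assume F: "par F = F"
  have "coef F J x = 0" if "odd (card J)" for J
    using F that coef_par[of F J x] by simp
  then show "coef (F * G) I x = coef (G * F) I x"
    unfolding mult_reorder[of G F] by (auto simp: coef_mult uminus_power_if intro!: sum.cong)
qed

lemma odd_mult_commute: "par F = - F \<Longrightarrow> F * G = par G * F"
proof (rule sfun_eqI)
  fix I x
  assume F: "par F = - F"
  have "coef F J x = 0" if "even (card J)" for J
    using F that coef_par[of F J x] by simp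
  then show "coef (F * G) I x = coef (par G * F) I x"
    unfolding mult_reorder[of "par G" F] by (auto simp: coef_mult coef_par uminus_power_if intro!: sum.cong)
qed

lemma xcoord_commute: "F * xcoord = xcoord * F"
  using even_mult_commute[of xcoord F] by simp

section \<open>Derivation rules for \<open>dx\<close> and \<open>dtheta\<close>\<close>

lemma coef_differentiable: "coef F I field_differentiable at x"
  using smooth_coef smooth_differentiable by blast

lemma coef_has_deriv: "(coef F I has_field_derivative coef (dx F) I x) (at x)"
  by (simp add: DERIV_deriv_iff_field_differentiable coef_differentiable coef_dx)

lemma dx_eqI: "(\<And>I x. (coef F I has_field_derivative coef G I x) (at x)) \<Longrightarrow> dx F = G"
  by (rule sfun_eqI) (simp add: coef_dx DERIV_imp_deriv)

lemma coef_add_fun: "coef (F + G) I = (\<lambda>x. coef F I x + coef G I x)"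
  and coef_scaleR_fun: "coef (c *\<^sub>R F) I = (\<lambda>x. c * coef F I x)"
  and coef_par_fun: "coef (par F) I = (\<lambda>x. (-1) ^ card I * coef F I x)"
  and coef_mult_fun: "coef (F * G) I = (\<lambda>x. \<Sum>J\<in>Pow I. gsign J (I - J) * coef F J x * coef G (I - J) x)"
  and coef_smon_fun: "coef (smon p J) I = (\<lambda>x. if I = J then x ^ p else 0)"
  and coef_dtheta_fun: "coef (dtheta i F) I =
    (\<lambda>x. (if i \<in> I then 0 else isgn i I) * coef F (insert i I) x)"
  by (auto simp: coef_par coef_mult coef_smon coef_dtheta)

lemma dx_add [simp]: "dx (F + G) = dx F + dx G"
  by (rule dx_eqI) (auto simp: coef_add_fun intro!: derivative_eq_intros coef_has_deriv)

lemma dx_scaleR [simp]: "dx (c *\<^sub>R F) = c *\<^sub>R dx F"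
  by (rule dx_eqI) (auto simp: coef_scaleR_fun intro!: derivative_eq_intros coef_has_deriv)

lemma dx_par: "dx (par F) = par (dx F)"
  by (rule dx_eqI) (auto simp: coef_par_fun intro!: derivative_eq_intros coef_has_deriv)

lemma dx_mult: "dx (F * G) = dx F * G + F * dx G"
  by (rule dx_eqI)
    (auto simp: coef_mult_fun sum.distrib[symmetric] algebra_simps
      intro!: derivative_eq_intros coef_has_deriv sum.cong)

lemma dx_dtheta: "dx (dtheta i F) = dtheta i (dx F)"
  by (rule dx_eqI)
    (auto simp: coef_dtheta_fun intro!: derivative_eq_intros coef_has_deriv)

lemma dx_minus [simp]: "dx (- F) = - dx F"
  using dx_scaleR[of "-1" F] by simp

lemma dx_diff [simp]: "dx (F - G) = dx F - dx G"
  using dx_add[of F "- G"] by simp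

lemma dx_zero [simp]: "dx 0 = 0"
  using dx_scaleR[of 0 0] by simp

lemma dx_sum [simp]: "dx (\<Sum>a\<in>S. F a) = (\<Sum>a\<in>S. dx (F a))"
  by (induction S rule: infinite_finite_induct) simp_all

lemma dx_smon [simp]: "dx (smon p J) = real p *\<^sub>R smon (p - 1) J"
  by (rule dx_eqI) (auto simp: coef_smon_fun intro!: derivative_eq_intros)

lemma dtheta_simps [simp]:
  "dtheta i (F + G) = dtheta i F + dtheta i G" "dtheta i (F - G) = dtheta i F - dtheta i G"
  "dtheta i (- F) = - dtheta i F" "dtheta i (c *\<^sub>R F) = c *\<^sub>R dtheta i F" "dtheta i 0 = 0"
  by (rule sfun_eqI; simp add: coef_dtheta algebra_simps)+

lemma sum_Pow_insert:
  assumes "finite S" "i \<notin> S"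
  shows "(\<Sum>J\<in>Pow (insert i S). f J) = (\<Sum>J\<in>Pow S. f J) + (\<Sum>J\<in>Pow S. f (insert i J))"
proof -
  have "(\<Sum>J\<in>insert i ` Pow S. f J) = (\<Sum>J\<in>Pow S. f (insert i J))"
    by (rule sum.reindex_cong[where l = "insert i"]) (use assms in \<open>auto simp: inj_on_def\<close>)
  moreover have "Pow S \<inter> insert i ` Pow S = {}"
    using assms by auto
  ultimately show ?thesis
    using assms by (simp add: Pow_insert sum.union_disjoint)
qed

text \<open>If i is not in K, the coefficient at K comes from subsets of insert i K: those
  containing i give the derivative of the first factor, the others that of the second. If i is in K,
  the left side is zero, and on the right the terms of J and insert i J cancel.\<close>

lemma dtheta_mult: "dtheta i (F * G) = dtheta i F * G + par F * dtheta i G"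
proof (rule sfun_eqI)
  fix K x
  show "coef (dtheta i (F * G)) K x = coef (dtheta i F * G + par F * dtheta i G) K x"
  proof (cases "i \<in> K")
    case False
    have 1: "isgn i K * (gsign J (insert i K - J) * coef F J x * coef G (insert i K - J) x) =
        gsign J (K - J) * coef (par F) J x * coef (dtheta i G) (K - J) x" if "J \<subseteq> K" for J
    proof -
      have "insert i K - J = insert i (K - J)" "i \<notin> J" "i \<notin> K - J" "isgn i K = isgn i J * isgn i (K - J)"
        using that False isgn_Un[of J "K - J" i] by (auto simp: Un_absorb1)
      then show ?thesis
        by (simp add: gsign_insert_right coef_par coef_dtheta)
    qed
    have 2: "isgn i K * (gsign (insert i J) (insert i K - insert i J) * coef F (insert i J) x *
          coef G (insert i K - insert i J) x) =
        gsign J (K - J) * coef (dtheta i F) J x * coef G (K - J) x" if "J \<subseteq> K" for J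
    proof -
      have "insert i K - insert i J = K - J" "i \<notin> J" "isgn i K = isgn i (K - J) * isgn i J"
        using that False isgn_Un[of "K - J" J i] by (auto simp: Un_absorb2)
      then show ?thesis
        by (simp add: gsign_insert_left coef_dtheta)
    qed
    have "coef (dtheta i (F * G)) K x =
        (\<Sum>J\<in>Pow K. isgn i K * (gsign J (insert i K - J) * coef F J x * coef G (insert i K - J) x)) +
        (\<Sum>J\<in>Pow K. isgn i K * (gsign (insert i J) (insert i K - insert i J) *
          coef F (insert i J) x * coef G (insert i K - insert i J) x))"
      unfolding coef_dtheta coef_mult sum_Pow_insert[OF finite False]
      using False by (simp add: distrib_left sum_distrib_left)
    also have "\<dots> = coef (dtheta i F * G + par F * dtheta i G) K x"
      unfolding coef_add coef_mult
      by (subst add.commute) (intro arg_cong2[where f = "(+)"] sum.cong; simp only: Pow_iff 1 2)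
    finally show ?thesis .
  next
    case True
    define L where "L = K - {i}"
    have K: "K = insert i L" "i \<notin> L"
      using True by (auto simp: L_def)
    have 1: "gsign J (insert i L - J) * coef (dtheta i F) J x * coef G (insert i L - J) x =
        - (gsign (insert i J) (insert i L - insert i J) * coef (par F) (insert i J) x *
            coef (dtheta i G) (insert i L - insert i J) x)" if "J \<subseteq> L" for J
    proof -
      have "insert i L - J = insert i (L - J)" "i \<notin> J" "i \<notin> L - J" "insert i L - insert i J = L - J"
        using that K by auto
      then show ?thesis
        by (simp add: gsign_insert_right gsign_insert_left coef_par coef_dtheta)
    qed
    have 2: "coef (dtheta i F) (insert i J) x = 0" "coef (dtheta i G) (insert i L - J) x = 0"
      if "J \<subseteq> L" for J
      using that K by (auto simp: coef_dtheta)
    have "coef (dtheta i F * G) K x = (\<Sum>J\<in>Pow L.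
        gsign J (insert i L - J) * coef (dtheta i F) J x * coef G (insert i L - J) x)"
      unfolding K(1) coef_mult sum_Pow_insert[OF finite K(2)] by (simp add: 2)
    also have "\<dots> = - (\<Sum>J\<in>Pow L. gsign (insert i J) (insert i L - insert i J) *
        coef (par F) (insert i J) x * coef (dtheta i G) (insert i L - insert i J) x)"
      unfolding sum_negf[symmetric] by (rule sum.cong) (simp_all only: Pow_iff 1)
    also have "\<dots> = - coef (par F * dtheta i G) K x"
      unfolding K(1) coef_mult sum_Pow_insert[OF finite K(2)] using 2 by simp
    finally show ?thesis
      using True by (simp add: coef_dtheta)
  qed
qed

lemma par_dtheta: "par (dtheta i F) = - dtheta i (par F)"
  by (rule sfun_eqI) (simp add: coef_par coef_dtheta)

lemma dtheta_dtheta: "dtheta i (dtheta j F) = - dtheta j (dtheta i F)"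
proof (rule sfun_eqI)
  fix K x
  show "coef (dtheta i (dtheta j F)) K x = coef (- dtheta j (dtheta i F)) K x"
    by (cases i j rule: linorder_cases)
      (auto simp: coef_dtheta isgn_insert_notin insert_commute)
qed

section \<open>Coordinates: multiplication, derivatives, monomials\<close>

lemma coef_theta_mult: "coef (theta i * F) K x = (if i \<in> K then isgn i K * coef F (K - {i}) x else 0)"
proof (cases "i \<in> K")
  case True
  have "coef (theta i * F) K x =
      (\<Sum>J\<in>Pow K. if J = {i} then isgn i K * coef F (K - {i}) x else 0)"
    unfolding coef_mult by (rule sum.cong) (auto simp: coef_theta gsign_singleton_left)
  with True show ?thesis by simp
next
  case False
  then have "coef (theta i * F) K x = 0"
    unfolding coef_mult by (intro sum.neutral) (auto simp: coef_theta)
  with False show ?thesis by simp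
qed

lemma coef_xcoord_mult: "coef (xcoord * F) K x = x * coef F K x"
proof -
  have "coef (xcoord * F) K x = (\<Sum>J\<in>Pow K. if J = {} then x * coef F K x else 0)"
    unfolding coef_mult by (rule sum.cong) (auto simp: coef_xcoord)
  then show ?thesis by simp
qed

lemma dx_theta [simp]: "dx (theta i) = 0"
  by (rule dx_eqI) (auto simp: coef_theta[abs_def] intro!: derivative_eq_intros)

lemma dx_one [simp]: "dx 1 = 0"
  by (rule dx_eqI) (auto simp: coef_one[abs_def] intro!: derivative_eq_intros)

lemma dx_xcoord [simp]: "dx xcoord = 1"
  by (rule dx_eqI) (auto simp: coef_xcoord[abs_def] coef_one intro!: derivative_eq_intros)

lemma dtheta_theta: "dtheta i (theta j) = (if i = j then 1 else 0)"
  by (rule sfun_eqI) (auto simp: coef_dtheta coef_theta coef_one)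

lemma dtheta_one [simp]: "dtheta i 1 = 0"
  by (rule sfun_eqI) (auto simp: coef_dtheta coef_one)

lemma dtheta_xcoord [simp]: "dtheta i xcoord = 0"
  by (rule sfun_eqI) (auto simp: coef_dtheta coef_xcoord)

lemma theta_commute: "theta i * theta j = - (theta j * theta i)"
  using odd_mult_commute[of "theta i" "theta j"] by simp

lemma theta_square [simp]: "theta i * theta i = 0"
  by (rule sfun_eqI) (auto simp: coef_theta_mult coef_theta)

lemma theta_smon: "theta i * smon p J = (if i \<in> J then 0 else isgn i J *\<^sub>R smon p (insert i J))"
  by (rule sfun_eqI) (auto simp: coef_theta_mult coef_smon insert_absorb)

lemma dtheta_smon: "dtheta i (smon p J) = (if i \<in> J then isgn i J *\<^sub>R smon p (J - {i}) else 0)"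
  by (rule sfun_eqI) (auto simp: coef_dtheta coef_smon)

lemma xcoord_smon: "xcoord * smon p J = smon (Suc p) J"
  by (rule sfun_eqI) (simp add: coef_xcoord_mult coef_smon)

section \<open>The algebra of linear operators\<close>

text \<open>On bare functions the product would be pointwise. With composition as product the linear
  endomorphisms form a real algebra, so operator identities become ring identities and the Leibniz
  rules become commutation relations.\<close>

typedef (overloaded) ('n::"{finite,linorder}") lop = "{A :: 'n operator. linear A}"
  morphisms ap Lop
  by (rule exI[where x = "\<lambda>F. 0"]) (simp add: linear_iff)

setup_lifting type_definition_lop

instantiation lop :: ("{finite,linorder}") real_algebra_1
begin

lift_definition zero_lop :: "'a lop" is "\<lambda>F. 0"
  by (simp add: linear_iff)

lift_definition one_lop :: "'a lop" is "\<lambda>F. F"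
  by (simp add: linear_iff)

lift_definition plus_lop :: "'a lop \<Rightarrow> 'a lop \<Rightarrow> 'a lop" is "\<lambda>A B F. A F + B F"
  by (simp add: linear_compose_add)

lift_definition minus_lop :: "'a lop \<Rightarrow> 'a lop \<Rightarrow> 'a lop" is "\<lambda>A B F. A F - B F"
  by (simp add: linear_compose_sub)

lift_definition uminus_lop :: "'a lop \<Rightarrow> 'a lop" is "\<lambda>A F. - A F"
  by (simp add: linear_compose_neg)

lift_definition scaleR_lop :: "real \<Rightarrow> 'a lop \<Rightarrow> 'a lop" is "\<lambda>c A F. c *\<^sub>R A F"
  by (simp add: linear_iff algebra_simps)

lift_definition times_lop :: "'a lop \<Rightarrow> 'a lop \<Rightarrow> 'a lop" is "\<lambda>A B F. A (B F)"
  by (simp add: linear_iff)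

instance
proof
  fix A B C :: "'a lop" and a b :: real
  show "A * (B + C) = A * B + A * C"
    by transfer (simp add: linear_iff)
  show "A * (a *\<^sub>R B) = a *\<^sub>R (A * B)"
    by transfer (simp add: linear_iff)
  show "(0::'a lop) \<noteq> 1"
    by transfer (metis zero_neq_one)
qed (transfer; simp add: fun_eq_iff algebra_simps)+

end

lemma ap_simps [simp]:
  "ap 0 F = 0" "ap 1 F = F" "ap (A + B) F = ap A F + ap B F" "ap (A - B) F = ap A F - ap B F"
  "ap (- A) F = - ap A F" "ap (c *\<^sub>R A) F = c *\<^sub>R ap A F" "ap (A * B) F = ap A (ap B F)"
  by (transfer; simp)+

lemma linear_ap: "linear (ap A)"
  using ap by blast

lemma ap_linear [simp]:
  "ap A (F + G) = ap A F + ap A G" "ap A (F - G) = ap A F - ap A G" "ap A (- F) = - ap A F"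
  "ap A (c *\<^sub>R F) = c *\<^sub>R ap A F" "ap A 0 = 0"
  using linear_ap[of A] by (simp_all add: linear_add linear_diff linear_neg linear_cmul linear_0)

lemma ap_sum [simp]: "ap (\<Sum>a\<in>S. f a) F = (\<Sum>a\<in>S. ap (f a) F)"
  by (induction S rule: infinite_finite_induct) simp_all

lemma ap_sum_right: "ap A (\<Sum>a\<in>S. f a) = (\<Sum>a\<in>S. ap A (f a))"
  by (induction S rule: infinite_finite_induct) simp_all

lemma ap_power: "ap (A ^ k) F = (ap A ^^ k) F"
  by (induction k arbitrary: F) simp_all

lemma lop_eqI: "(\<And>F. ap A F = ap B F) \<Longrightarrow> A = B"
  by (metis ap_inject ext)

lemma ap_eq_iff: "ap A = ap B \<longleftrightarrow> A = B"
  by (rule ap_inject)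

lemma ap_Lop: "linear A \<Longrightarrow> ap (Lop A) = A"
  by (simp add: Lop_inverse)

definition Mul :: "'n::{finite,linorder} sfun \<Rightarrow> 'n lop" where
  "Mul F = Lop (\<lambda>G. F * G)"

definition Dx :: "'n::{finite,linorder} lop" where
  "Dx = Lop dx"

definition Dth :: "'n::{finite,linorder} \<Rightarrow> 'n lop" where
  "Dth i = Lop (dtheta i)"

definition Par :: "'n::{finite,linorder} lop" where
  "Par = Lop par"

definition Eta :: "'n::{finite,linorder} \<Rightarrow> 'n lop" where
  "Eta i = Dth i - Mul (theta i) * Dx"

text \<open>Twice the field of theta_i, whatever the weight (\<open>Lie_theta\<close>). These
  operators anticommute with all \<open>Eta j\<close> (\<open>Q_Eta\<close>), which makes
  polynomials in the \<open>Eta j\<close> invariant.\<close>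

definition Q :: "'n::{finite,linorder} \<Rightarrow> 'n lop" where
  "Q i = Dth i + Mul (theta i) * Dx"

lemma ap_generators [simp]:
  "ap (Mul F) G = F * G" "ap Dx F = dx F" "ap (Dth i) F = dtheta i F" "ap Par F = par F"
  "ap (Eta i) F = eta i F"
  by (simp_all add: Mul_def Dx_def Dth_def Par_def Eta_def eta_def ap_Lop linear_iff distrib_left)

lemma Mul_simps:
  "Mul (F + G) = Mul F + Mul G" "Mul (F - G) = Mul F - Mul G" "Mul (- F) = - Mul F"
  "Mul (c *\<^sub>R F) = c *\<^sub>R Mul F" "Mul 0 = 0" "Mul 1 = 1" "Mul (F * G) = Mul F * Mul G"
  by (rule lop_eqI; simp add: algebra_simps)+

lemma Mul_sum: "Mul (\<Sum>a\<in>S. F a) = (\<Sum>a\<in>S. Mul (F a))"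
  by (induction S rule: infinite_finite_induct) (simp_all add: Mul_simps)

lemma Dx_Mul: "Dx * Mul F = Mul (dx F) + Mul F * Dx"
  by (rule lop_eqI) (simp add: dx_mult)

lemma Dth_Mul: "Dth i * Mul F = Mul (dtheta i F) + Mul (par F) * Dth i"
  by (rule lop_eqI) (simp add: dtheta_mult)

lemma Par_Mul: "Par * Mul F = Mul (par F) * Par"
  by (rule lop_eqI) simp

lemma Par_Par [simp]: "Par * Par = 1"
  by (rule lop_eqI) simp

lemma Par_Par_left [simp]: "Par * (Par * A) = A"
  by (simp flip: mult.assoc)

lemma Par_Dx: "Par * Dx = Dx * Par"
  by (rule lop_eqI) (simp add: dx_par)

lemma Par_Dth: "Par * Dth i = - (Dth i * Par)"
  by (rule lop_eqI) (simp add: par_dtheta)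

lemma Dx_Dth: "Dx * Dth i = Dth i * Dx"
  by (rule lop_eqI) (simp add: dx_dtheta)

lemma Dth_Dth: "Dth i * Dth j = - (Dth j * Dth i)"
  by (rule lop_eqI) (simp add: dtheta_dtheta[of i])

lemma Dx_theta: "Dx * Mul (theta i) = Mul (theta i) * Dx"
  by (simp add: Dx_Mul Mul_simps)

lemma theta_theta: "Mul (theta i) * Mul (theta j) = - (Mul (theta j) * Mul (theta i))"
  by (metis Mul_simps(3,7) theta_commute)

lemma theta_theta_same [simp]: "Mul (theta i) * Mul (theta i) = 0"
  using Mul_simps(7)[of "theta i" "theta i"] by (simp add: Mul_simps(5))

lemma Dth_theta: "Dth i * Mul (theta j) = (if i = j then 1 else 0) - Mul (theta j) * Dth i"
  by (simp add: Dth_Mul dtheta_theta Mul_simps)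

lemma Par_theta: "Par * Mul (theta i) = - (Mul (theta i) * Par)"
  by (simp add: Par_Mul Mul_simps)

lemma Dx_Eta: "Dx * Eta i = Eta i * Dx"
  by (simp add: Eta_def algebra_simps Dx_Dth) (simp add: Dx_theta flip: mult.assoc)

lemma Dx_Q: "Dx * Q i = Q i * Dx"
  by (simp add: Q_def algebra_simps Dx_Dth) (simp add: Dx_theta flip: mult.assoc)

lemma Par_theta_left: "Par * (Mul (theta i) * A) = - (Mul (theta i) * (Par * A))"
  by (simp add: Par_theta flip: mult.assoc)

lemma Par_Eta: "Par * Eta i = - (Eta i * Par)"
  by (simp add: Eta_def algebra_simps Par_Dth Par_Dx Par_theta_left)

lemma Par_Q: "Par * Q i = - (Q i * Par)"
  by (simp add: Q_def algebra_simps Par_Dth Par_Dx Par_theta_left)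

lemma Eta_Mul: "Eta i * Mul F = Mul (eta i F) + Mul (par F) * Eta i"
  using odd_mult_commute[of "theta i" F]
  by (simp add: Eta_def eta_def algebra_simps Dth_Mul Dx_Mul Mul_simps)
    (metis Mul_simps(7) mult.assoc)

lemma theta_Dx_left: "Dx * (Mul (theta i) * A) = Mul (theta i) * (Dx * A)"
  by (simp add: Dx_theta flip: mult.assoc)

lemma Dth_theta_left: "Dth i * (Mul (theta j) * A) = (if i = j then A else 0) - Mul (theta j) * (Dth i * A)"
  by (simp add: Dth_theta algebra_simps flip: mult.assoc)

lemma Eta_Eta: "Eta i * Eta j + Eta j * Eta i = (if i = j then - (2 *\<^sub>R Dx) else 0)"
  using Dth_Dth[of i j] theta_theta[of i j]
  by (simp add: Eta_def algebra_simps Dth_theta_left theta_Dx_left Dx_Dth Dx_theta scaleR_2)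
    (simp flip: mult.assoc)

lemma Q_Eta: "Q i * Eta j = - (Eta j * Q i)"
  using Dth_Dth[of i j] theta_theta[of i j]
  by (simp add: Q_def Eta_def algebra_simps Dth_theta_left theta_Dx_left Dx_Dth Dx_theta)
    (simp flip: mult.assoc)

section \<open>Contact vector fields and the contact bracket\<close>

lemma eta_simps [simp]:
  "eta i (F + G) = eta i F + eta i G" "eta i (F - G) = eta i F - eta i G"
  "eta i (- F) = - eta i F" "eta i (c *\<^sub>R F) = c *\<^sub>R eta i F" "eta i 0 = 0"
  by (fact ap_linear[of "Eta i", unfolded ap_generators])+

lemma eta_sum [simp]: "eta i (\<Sum>a\<in>S. F a) = (\<Sum>a\<in>S. eta i (F a))"
  by (fact ap_sum_right[of "Eta i", unfolded ap_generators])

lemma eta_mult: "eta i (F * G) = eta i F * G + par F * eta i G"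
  using arg_cong[OF Eta_Mul[of i F], of "\<lambda>A. ap A G"] by simp

lemma dx_eta: "dx (eta i F) = eta i (dx F)"
  using arg_cong[OF Dx_Eta[of i], of "\<lambda>A. ap A F"] by simp

lemma par_eta: "par (eta i F) = - eta i (par F)"
  using arg_cong[OF Par_Eta[of i], of "\<lambda>A. ap A F"] by simp

lemma eta_eta: "eta i (eta j F) = (if i = j then - (2 *\<^sub>R dx F) else 0) - eta j (eta i F)"
  using arg_cong[OF Eta_Eta[of i j], of "\<lambda>A. ap A F"] by (simp add: eq_diff_eq split: if_splits)

text \<open>The operator \<open>eta i\<close> is odd, so \<open>par (eta i F)\<close> is -(-1)^F
  \<open>eta i F\<close>; the sum over parities collapses to one term with this sign built
  in.\<close>

lemma contact_bracket_eq:
  "contact_bracket F G = F * dx G - dx F * G + (1/2) *\<^sub>R (\<Sum>i\<in>UNIV. par (eta i F) * eta i G)"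
  by (simp add: contact_bracket_def hpart_eq par_eta scaleR_sum_right sum_negf[symmetric]
      sum.distrib[symmetric] sum_subtractf[symmetric] algebra_simps)
    (simp add: scaleR_add_left[symmetric] scaleR_left_diff_distrib[symmetric])

definition Lie :: "real \<Rightarrow> 'n::{finite,linorder} sfun \<Rightarrow> 'n lop" where
  "Lie l F = Mul F * Dx + (1/2) *\<^sub>R (\<Sum>i\<in>UNIV. Mul (par (eta i F)) * Eta i) + l *\<^sub>R Mul (dx F)"

lemma sum_fun_apply: "(\<Sum>a\<in>S. f a) x = (\<Sum>a\<in>S. f a x)"
  for f :: "'a \<Rightarrow> 'b \<Rightarrow> 'c::comm_monoid_add"
  by (induction S rule: infinite_finite_induct) simp_all

lemma contact_field_eq: "contact_field F = ap (Lie 0 F)"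
  by (rule ext)
    (simp add: Lie_def contact_field_def mult_op_def scaleR_fun_def sum_fun_apply hpart_eq par_eta
      scaleR_sum_right sum_negf[symmetric] sum.distrib[symmetric] sum_subtractf[symmetric] algebra_simps,
     simp add: scaleR_add_left[symmetric] scaleR_left_diff_distrib[symmetric])

lemma Lie_eq: "Lie l F = Lie 0 F + l *\<^sub>R Mul (dx F)"
  by (simp add: Lie_def)

lemma ap_Lie: "lie_density l F = ap (Lie l F)"
  by (rule ext)
    (simp add: Lie_eq[of l] lie_density_def contact_field_eq mult_op_def scaleR_fun_def)

text \<open>Parities are carried as eigenvalues s, t of \<open>par\<close>, so that signs become
  scalars which can be multiplied.\<close>

lemma super_commute:
  assumes "par F = s *\<^sub>R F" "par G = t *\<^sub>R G" "s \<in> {1, -1}" "t \<in> {1, -1}"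
  shows "F * G = (if s = -1 \<and> t = -1 then -1 else 1) *\<^sub>R (G * F)"
proof -
  consider "s = 1" | "s = -1" "t = 1" | "s = -1" "t = -1"
    using assms by auto
  then show ?thesis
  proof cases
    case 1
    then show ?thesis
      using assms(1) even_mult_commute[of F G] by simp
  next
    case 2
    then show ?thesis
      using assms(2) even_mult_commute[of G F] by simp
  next
    case 3
    then show ?thesis
      using assms(1,2) odd_mult_commute[of F G] by simp
  qed
qed

text \<open>Normal ordering: multiplications are moved to the left by the Leibniz rules. The terms
  are kept separate according to the operators \<open>Dx\<close> and \<open>Eta\<close> that remain
  on the right, since the supercommutator is compared term by term.\<close>

lemma Lie_mult:
  assumes F: "par F = s *\<^sub>R F" and G: "par G = t *\<^sub>R G" and t: "t * t = 1"
  shows "Lie l F * Lie l G =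
      Mul (F * dx G) * Dx + Mul (F * G) * Dx * Dx - (t/2) *\<^sub>R (\<Sum>j\<in>UNIV. Mul (F * dx (eta j G)) * Eta j)
    - (t/2) *\<^sub>R (\<Sum>j\<in>UNIV. Mul (F * eta j G) * Dx * Eta j)
    + l *\<^sub>R Mul (F * dx (dx G)) + l *\<^sub>R (Mul (F * dx G) * Dx)
    - (s/2) *\<^sub>R (\<Sum>i\<in>UNIV. Mul (eta i F * eta i G) * Dx)
    - (s*t/2) *\<^sub>R (\<Sum>i\<in>UNIV. Mul (eta i F * G) * Dx * Eta i)
    + (s*t/4) *\<^sub>R (\<Sum>j\<in>UNIV. \<Sum>i\<in>UNIV. Mul (eta i F * eta i (eta j G)) * Eta j)
    - (s/4) *\<^sub>R (\<Sum>i\<in>UNIV. \<Sum>j\<in>UNIV. Mul (eta i F * eta j G) * Eta i * Eta j)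
    - (l * s/2) *\<^sub>R (\<Sum>i\<in>UNIV. Mul (eta i F * dx (eta i G)))
    - (l * s * t/2) *\<^sub>R (\<Sum>i\<in>UNIV. Mul (eta i F * dx G) * Eta i)
    + l *\<^sub>R (Mul (dx F * G) * Dx) - (l*t/2) *\<^sub>R (\<Sum>i\<in>UNIV. Mul (dx F * eta i G) * Eta i)
    + (l*l) *\<^sub>R Mul (dx F * dx G)"
proof -
  define f f1 a g g1 b where "f = Mul F" "f1 = Mul (dx F)" "a = (\<lambda>i. Mul (eta i F))"
    "g = Mul G" "g1 = Mul (dx G)" "b = (\<lambda>i. Mul (eta i G))"
  note d = this
  have LF: "Lie l F = f * Dx - (s/2) *\<^sub>R (\<Sum>i\<in>UNIV. a i * Eta i) + l *\<^sub>R f1"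
    by (simp add: d Lie_def par_eta F Mul_simps sum_negf scaleR_sum_right[symmetric])
  have LG: "Lie l G = g * Dx - (t/2) *\<^sub>R (\<Sum>i\<in>UNIV. b i * Eta i) + l *\<^sub>R g1"
    by (simp add: d Lie_def par_eta G Mul_simps sum_negf scaleR_sum_right[symmetric])
  have 1: "f * Dx * (g * Dx) = Mul (F * dx G) * Dx + Mul (F * G) * Dx * Dx"
    by (simp add: d Mul_simps mult.assoc) (simp add: Dx_Mul algebra_simps flip: mult.assoc)
  have 2: "f * Dx * (\<Sum>i\<in>UNIV. b i * Eta i) =
      (\<Sum>j\<in>UNIV. Mul (F * dx (eta j G)) * Eta j) + (\<Sum>j\<in>UNIV. Mul (F * eta j G) * Dx * Eta j)"
    by (simp add: d Mul_simps sum_distrib_left Dx_Mul distrib_right distrib_left sum.distrib mult.assoc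
        flip: mult.assoc[of Dx "Mul _"])
  have 3: "f * Dx * g1 = Mul (F * dx (dx G)) + Mul (F * dx G) * Dx"
    by (simp add: d Mul_simps Dx_Mul distrib_left mult.assoc)
  have 4: "(\<Sum>i\<in>UNIV. a i * Eta i) * (g * Dx) =
      (\<Sum>i\<in>UNIV. Mul (eta i F * eta i G) * Dx) + t *\<^sub>R (\<Sum>i\<in>UNIV. Mul (eta i F * G) * Dx * Eta i)"
    by (simp add: d Mul_simps sum_distrib_right Eta_Mul G distrib_right distrib_left sum.distrib mult.assoc
        scaleR_sum_right Dx_Eta flip: mult.assoc[of "Eta _" "Mul _"])
  have 5: "(\<Sum>i\<in>UNIV. a i * Eta i) * (\<Sum>j\<in>UNIV. b j * Eta j) =
      (\<Sum>j\<in>UNIV. \<Sum>i\<in>UNIV. Mul (eta i F * eta i (eta j G)) * Eta j)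
    - t *\<^sub>R (\<Sum>i\<in>UNIV. \<Sum>j\<in>UNIV. Mul (eta i F * eta j G) * Eta i * Eta j)"
  proof -
    have "a i * Eta i * (b j * Eta j) = Mul (eta i F * eta i (eta j G)) * Eta j
        - t *\<^sub>R (Mul (eta i F * eta j G) * Eta i * Eta j)" for i j
      by (simp add: d Mul_simps Eta_Mul par_eta G distrib_right distrib_left mult.assoc algebra_simps
        flip: mult.assoc[of "Eta _" "Mul _"])
    then show ?thesis
      by (simp add: sum_product sum_subtractf scaleR_sum_right) (subst sum.swap, simp)
  qed
  have 6: "(\<Sum>i\<in>UNIV. a i * Eta i) * g1 =
      (\<Sum>i\<in>UNIV. Mul (eta i F * dx (eta i G))) + t *\<^sub>R (\<Sum>i\<in>UNIV. Mul (eta i F * dx G) * Eta i)"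
    by (simp add: d Mul_simps sum_distrib_right Eta_Mul G distrib_left sum.distrib mult.assoc
        scaleR_sum_right dx_eta flip: dx_par)
  have 7: "f1 * (g * Dx) = Mul (dx F * G) * Dx" "f1 * g1 = Mul (dx F * dx G)"
    "f1 * (\<Sum>i\<in>UNIV. b i * Eta i) = (\<Sum>i\<in>UNIV. Mul (dx F * eta i G) * Eta i)"
    by (simp_all add: d Mul_simps sum_distrib_left mult.assoc)
  show ?thesis
    unfolding LF LG
    by (simp only: ring_distribs mult_scaleR_left mult_scaleR_right 1 2 3 4 5 6 7)
      (simp add: algebra_simps t)
qed

text \<open>In the supercommutator of the normally ordered products the terms with
  \<open>Dx * Dx\<close> and \<open>Dx * Eta j\<close> cancel. Those with two \<open>Eta\<close> are
  reduced by the Clifford relation to multiples of \<open>Dx\<close>, and the rest matches the field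
  of the bracket.\<close>

lemma Lie_bracket:
  assumes F: "par F = s *\<^sub>R F" and G: "par G = t *\<^sub>R G" and s: "s \<in> {1, -1}" and t: "t \<in> {1, -1}"
  shows "Lie l (contact_bracket F G) =
    Lie l F * Lie l G - (if s = -1 \<and> t = -1 then -1 else 1) *\<^sub>R (Lie l G * Lie l F)"
proof -
  define c :: real where "c = (if s = -1 \<and> t = -1 then -1 else 1)"
  have sq: "s * s = 1" "t * t = 1" "c * c = 1"
    using s t by (auto simp: c_def)
  have comm: "G' * F' = c *\<^sub>R (F' * G')"
    if "par F' = s *\<^sub>R F'" "par G' = t *\<^sub>R G'" for F' G' :: "'a sfun"
    using super_commute[OF that s t] by (simp add: c_def)
  \<comment> \<open>Applying \<open>eta\<close> to one factor reverses its parity, which changes the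
    sign of the exchange by the parity sign of the other factor.\<close>
  have comm1: "G' * F' = (c * t) *\<^sub>R (F' * G')"
    if "par F' = - s *\<^sub>R F'" "par G' = t *\<^sub>R G'" for F' G' :: "'a sfun"
    using super_commute[OF that] s t by (auto simp: c_def)
  have comm2: "G' * F' = (c * s) *\<^sub>R (F' * G')"
    if "par F' = s *\<^sub>R F'" "par G' = - t *\<^sub>R G'" for F' G' :: "'a sfun"
    using super_commute[OF that] s t by (auto simp: c_def)
  have comm3: "G' * F' = - (c * s * t) *\<^sub>R (F' * G')"
    if "par F' = - s *\<^sub>R F'" "par G' = - t *\<^sub>R G'" for F' G' :: "'a sfun"
    using super_commute[OF that] s t by (auto simp: c_def)
  note com = comm[of F G] comm[of "dx F" G] comm[of F "dx G"] comm[of "dx F" "dx G"] comm[of "dx (dx F)" G]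
    comm1[of "dx (eta _ F)" G] comm1[of "eta _ F" G] comm1[of "eta _ F" "dx G"]
    comm2[of F "eta _ G"] comm2[of "dx F" "eta _ G"] comm2[of "eta _ (eta _ F)" "eta _ G"]
    comm3[of "eta _ F" "eta _ G"] comm3[of "dx (eta _ F)" "eta _ G"]
  note pars = F G dx_par[symmetric] par_eta
  define u1 u2 u3 u4 u5 u6 u7 u8 u9 where
    "u1 = (\<Sum>j\<in>UNIV. Mul (F * dx (eta j G)) * Eta j)"
    "u2 = (\<Sum>j\<in>UNIV. Mul (dx (eta j F) * G) * Eta j)"
    "u3 = (\<Sum>j\<in>UNIV. Mul (F * eta j G) * Dx * Eta j)"
    "u4 = (\<Sum>j\<in>UNIV. Mul (eta j F * G) * Dx * Eta j)"
    "u5 = (\<Sum>i\<in>UNIV. Mul (eta i F * eta i G))"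
    "u6 = (\<Sum>j\<in>UNIV. \<Sum>i\<in>UNIV. Mul (eta i F * eta i (eta j G)) * Eta j)"
    "u7 = (\<Sum>j\<in>UNIV. \<Sum>i\<in>UNIV. Mul (eta i (eta j F) * eta i G) * Eta j)"
    "u8 = (\<Sum>i\<in>UNIV. \<Sum>j\<in>UNIV. Mul (eta i F * eta j G) * Eta i * Eta j)"
    "u9 = (\<Sum>i\<in>UNIV. \<Sum>j\<in>UNIV. Mul (eta j F * eta i G) * Eta i * Eta j)"
  note u = this
  define v1 v2 v3 v4 where
    "v1 = (\<Sum>i\<in>UNIV. Mul (eta i F * dx (eta i G)))"
    "v2 = (\<Sum>i\<in>UNIV. Mul (dx (eta i F) * eta i G))"
    "v3 = (\<Sum>i\<in>UNIV. Mul (eta i F * dx G) * Eta i)"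
    "v4 = (\<Sum>i\<in>UNIV. Mul (dx F * eta i G) * Eta i)"
  note v = this
  have FG: "Lie l F * Lie l G =
      Mul (F * dx G) * Dx + Mul (F * G) * Dx * Dx - (t/2) *\<^sub>R u1 - (t/2) *\<^sub>R u3
    + l *\<^sub>R Mul (F * dx (dx G)) + l *\<^sub>R (Mul (F * dx G) * Dx) - (s/2) *\<^sub>R (u5 * Dx)
    - (s*t/2) *\<^sub>R u4 + (s*t/4) *\<^sub>R u6 - (s/4) *\<^sub>R u8 - (l * s/2) *\<^sub>R v1 - (l * s * t/2) *\<^sub>R v3
    + l *\<^sub>R (Mul (dx F * G) * Dx) - (l*t/2) *\<^sub>R v4 + (l*l) *\<^sub>R Mul (dx F * dx G)"
    unfolding Lie_mult[OF F G sq(2)] u v sum_distrib_right ..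
  have GF: "c *\<^sub>R (Lie l G * Lie l F) =
      Mul (dx F * G) * Dx + Mul (F * G) * Dx * Dx - (s*t/2) *\<^sub>R u2 - (s*t/2) *\<^sub>R u4
    + l *\<^sub>R Mul (dx (dx F) * G) + l *\<^sub>R (Mul (dx F * G) * Dx) + (s/2) *\<^sub>R (u5 * Dx)
    - (t/2) *\<^sub>R u3 + (t/4) *\<^sub>R u7 + (s/4) *\<^sub>R u9 + (l * s/2) *\<^sub>R v2 - (l*t/2) *\<^sub>R v4
    + l *\<^sub>R (Mul (F * dx G) * Dx) - (l * s * t/2) *\<^sub>R v3 + (l*l) *\<^sub>R Mul (dx F * dx G)"
    unfolding Lie_mult[OF G F sq(1)] u v sum_distrib_right
    using s t
    by (simp add: pars com Mul_simps(3,4) scaleR_sum_right[symmetric] scaleR_right_distrib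
        scaleR_right_diff_distrib sq c_def) (auto simp: sum_negf)
  have K: "contact_bracket F G = F * dx G - dx F * G - (s/2) *\<^sub>R (\<Sum>i\<in>UNIV. eta i F * eta i G)"
    by (simp add: contact_bracket_eq par_eta F sum_negf scaleR_sum_right[symmetric])
  \<comment> \<open>After renaming the indices of one double sum the operators combine to
    \<open>Eta i * Eta j + Eta j * Eta i\<close>, of which the Clifford relation leaves only the
    diagonal.\<close>
  have 89: "u8 + u9 = - 2 *\<^sub>R (u5 * Dx)"
  proof -
    have "u8 + u9 = (\<Sum>i\<in>UNIV. \<Sum>j\<in>UNIV. Mul (eta i F * eta j G) * (Eta i * Eta j + Eta j * Eta i))"
      unfolding u by (subst (2) sum.swap) (simp add: sum.distrib distrib_left mult.assoc)
    also have "\<dots> = - 2 *\<^sub>R (u5 * Dx)"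
      by (simp add: Eta_Eta u if_distrib if_distribR sum_negf scaleR_sum_right[symmetric]
          sum_distrib_right cong: if_cong)
    finally show ?thesis .
  qed
  have eta_K: "eta j (contact_bracket F G) = eta j F * dx G + s *\<^sub>R (F * dx (eta j G))
      - dx (eta j F) * G - s *\<^sub>R (dx F * eta j G)
      - (s/2) *\<^sub>R (\<Sum>i\<in>UNIV. eta j (eta i F) * eta i G - s *\<^sub>R (eta i F * eta j (eta i G)))" for j
    by (simp add: K eta_mult pars dx_eta)
  define w1 w2 where
    "w1 = (\<Sum>j\<in>UNIV. \<Sum>i\<in>UNIV. Mul (eta i F * eta j (eta i G)) * Eta j)"
    "w2 = (\<Sum>j\<in>UNIV. \<Sum>i\<in>UNIV. Mul (eta j (eta i F) * eta i G) * Eta j)"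
  note w = this
  have expand: "Mul (par (eta j (contact_bracket F G))) * Eta j =
      - (s * t) *\<^sub>R (Mul (eta j F * dx G) * Eta j) - t *\<^sub>R (Mul (F * dx (eta j G)) * Eta j)
      + (s * t) *\<^sub>R (Mul (dx (eta j F) * G) * Eta j) + t *\<^sub>R (Mul (dx F * eta j G) * Eta j)
      - (t / 2) *\<^sub>R (\<Sum>i\<in>UNIV. s *\<^sub>R (Mul (eta i F * eta j (eta i G)) * Eta j)
          - Mul (eta j (eta i F) * eta i G) * Eta j)" for j
    unfolding eta_K using s
    by (auto simp: pars Mul_simps Mul_sum algebra_simps sum_distrib_right scaleR_sum_right
        sum.distrib sum_subtractf sum_negf)
  have K1: "(\<Sum>j\<in>UNIV. Mul (par (eta j (contact_bracket F G))) * Eta j) =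
      - (s * t) *\<^sub>R v3 - t *\<^sub>R u1 + (s * t) *\<^sub>R u2 + t *\<^sub>R v4 - (s * t / 2) *\<^sub>R w1 + (t/2) *\<^sub>R w2"
    using s unfolding u v w expand
    by (auto simp: sum.distrib sum_subtractf sum_negf scaleR_sum_right algebra_simps)
  \<comment> \<open>Exchanging the two odd derivatives of G costs a sign and a diagonal term with
    \<open>dx G\<close>.\<close>
  have w1: "w1 = - 2 *\<^sub>R v3 - u6"
  proof -
    have "Mul (eta i F * eta j (eta i G)) * Eta j = (if j = i then - 2 *\<^sub>R (Mul (eta i F * dx G) * Eta i) else 0)
        - Mul (eta i F * eta i (eta j G)) * Eta j" for i j
      by (simp add: eta_eta[of j i] Mul_simps algebra_simps)
    then show ?thesis
      unfolding u v w by (simp only: sum_subtractf sum.delta' finite UNIV_I if_True scaleR_sum_right)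
  qed
  have w2: "w2 = - 2 *\<^sub>R v4 - u7"
  proof -
    have "Mul (eta j (eta i F) * eta i G) * Eta j = (if j = i then - 2 *\<^sub>R (Mul (dx F * eta i G) * Eta i) else 0)
        - Mul (eta i (eta j F) * eta i G) * Eta j" for i j
      by (simp add: eta_eta[of j i] Mul_simps algebra_simps)
    then show ?thesis
      unfolding u v w by (simp only: sum_subtractf sum.delta' finite UNIV_I if_True scaleR_sum_right)
  qed
  have K2: "Mul (contact_bracket F G) = Mul (F * dx G) - Mul (dx F * G) - (s/2) *\<^sub>R u5"
    unfolding K u by (simp add: Mul_simps Mul_sum)
  have K3: "Mul (dx (contact_bracket F G)) = Mul (F * dx (dx G)) - Mul (dx (dx F) * G) - (s/2) *\<^sub>R (v1 + v2)"
    unfolding K v by (simp add: dx_mult Mul_simps Mul_sum sum.distrib algebra_simps)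
  have u9: "u9 = - 2 *\<^sub>R (u5 * Dx) - u8"
    using 89 by (simp add: eq_diff_eq add.commute)
  have "Lie l (contact_bracket F G) = (Mul (F * dx G) - Mul (dx F * G) - (s/2) *\<^sub>R u5) * Dx
      - (t/2) *\<^sub>R u1 + (s * t / 2) *\<^sub>R u2 + (s * t / 4) *\<^sub>R u6 - (t/4) *\<^sub>R u7
      + l *\<^sub>R (Mul (F * dx (dx G)) - Mul (dx (dx F) * G) - (s/2) *\<^sub>R (v1 + v2))"
    unfolding Lie_def K1 K2 K3 w1 w2 using s
    by (auto simp: algebra_simps simp flip: scaleR_add_left)
  then show ?thesis
    unfolding c_def[symmetric] FG GF u9 using s
    by (auto simp: algebra_simps simp flip: scaleR_add_left)
qed

section \<open>Differential operators\<close>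

definition oprod :: "('n::{finite,linorder} \<Rightarrow> 'n lop) \<Rightarrow> 'n set \<Rightarrow> 'n lop" where
  "oprod D I = prod_list (map D (sorted_list_of_set I))"

lemma oprod_empty [simp]: "oprod D {} = 1"
  by (simp add: oprod_def)

lemma ap_oprod: "ap (oprod D I) = ordered_comp (\<lambda>i. ap (D i)) I"
proof -
  have "ap (prod_list (map D xs)) = foldr (\<lambda>i A. ap (D i) \<circ> A) xs id" for xs
    by (induction xs) (auto simp: fun_eq_iff)
  then show ?thesis
    by (simp add: oprod_def ordered_comp_def)
qed

text \<open>Moving \<open>D i\<close> to its place changes the sign at each smaller index; the total
  sign is left existential because closure of \<open>dops\<close> depends only on its being a
  scalar.\<close>

lemma oprod_insert:
  fixes D :: "'n::{finite,linorder} \<Rightarrow> 'n lop"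
  assumes anti: "\<And>i j. i \<noteq> j \<Longrightarrow> D i * D j = - (D j * D i)" and "i \<notin> I"
  obtains c where "c \<in> {1, -1}" "D i * oprod D I = c *\<^sub>R oprod D (insert i I)"
proof -
  have "\<exists>c\<in>{1, -1}. D i * prod_list (map D xs) = c *\<^sub>R prod_list (map D (insort i xs))"
    if "i \<notin> set xs" for xs
    using that
  proof (induction xs)
    case Nil
    show ?case by (intro bexI[of _ 1]) auto
  next
    case (Cons j xs)
    show ?case
    proof (cases "i \<le> j")
      case True
      then show ?thesis by (intro bexI[of _ 1]) auto
    next
      case False
      obtain c where c: "c \<in> {1, -1}" "D i * prod_list (map D xs) = c *\<^sub>R prod_list (map D (insort i xs))"
        using Cons.IH Cons.prems by (metis list.set_intros(2))
      have "D i * (D j * prod_list (map D xs)) = - (D j * (D i * prod_list (map D xs)))"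
        using anti[of i j] Cons.prems by (simp flip: mult.assoc)
      then show ?thesis
        using False c by (intro bexI[of _ "- c"]) auto
    qed
  qed
  from this[of "sorted_list_of_set I"]
  have "\<exists>c\<in>{1, -1}. D i * oprod D I = c *\<^sub>R oprod D (insert i I)"
    using assms(2) by (simp add: oprod_def sorted_list_of_set_insert)
  then show ?thesis
    using that by blast
qed

definition dops :: "'n::{finite,linorder} lop set" where
  "dops = {B. \<exists>(N::nat) a. B = (\<Sum>j<N. \<Sum>I\<in>UNIV. Mul (a j I) * Dx ^ j * oprod Dth I)}"

lemma ap_Dx: "ap Dx = dx" and ap_Dth: "ap (Dth i) = dtheta i"
  by (rule ext, simp)+

lemma diff_ops_eq: "diff_ops = ap ` dops"
proof -
  have "(\<Sum>j<N. \<Sum>I\<in>UNIV. mult_op (a j I) \<circ> (dx ^^ j) \<circ> ordered_comp dtheta I) =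
      ap (\<Sum>j<N. \<Sum>I\<in>UNIV. Mul (a j I) * Dx ^ j * oprod Dth I)" for N :: nat and a :: "nat \<Rightarrow> 'a set \<Rightarrow> 'a sfun"
    by (rule ext) (simp add: sum_fun_apply mult_op_def ap_power ap_oprod ap_Dx ap_Dth)
  then show ?thesis
    unfolding diff_ops_def dops_def by auto
qed

lemma dops_zero [intro, simp]: "0 \<in> dops"
  unfolding dops_def by (auto intro!: exI[of _ 0])

lemma dops_add [intro]:
  assumes "B \<in> dops" "C \<in> dops"
  shows "B + C \<in> dops"
proof -
  obtain N a M b where B: "B = (\<Sum>j<N. \<Sum>I\<in>UNIV. Mul (a j I) * Dx ^ j * oprod Dth I)"
    and C: "C = (\<Sum>j<M. \<Sum>I\<in>UNIV. Mul (b j I) * Dx ^ j * oprod Dth I)"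
    using assms unfolding dops_def by blast
  define a' b' where "a' = (\<lambda>j I. if j < N then a j I else 0)" "b' = (\<lambda>j I. if j < M then b j I else 0)"
  have "B = (\<Sum>j<max N M. \<Sum>I\<in>UNIV. Mul (a' j I) * Dx ^ j * oprod Dth I)"
    unfolding B a'_b'_def by (rule sum.mono_neutral_cong_left) (auto simp: Mul_simps)
  moreover have "C = (\<Sum>j<max N M. \<Sum>I\<in>UNIV. Mul (b' j I) * Dx ^ j * oprod Dth I)"
    unfolding C a'_b'_def by (rule sum.mono_neutral_cong_left) (auto simp: Mul_simps)
  ultimately have "B + C = (\<Sum>j<max N M. \<Sum>I\<in>UNIV. Mul (a' j I + b' j I) * Dx ^ j * oprod Dth I)"
    by (simp add: Mul_simps distrib_right sum.distrib)
  then show ?thesis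
    unfolding dops_def by (intro CollectI exI)
qed

lemma dops_Mul [intro]:
  assumes "B \<in> dops"
  shows "Mul F * B \<in> dops"
proof -
  obtain N a where "B = (\<Sum>j<N. \<Sum>I\<in>UNIV. Mul (a j I) * Dx ^ j * oprod Dth I)"
    using assms unfolding dops_def by blast
  then have "Mul F * B = (\<Sum>j<N. \<Sum>I\<in>UNIV. Mul (F * a j I) * Dx ^ j * oprod Dth I)"
    by (simp add: sum_distrib_left Mul_simps mult.assoc)
  then show ?thesis
    unfolding dops_def by (intro CollectI exI)
qed

lemma dops_scaleR [intro]: "B \<in> dops \<Longrightarrow> c *\<^sub>R B \<in> dops"
  using dops_Mul[of B "c *\<^sub>R 1"] by (simp add: Mul_simps)

lemma dops_minus [intro]: "B \<in> dops \<Longrightarrow> - B \<in> dops"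
  using dops_scaleR[of B "-1"] by simp

lemma dops_diff [intro]: "B \<in> dops \<Longrightarrow> C \<in> dops \<Longrightarrow> B - C \<in> dops"
  using dops_add[of B "- C"] by (auto)

lemma dops_sum [intro]: "(\<And>a. a \<in> S \<Longrightarrow> f a \<in> dops) \<Longrightarrow> (\<Sum>a\<in>S. f a) \<in> dops"
  by (induction S rule: infinite_finite_induct) auto

lemma dops_monomial: "Mul a * Dx ^ j * oprod Dth I \<in> dops"
proof -
  define b where "b = (\<lambda>j' I'. if j' = j \<and> I' = I then a else 0)"
  have "(\<Sum>j'<Suc j. \<Sum>I'\<in>UNIV. Mul (b j' I') * Dx ^ j' * oprod Dth I') =
      (\<Sum>j'<Suc j. \<Sum>I'\<in>UNIV. if I = I' then if j' = j then Mul a * Dx ^ j * oprod Dth I else 0 else 0)"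
    unfolding b_def by (intro sum.cong refl) (auto simp: Mul_simps)
  then show ?thesis
    unfolding dops_def by (intro CollectI exI[of _ "Suc j"] exI[of _ b]) simp
qed

lemma dops_induct_left:
  assumes "B \<in> dops" and "\<And>a j I. T * (Mul a * Dx ^ j * oprod Dth I) \<in> dops"
  shows "T * B \<in> dops"
proof -
  obtain N a where "B = (\<Sum>j<N. \<Sum>I\<in>UNIV. Mul (a j I) * Dx ^ j * oprod Dth I)"
    using assms(1) unfolding dops_def by blast
  then show ?thesis
    by (simp add: sum_distrib_left dops_sum assms(2))
qed

lemma dops_Dx [intro]:
  assumes "B \<in> dops"
  shows "Dx * B \<in> dops"
  using assms
proof (rule dops_induct_left)
  fix a :: "'a sfun" and j I
  have "Dx * (Mul a * Dx ^ j * oprod Dth I) =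
      Mul (dx a) * Dx ^ j * oprod Dth I + Mul a * Dx ^ Suc j * oprod Dth I"
    by (simp add: Dx_Mul distrib_right mult.assoc flip: mult.assoc[of Dx "Mul a"])
  then show "Dx * (Mul a * Dx ^ j * oprod Dth I) \<in> dops"
    by (metis dops_add dops_monomial)
qed

lemma Dth_Dx_power: "Dth i * Dx ^ j = Dx ^ j * Dth i"
  using power_commuting_commutes[of Dx "Dth i" j] by (simp add: Dx_Dth)

lemma dops_Dth [intro]:
  assumes "B \<in> dops"
  shows "Dth i * B \<in> dops"
  using assms
proof (rule dops_induct_left)
  fix a :: "'a sfun" and j and I
  have "\<exists>c J. Dth i * oprod Dth I = c *\<^sub>R oprod Dth J"
  proof (cases "i \<in> I")
    case True
    define J where "J = I - {i}"
    have J: "i \<notin> J" "I = insert i J"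
      using True by (auto simp: J_def)
    obtain c where c: "c \<in> {1, -1}" "Dth i * oprod Dth J = c *\<^sub>R oprod Dth I"
      unfolding J(2) by (rule oprod_insert[of Dth, OF Dth_Dth J(1)]) blast
    have "Dth i * Dth i = 0"
      using Dth_Dth[of i i] by (simp add: eq_neg_iff_add_eq_0 flip: scaleR_2)
    then have "c *\<^sub>R (Dth i * oprod Dth I) = 0"
      using c(2) by (metis mult.assoc mult_scaleR_right mult_zero_left)
    then have "Dth i * oprod Dth I = 0 *\<^sub>R oprod Dth I"
      using c(1) by auto
    then show ?thesis by blast
  next
    case False
    then show ?thesis
      by (meson oprod_insert[of Dth, OF Dth_Dth])
  qed
  then obtain c J where cJ: "Dth i * oprod Dth I = c *\<^sub>R oprod Dth J"
    by blast
  have "Dth i * (Mul a * Dx ^ j * oprod Dth I) =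
      Mul (dtheta i a) * Dx ^ j * oprod Dth I + Mul (par a) * (Dth i * Dx ^ j) * oprod Dth I"
    by (simp add: Dth_Mul distrib_right mult.assoc flip: mult.assoc[of "Dth i" "Mul a"])
  also have "\<dots> = Mul (dtheta i a) * Dx ^ j * oprod Dth I + c *\<^sub>R (Mul (par a) * Dx ^ j * oprod Dth J)"
    by (simp add: Dth_Dx_power mult.assoc cJ)
  finally show "Dth i * (Mul a * Dx ^ j * oprod Dth I) \<in> dops"
    by (metis dops_add dops_scaleR dops_monomial)
qed

text \<open>Each term of the left factor is a word in \<open>Mul\<close>, \<open>Dx\<close> and
  \<open>Dth\<close>, so closure under left multiplication by these letters is enough.\<close>

lemma dops_mult [intro]:
  assumes "A \<in> dops" "B \<in> dops"
  shows "A * B \<in> dops"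
proof -
  obtain N a where A: "A = (\<Sum>j<N. \<Sum>I\<in>UNIV. Mul (a j I) * Dx ^ j * oprod Dth I)"
    using assms unfolding dops_def by blast
  have "prod_list (map Dth xs) * B \<in> dops" for xs
    by (induction xs) (auto simp: mult.assoc assms(2))
  then have "Dx ^ j * (oprod Dth I * B) \<in> dops" for j I
    by (induction j) (auto simp: mult.assoc oprod_def)
  then show ?thesis
    unfolding A by (auto simp: sum_distrib_right mult.assoc intro!: dops_sum dops_Mul)
qed

lemma dops_one [intro, simp]: "1 \<in> dops"
  using dops_monomial[of 1 0 "{}"] by (simp add: Mul_simps)

lemma dops_power [intro]: "A \<in> dops \<Longrightarrow> A ^ k \<in> dops"
  by (induction k) auto

lemma dops_prod_list: "(\<And>i. D i \<in> dops) \<Longrightarrow> prod_list (map D xs) \<in> dops"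
  by (induction xs) auto

lemma dops_oprod [intro]: "(\<And>i. D i \<in> dops) \<Longrightarrow> oprod D I \<in> dops"
  unfolding oprod_def by (rule dops_prod_list)

lemma dops_Mul1 [intro, simp]: "Mul F \<in> dops"
  using dops_Mul[of 1 F] by simp

lemma dops_Dx1 [intro, simp]: "Dx \<in> dops"
  using dops_Dx[of 1] by simp

lemma dops_Dth1 [intro, simp]: "Dth i \<in> dops"
  using dops_Dth[of 1 i] by simp

lemma dops_Eta [intro, simp]: "Eta i \<in> dops"
  unfolding Eta_def by (intro dops_diff dops_mult) simp_all

lemma dops_Lie [intro, simp]: "Lie l F \<in> dops"
  unfolding Lie_def by (intro dops_add dops_scaleR dops_sum dops_mult) simp_all

text \<open>The parity operator is the product of the \<open>1 - 2 \<theta>\<^sub>i \<partial>\<close>, hence a differential operator.\<close>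

lemma dops_Par [intro, simp]: "(Par :: 'n::{finite,linorder} lop) \<in> dops"
proof -
  define S :: "'n \<Rightarrow> 'n lop" where "S = (\<lambda>i. 1 - 2 *\<^sub>R (Mul (theta i) * Dth i))"
  have S: "coef (ap (S i) F) K x = (if i \<in> K then - 1 else 1) * coef F K x" for i F K x
    by (auto simp: S_def coef_theta_mult coef_dtheta insert_absorb)
  have "coef (ap (prod_list (map S xs)) F) K x = (-1) ^ card (K \<inter> set xs) * coef F K x"
    if "distinct xs" for xs F K x
    using that by (induction xs) (auto simp: S)
  from this[of "sorted_list_of_set UNIV"] have "Par = oprod S UNIV"
    by (intro lop_eqI sfun_eqI) (simp add: oprod_def coef_par)
  moreover have "oprod S UNIV \<in> dops"
    by (rule dops_oprod) (auto simp: S_def)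
  ultimately show ?thesis
    by simp
qed

section \<open>Operators tested on monomials\<close>

text \<open>The value at the origin x = 0, theta = 0. The linear form F to
  \<open>ev (ap B F)\<close> is what is kept of an operator B in the reduction to the stabiliser of
  the origin.\<close>

definition ev :: "'n::{finite,linorder} sfun \<Rightarrow> real" where
  "ev F = coef F {} 0"

lemma ev_simps [simp]:
  "ev 0 = 0" "ev (F + G) = ev F + ev G" "ev (F - G) = ev F - ev G" "ev (- F) = - ev F"
  "ev (c *\<^sub>R F) = c * ev F" "ev (par F) = ev F"
  by (simp_all add: ev_def coef_par)

lemma ev_sum [simp]: "ev (\<Sum>a\<in>S. f a) = (\<Sum>a\<in>S. ev (f a))"
  by (simp add: ev_def)

lemma ev_theta_mult [simp]: "ev (theta i * F) = 0" and ev_xcoord_mult [simp]: "ev (xcoord * F) = 0"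
  by (simp_all add: ev_def coef_theta_mult coef_xcoord_mult)

lemma funpow_dx_smon:
  "ap (Dx ^ j) (smon p J) = (if j \<le> p then (fact p / fact (p - j)) *\<^sub>R smon (p - j) J else 0)"
proof (induction j)
  case (Suc j)
  show ?case
  proof (cases "Suc j \<le> p")
    case True
    then have "p - j = Suc (p - Suc j)"
      by simp
    then have "fact (p - j) = real (p - j) * fact (p - Suc j)"
      by simp
    with True Suc show ?thesis
      by simp
  next
    case False
    with Suc show ?thesis
      by (cases "p = j") auto
  qed
qed simp

lemma coef_eta: "i \<notin> K \<Longrightarrow> coef (ap (Eta i) F) K x = isgn i K * coef F (insert i K) x"
  by (simp add: eta_def coef_dtheta coef_theta_mult)

lemma coef_Q: "i \<notin> K \<Longrightarrow> coef (ap (Q i) F) K x = isgn i K * coef F (insert i K) x"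
  by (simp add: Q_def coef_dtheta coef_theta_mult)

text \<open>\<open>Eta i\<close> differs from \<open>Dth i\<close> by an operator with image in the
  multiples of theta_i, invisible on coefficients at K with i not in K. There each factor just
  extracts theta_i up to sign, and the whole product extracts theta_I.\<close>

lemma coef_oprod:
  assumes D: "\<And>i K F x. i \<notin> K \<Longrightarrow> coef (ap (D i) F) K x = isgn i K * coef F (insert i K) x"
  obtains c where "c \<in> {1, -1}" "\<And>F x. coef (ap (oprod D I) F) {} x = c * coef F I x"
proof -
  have "\<exists>c\<in>{1, -1}. \<forall>F x. coef (ap (prod_list (map D xs)) F) K x = c * coef F (K \<union> set xs) x"
    if "distinct xs" "K \<inter> set xs = {}" for xs K
    using that
  proof (induction xs arbitrary: K)
    case Nil
    show ?case by (intro bexI[of _ 1]) auto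
  next
    case (Cons i xs)
    have "insert i K \<inter> set xs = {}" "distinct xs" "i \<notin> K"
      using Cons.prems by auto
    then obtain c where c: "c \<in> {1, -1}"
      "\<And>F x. coef (ap (prod_list (map D xs)) F) (insert i K) x = c * coef F (insert i K \<union> set xs) x"
      using Cons.IH[of "insert i K"] by blast
    have "isgn i K * c \<in> {1, -1}"
      using c(1) by (auto simp: isgn_def uminus_power_if)
    moreover have "coef (ap (prod_list (map D (i # xs))) F) K x = isgn i K * c * coef F (K \<union> set (i # xs)) x" for F x
      using c(2) D \<open>i \<notin> K\<close> by simp
    ultimately show ?case
      by blast
  qed
  from this[of "sorted_list_of_set I" "{}"]
  have "\<exists>c\<in>{1, -1}. \<forall>F x. coef (ap (oprod D I) F) {} x = c * coef F I x"
    by (simp add: oprod_def)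
  then show ?thesis
    using that by blast
qed

lemma oprod_Dth_smon:
  obtains c where "c \<in> {1, -1}"
    "ap (oprod Dth I) (smon p J) = (if I \<subseteq> J then c *\<^sub>R smon p (J - I) else 0)"
proof -
  have "\<exists>c\<in>{1, -1}. ap (prod_list (map Dth xs)) (smon p J) =
      (if set xs \<subseteq> J then c *\<^sub>R smon p (J - set xs) else 0)" if "distinct xs" for xs
    using that
  proof (induction xs)
    case Nil
    show ?case by (intro bexI[of _ 1]) auto
  next
    case (Cons i xs)
    then obtain c where c: "c \<in> {1, -1}" "ap (prod_list (map Dth xs)) (smon p J) =
        (if set xs \<subseteq> J then c *\<^sub>R smon p (J - set xs) else 0)"
      by auto
    have "c * isgn i (J - set xs) \<in> {1, -1}"
      using c(1) by (auto simp: isgn_def uminus_power_if)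
    moreover have "J - set xs - {i} = J - insert i (set xs)"
      by blast
    then have "ap (prod_list (map Dth (i # xs))) (smon p J) =
        (if set (i # xs) \<subseteq> J then (c * isgn i (J - set xs)) *\<^sub>R smon p (J - set (i # xs)) else 0)"
      using c(2) Cons.prems by (simp add: dtheta_smon)
    ultimately show ?case
      by blast
  qed
  from this[of "sorted_list_of_set I"]
  have "\<exists>c\<in>{1, -1}. ap (oprod Dth I) (smon p J) = (if I \<subseteq> J then c *\<^sub>R smon p (J - I) else 0)"
    by (simp only: oprod_def set_sorted_list_of_set finite distinct_sorted_list_of_set)
  then show ?thesis
    using that by blast
qed

text \<open>Triangularity, by induction on p and then on J under inclusion. On x^p theta_J the terms
  of order j > p and those with I not inside J vanish; the terms with j < p or I a proper subset of
  J have zero coefficients by induction; what remains is a nonzero multiple of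
  \<open>a p J\<close>.\<close>

lemma dops_zeroI:
  assumes "B \<in> dops" and B: "\<And>p J. ap B (smon p J) = 0"
  shows "B = 0"
proof -
  obtain N a where N: "B = (\<Sum>j<N. \<Sum>I\<in>UNIV. Mul (a j I) * Dx ^ j * oprod Dth I)"
    using assms(1) unfolding dops_def by blast
  have "\<forall>J. p < N \<longrightarrow> a p J = 0" for p
  proof (induction p rule: less_induct)
    case (less p)
    have "a p J = 0" if "p < N" for J
    proof (induction J rule: finite_psubset_induct[OF finite])
      case (1 J)
      obtain c where c: "c \<in> {1, -1}" "ap (oprod Dth J) (smon p J) = c *\<^sub>R smon p {}"
        using oprod_Dth_smon[of J p J] by auto
      have "a j I * ap (Dx ^ j) (ap (oprod Dth I) (smon p J)) =
          (if J = I then if p = j then (c * fact p) *\<^sub>R a p J else 0 else 0)" if "j < N" for j I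
      proof -
        obtain d where d: "ap (oprod Dth I) (smon p J) = (if I \<subseteq> J then d *\<^sub>R smon p (J - I) else 0)"
          using oprod_Dth_smon[of I p J] by metis
        consider "j < p" | "p < j" | "j = p" "I = J" | "j = p" "I \<subset> J" | "j = p" "\<not> I \<subseteq> J"
          by fastforce
        then show ?thesis
        proof cases
          case 1
          then show ?thesis using less that by auto
        next
          case 2
          then show ?thesis by (auto simp: d funpow_dx_smon)
        next
          case 3
          have "smon 0 {} = (1 :: 'a sfun)"
            by (rule sfun_eqI) (simp add: coef_smon coef_one)
          with 3 show ?thesis by (simp add: c funpow_dx_smon)
        next
          case 4
          then show ?thesis using 1 by auto
        next
          case 5
          then show ?thesis by (auto simp: d)
        qed
      qed
      then have "ap B (smon p J) = (\<Sum>j<N. \<Sum>I\<in>UNIV. if J = I then if p = j then (c * fact p) *\<^sub>R a p J else 0 else 0)"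
        unfolding N by (simp add: mult.assoc)
      then show ?case
        using B \<open>p < N\<close> c(1) by auto
    qed
    then show ?case by blast
  qed
  then show ?thesis
    unfolding N by (simp add: Mul_simps)
qed

text \<open>The operators supercommuting with the fields of \<open>1\<close> and \<open>\<theta>\<^sub>i\<close>; multiplying \<^term>\<open>Q i\<close> by
  \<^term>\<open>Par\<close> turns supercommutators into commutators.\<close>

definition invar :: "'n::{finite,linorder} lop set" where
  "invar = {B. Dx * B = B * Dx \<and> (\<forall>i. Q i * Par * B = B * (Q i * Par))}"

lemma invar_closed [intro, simp]:
  shows invar_one: "1 \<in> invar"
    and invar_zero: "0 \<in> invar"
    and invar_add: "A \<in> invar \<Longrightarrow> B \<in> invar \<Longrightarrow> A + B \<in> invar"
    and invar_diff: "A \<in> invar \<Longrightarrow> B \<in> invar \<Longrightarrow> A - B \<in> invar"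
    and invar_scaleR: "A \<in> invar \<Longrightarrow> c *\<^sub>R A \<in> invar"
  by (auto simp: invar_def algebra_simps)

lemma invar_mult [intro, simp]:
  assumes "A \<in> invar" "B \<in> invar"
  shows "A * B \<in> invar"
proof -
  have "T * (A * B) = A * B * T" if "T * A = A * T" "T * B = B * T" for T
    using that by (metis mult.assoc)
  with assms show ?thesis
    by (auto simp: invar_def)
qed

lemma invar_sum [intro]: "(\<And>a. a \<in> S \<Longrightarrow> f a \<in> invar) \<Longrightarrow> (\<Sum>a\<in>S. f a) \<in> invar"
  by (induction S rule: infinite_finite_induct) auto

lemma invar_Dx [intro, simp]: "Dx \<in> invar"
  by (simp add: invar_def Par_Dx Dx_Q mult.assoc) (metis Dx_Q mult.assoc)

text \<open>\<open>Eta i\<close> anticommutes both with \<open>Q j\<close> and with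
  \<open>Par\<close>, hence commutes with their product.\<close>

lemma invar_Eta [intro, simp]: "Eta i \<in> invar"
proof -
  have "Q j * Par * Eta i = Eta i * (Q j * Par)" for j
    by (simp add: mult.assoc Par_Eta) (simp add: Q_Eta flip: mult.assoc)
  then show ?thesis
    by (simp add: invar_def Dx_Eta)
qed

lemma invar_power [intro]: "A \<in> invar \<Longrightarrow> A ^ k \<in> invar"
  by (induction k) auto

lemma invar_oprod_Eta [intro, simp]: "oprod Eta I \<in> invar"
proof -
  have "prod_list (map Eta xs) \<in> invar" for xs
    by (induction xs) auto
  then show ?thesis
    by (simp add: oprod_def)
qed

lemma dx_eq_zero:
  assumes "dx F = 0" and "\<And>K. coef F K 0 = 0"
  shows "F = 0"
proof (rule sfun_eqI)
  fix K x
  have "\<forall>y. (coef F K has_field_derivative 0) (at y)"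
    using coef_has_deriv[of F K] assms(1) by simp
  then have "coef F K x = coef F K 0"
    by (rule DERIV_isconst_all)
  then show "coef F K x = coef 0 K x"
    using assms(2) by simp
qed

text \<open>The fields of 1 and theta_i move the origin to every point. The coefficient of B F at
  insert i K is, up to sign, the one of B (Q_i F) at K, so all coefficients vanish at x = 0; and
  d/dx of B (x^p theta_J) is p B (x^(p-1) theta_J), so they vanish for all x by induction on
  p.\<close>

lemma invar_zeroI:
  assumes "B \<in> dops" and "B \<in> invar" and ev: "\<And>p J. ev (ap B (smon p J)) = 0"
  shows "B = 0"
proof (rule dops_zeroI[OF assms(1)])
  have coef: "\<forall>p J. coef (ap B (smon p J)) K 0 = 0" for K
  proof (induction K rule: finite_induct[OF finite])
    case 1
    show ?case using ev by (simp add: ev_def)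
  next
    case (2 i K)
    have "coef (ap B (smon p J)) (insert i K) 0 = 0" for p J
    proof -
      have "ap (Q i * Par) (ap B (smon p J)) = ap B (ap (Q i * Par) (smon p J))"
        using assms(2) by (metis (mono_tags, lifting) ap_simps(7) invar_def mem_Collect_eq)
      also have "coef \<dots> K 0 = 0"
        using 2 by (simp add: Q_def dtheta_smon theta_smon)
      finally show ?thesis
        using \<open>i \<notin> K\<close> by (simp add: coef_Q coef_par)
    qed
    then show ?case by blast
  qed
  fix p J
  show "ap B (smon p J) = 0"
  proof (induction p)
    case 0
    have "dx (ap B (smon 0 J)) = ap (Dx * B) (smon 0 J)"
      by simp
    also have "\<dots> = ap (B * Dx) (smon 0 J)"
      using assms(2) by (simp only: invar_def mem_Collect_eq)
    finally have "dx (ap B (smon 0 J)) = 0"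
      by simp
    then show ?case
      by (rule dx_eq_zero) (simp add: coef)
  next
    case (Suc p)
    have "dx (ap B (smon (Suc p) J)) = ap (Dx * B) (smon (Suc p) J)"
      by simp
    also have "\<dots> = ap (B * Dx) (smon (Suc p) J)"
      using assms(2) by (simp only: invar_def mem_Collect_eq)
    finally have "dx (ap B (smon (Suc p) J)) = 0"
      by (simp add: Suc)
    then show ?case
      by (rule dx_eq_zero) (simp add: coef)
  qed
qed

lemma ev_oprod_Eta:
  obtains c where "c \<in> {1, -1}"
    "\<And>j p J. ev (ap (oprod Eta I * Dx ^ j) (smon p J)) = (if p = j \<and> J = I then c * fact j else 0)"
proof -
  obtain c where "c \<in> {1, -1}" "\<And>F x. coef (ap (oprod Eta I) F) {} x = c * coef F I x"
    using coef_oprod[of Eta I] coef_eta by metis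
  then show ?thesis
    by (intro that[of c]) (auto simp: ev_def funpow_dx_smon coef_smon)
qed

text \<open>Up to the factors \<open>c I\<close> and j! the operators
  \<open>oprod Eta I * Dx ^ j\<close> are dual to the monomials, and \<open>c I\<close> is its own
  inverse. The bound N reflects the finite order of differential operators. With
  \<open>invar_zeroI\<close> this identifies invariant operators with forms of finite order.\<close>

lemma invar_realize:
  fixes b :: "nat \<Rightarrow> 'n::{finite,linorder} set \<Rightarrow> real"
  assumes "\<And>j I. j \<ge> N \<Longrightarrow> b j I = 0"
  obtains B where "B \<in> dops" "B \<in> invar" "\<And>p J. ev (ap B (smon p J)) = b p J"
proof -
  have "\<exists>c. \<forall>I. c I \<in> {1, -1} \<and> (\<forall>j p J. ev (ap (oprod Eta I * Dx ^ j) (smon p J)) =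
      (if p = j \<and> J = (I :: 'n set) then c I * fact j else 0))"
    by (rule choice) (metis ev_oprod_Eta)
  then obtain c where c: "\<And>I :: 'n set. c I \<in> {1, -1}"
    and ev: "\<And>(I :: 'n set) j p J. ev (ap (oprod Eta I * Dx ^ j) (smon p J)) =
      (if p = j \<and> J = I then c I * fact j else 0 :: real)"
    by blast
  define B where "B = (\<Sum>j<N. \<Sum>I\<in>UNIV. (b j I * c I / fact j) *\<^sub>R (oprod Eta I * Dx ^ j))"
  have "ev (ap B (smon p J)) = b p J" for p J
  proof -
    have "c I * c I = 1" for I
      using c[of I] by auto
    then have "ev (ap B (smon p J)) = (\<Sum>j<N. \<Sum>I\<in>UNIV. if J = I then if p = j then b p J else 0 else 0)"
      unfolding B_def ap_sum ev_sum ap_simps(6) ev_simps(5) ev by (intro sum.cong) auto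
    then show ?thesis
      using assms[of p J] by (simp add: not_less)
  qed
  moreover have "B \<in> dops" "B \<in> invar"
    unfolding B_def by (auto intro!: dops_sum dops_scaleR dops_mult dops_power dops_oprod
        invar_sum invar_scaleR invar_mult invar_power)
  ultimately show ?thesis
    using that by blast
qed

section \<open>Antiderivatives and the commutator with \<open>Dx\<close>\<close>

lemma smooth_antiderivative:
  assumes "smooth f"
  obtains g where "smooth g" "\<And>x. (g has_field_derivative f x) (at x)"
proof -
  have "isCont f x" for x
    using assms smooth_differentiable field_differentiable_imp_continuous_at by blast
  then have "\<exists>g. \<forall>x. - \<infinity> < ereal x \<longrightarrow> ereal x < \<infinity> \<longrightarrow> (g has_vector_derivative f x) (at x)"
    by (intro einterval_antiderivative) auto
  then obtain g where g: "\<And>x. (g has_field_derivative f x) (at x)"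
    by (auto simp: has_real_derivative_iff_has_vector_derivative)
  then have "deriv g = f"
    by (auto simp: DERIV_imp_deriv)
  moreover have "g field_differentiable at x" for x
    using g[of x] unfolding field_differentiable_def by blast
  ultimately have "smooth g"
    using assms by (intro smooth_coinduct[where P = "\<lambda>h. h = g \<or> smooth h"])
      (auto simp: smooth_deriv smooth_differentiable)
  then show ?thesis
    using g that by blast
qed

lemma dx_surj: obtains G where "dx G = F"
proof -
  have "\<exists>g. \<forall>I. smooth (g I) \<and> (\<forall>x. (g I has_field_derivative coef F I x) (at x))"
    by (rule choice) (metis smooth_antiderivative smooth_coef)
  then obtain g where g: "\<And>I. smooth (g I)" "\<And>I x. (g I has_field_derivative coef F I x) (at x)"
    by blast
  have "coef (Abs_sfun g) = g"
    using g(1) by (simp add: Abs_sfun_inverse)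
  then show ?thesis
    using that[of "Abs_sfun g"] dx_eqI g(2) by metis
qed

text \<open>\<open>Dx\<close> commutes with \<open>Dx ^ j\<close> and \<open>oprod Dth I\<close>, so
  its commutator only differentiates the coefficients, and these have antiderivatives.\<close>

lemma dops_commutator_Dx:
  assumes "A \<in> dops"
  obtains B where "B \<in> dops" "Dx * B - B * Dx = A"
proof -
  obtain N a where A: "A = (\<Sum>j<N. \<Sum>I\<in>UNIV. Mul (a j I) * Dx ^ j * oprod Dth I)"
    using assms unfolding dops_def by blast
  have "\<exists>b. \<forall>j I. dx (b j I) = a j I"
    by (intro choice allI) (metis dx_surj)
  then obtain b where b: "\<And>j I. dx (b j I) = a j I"
    by blast
  define B where "B = (\<Sum>j<N. \<Sum>I\<in>UNIV. Mul (b j I) * Dx ^ j * oprod Dth I)"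
  have "Dx * oprod Dth I = oprod Dth I * Dx" for I :: "'a set"
  proof -
    have "Dx * prod_list (map Dth xs) = prod_list (map Dth xs) * Dx" for xs :: "'a list"
      by (induction xs) (simp_all, metis Dx_Dth mult.assoc)
    then show ?thesis
      by (simp add: oprod_def)
  qed
  then have "Dx * (Dx ^ j * oprod Dth I) = Dx ^ j * oprod Dth I * Dx" for j and I :: "'a set"
    by (metis mult.assoc power_commutes)
  then have "Dx * (Mul F * Dx ^ j * oprod Dth I) - Mul F * Dx ^ j * oprod Dth I * Dx =
      Mul (dx F) * Dx ^ j * oprod Dth I" for F :: "'a sfun" and j I
    using Dx_Mul[of F] by (simp add: mult.assoc distrib_right flip: mult.assoc[of Dx "Mul F"])
  then have "Dx * B - B * Dx = A"
    by (simp add: A B_def sum_distrib_left sum_distrib_right b flip: sum_subtractf)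
  moreover have "B \<in> dops"
    unfolding B_def by (intro dops_sum dops_monomial)
  ultimately show ?thesis
    using that by blast
qed

section \<open>The superalgebra osp(n|2)\<close>

lemma eta_gens [simp]:
  "eta i 1 = 0" "eta i (theta j) = (if i = j then 1 else 0)" "eta i xcoord = - theta i"
  by (simp_all add: eta_def dtheta_theta)

lemma Lie_linear:
  "Lie l (F + G) = Lie l F + Lie l G" "Lie l (c *\<^sub>R F) = c *\<^sub>R Lie l F" "Lie l 0 = 0"
  by (simp_all add: Lie_def Mul_simps distrib_right sum.distrib scaleR_right_distrib
      scaleR_sum_right mult.commute)

lemma Par_Lie: "Par * Lie l F = Lie l (par F) * Par"
proof -
  have "Par * (Mul F * B) = Mul (par F) * (Par * B)" for F and B :: "'a lop"
    by (simp add: Par_Mul flip: mult.assoc)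
  then show ?thesis
    by (simp add: Lie_def distrib_left distrib_right sum_distrib_left sum_distrib_right
        Par_Mul Par_Dx Par_Eta mult.assoc par_eta dx_par Mul_simps)
qed

lemma inj_contact_field: "inj contact_field"
proof (rule injI)
  \<comment> \<open>The generating function is read off from the values of the field on the
    coordinate functions.\<close>
  have "F = contact_field F xcoord + (\<Sum>i\<in>UNIV. contact_field F (theta i) * theta i)" for F :: "'a sfun"
  proof -
    have "contact_field F (theta i) = (1/2) *\<^sub>R par (eta i F)" for i
      by (simp add: contact_field_eq Lie_def if_distrib cong: if_cong)
    moreover have "contact_field F xcoord = F - (1/2) *\<^sub>R (\<Sum>i\<in>UNIV. par (eta i F) * theta i)"
      by (simp add: contact_field_eq Lie_def sum_negf)
    ultimately show ?thesis
      by (simp add: scaleR_sum_right)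
  qed
  then show "F = G" if "contact_field F = contact_field G" for F G :: "'a sfun"
    using that by metis
qed

definition osp_gens :: "'n::{finite,linorder} sfun set" where
  "osp_gens = {1, xcoord, xcoord ^ 2} \<union> range theta \<union> range (\<lambda>i. xcoord * theta i)
     \<union> {theta i * theta j |i j. i < j}"

lemma osp_fun_eq: "(osp_fun :: 'n::{finite,linorder} sfun set) = span osp_gens"
proof -
  have "linear (contact_field :: 'n sfun \<Rightarrow> _)"
    by (auto simp: linear_iff contact_field_eq fun_eq_iff Lie_linear scaleR_fun_def)
  then have eq: "osp = contact_field ` span (osp_gens :: 'n sfun set)"
    unfolding osp_def osp_gens_def by (rule linear_span_image)
  have "contact_field F \<in> osp \<longleftrightarrow> F \<in> span osp_gens" for F :: "'n sfun"
    unfolding eq by (rule inj_image_mem_iff[OF inj_contact_field])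
  then show ?thesis
    unfolding osp_fun_def by blast
qed

lemma theta_theta_osp: "theta i * theta j \<in> osp_fun"
proof (cases i j rule: linorder_cases)
  case less
  then show ?thesis
    unfolding osp_fun_eq osp_gens_def by (intro span_base) auto
next
  case equal
  then show ?thesis
    by (simp add: osp_fun_eq span_zero)
next
  case greater
  then have "- (theta j * theta i) \<in> osp_fun"
    unfolding osp_fun_eq osp_gens_def by (intro span_neg span_base) auto
  then show ?thesis
    by (simp add: theta_commute[of i])
qed

lemma osp_fun_mem [intro, simp]:
  "0 \<in> osp_fun" "1 \<in> osp_fun" "xcoord \<in> osp_fun" "xcoord * xcoord \<in> osp_fun" "theta i \<in> osp_fun"
  "xcoord * theta i \<in> osp_fun" "theta i * theta j \<in> osp_fun"
  using theta_theta_osp unfolding osp_fun_eq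
  by (auto simp: osp_gens_def power2_eq_square intro: span_zero span_base)

lemma osp_fun_add [intro, simp]: "F \<in> osp_fun \<Longrightarrow> G \<in> osp_fun \<Longrightarrow> F + G \<in> osp_fun"
  and osp_fun_diff [intro, simp]: "F \<in> osp_fun \<Longrightarrow> G \<in> osp_fun \<Longrightarrow> F - G \<in> osp_fun"
  and osp_fun_minus [intro, simp]: "F \<in> osp_fun \<Longrightarrow> - F \<in> osp_fun"
  and osp_fun_scaleR [intro, simp]: "F \<in> osp_fun \<Longrightarrow> c *\<^sub>R F \<in> osp_fun"
  unfolding osp_fun_eq by (auto intro: span_add span_diff span_neg span_scale)

text \<open>The products theta_i theta_j appear for all i and j, so that later arguments need no
  distinction by order.\<close>

lemma osp_fun_induct [consumes 1, case_names zero add scaleR one xcoord xx theta xtheta thetatheta]: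
  assumes "F \<in> osp_fun" and "P 0"
    and "\<And>F G. F \<in> osp_fun \<Longrightarrow> G \<in> osp_fun \<Longrightarrow> P F \<Longrightarrow> P G \<Longrightarrow> P (F + G)"
    and "\<And>c F. F \<in> osp_fun \<Longrightarrow> P F \<Longrightarrow> P (c *\<^sub>R F)"
    and "P 1" "P xcoord" "P (xcoord * xcoord)" "\<And>i. P (theta i)" "\<And>i. P (xcoord * theta i)"
      "\<And>i j. P (theta i * theta j)"
  shows "P F"
proof -
  have "F \<in> osp_fun \<and> P F"
    using assms(1) unfolding osp_fun_eq
  proof (induction rule: span_induct_alt)
    case base
    then show ?case using assms by (simp add: span_zero)
  next
    case (step c G F)
    then have "G \<in> osp_fun"
      by (simp add: osp_fun_eq span_base)
    moreover have "P G"
      using step(1) assms by (auto simp: osp_gens_def power2_eq_square)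
    ultimately show ?case
      using step assms(3,4) by (auto simp flip: osp_fun_eq)
  qed
  then show ?thesis ..
qed

lemma par_osp: "F \<in> osp_fun \<Longrightarrow> par F \<in> osp_fun"
  by (induction rule: osp_fun_induct) simp_all

lemma hpart_osp: "F \<in> osp_fun \<Longrightarrow> hpart p F \<in> osp_fun"
  by (simp add: hpart_eq par_osp)

lemma theta_xcoord: "theta i * xcoord = xcoord * theta i"
  by (rule xcoord_commute)

lemma eta_theta_theta: "eta k (theta i * theta j) = (if k = i then theta j else 0) - (if k = j then theta i else 0)"
  by (simp add: eta_mult)

lemma eta_xcoord_theta: "eta k (xcoord * theta i) = (if k = i then xcoord else 0) - theta k * theta i"
  by (simp add: eta_mult)

lemma eta_xcoord_xcoord: "eta k (xcoord * xcoord) = - 2 *\<^sub>R (xcoord * theta k)"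
  by (simp add: eta_mult theta_xcoord scaleR_2)

lemma theta_theta_left [simp]: "theta i * (theta i * F) = 0"
  by (simp flip: mult.assoc)

lemma if_zero_distrib:
  "(if c then a else 0) * b = (if c then a * b else 0)" "b * (if c then a else 0) = (if c then b * a else 0)"
  "par (if c then F else 0) = (if c then par F else 0)"
  for a b :: "'a::ring_1"
  by auto

lemma diff_half [simp]: "F - (1/2) *\<^sub>R F = (1/2) *\<^sub>R F" for F :: "'a::real_vector"
  using scaleR_left_diff_distrib[of 1 "1/2" F] by simp

lemma bracket_theta: "contact_bracket (theta i) G = theta i * dx G + (1/2) *\<^sub>R eta i G"
  by (simp add: contact_bracket_eq if_zero_distrib)

lemma bracket_xcoord:
  "contact_bracket xcoord G = xcoord * dx G - G + (1/2) *\<^sub>R (\<Sum>k\<in>UNIV. theta k * eta k G)"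
  by (simp add: contact_bracket_eq)

lemma bracket_theta_theta:
  "contact_bracket (theta a * theta b) G =
    theta a * theta b * dx G - (1/2) *\<^sub>R (theta b * eta a G - theta a * eta b G)"
  by (simp add: contact_bracket_eq eta_theta_theta left_diff_distrib sum_subtractf if_zero_distrib
      dx_mult algebra_simps)

lemma bracket_xcoord_theta:
  "contact_bracket (xcoord * theta i) G = xcoord * theta i * dx G - theta i * G
    + (1/2) *\<^sub>R (xcoord * eta i G - (\<Sum>k\<in>UNIV. theta k * theta i * eta k G))"
  by (simp add: contact_bracket_eq eta_xcoord_theta left_diff_distrib sum_subtractf if_zero_distrib
      dx_mult)

lemma theta_theta_square [simp]: "theta k * (theta i * (theta k * theta i)) = 0"
  by (subst theta_commute[of k i]) simp

lemma xcoord_left_commute: "theta i * (xcoord * F) = xcoord * (theta i * F)"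
  by (metis mult.assoc theta_xcoord)

text \<open>\<open>xcoord\<close> is the Euler field, which grades the algebra: \<open>1\<close> and
  \<open>theta i\<close> have negative degree, \<open>xcoord\<close> and the rotations
  \<open>theta a * theta b\<close> degree zero, \<open>xcoord * theta i\<close> and
  \<open>xcoord * xcoord\<close> positive degree. The odd element x theta_i has bracket x^2/2 with
  itself, so x^2 is determined by the x theta_i.\<close>

lemma bracket_table:
  "contact_bracket 1 G = dx G"
  "contact_bracket (theta i) (theta j) = (if i = j then (1/2) *\<^sub>R 1 else 0)"
  "contact_bracket (theta i) xcoord = (1/2) *\<^sub>R theta i"
  "contact_bracket (theta i) (theta a * theta b) =
    (1/2) *\<^sub>R ((if i = a then theta b else 0) - (if i = b then theta a else 0))"
  "contact_bracket (theta i) (xcoord * theta j) = (1/2) *\<^sub>R (theta i * theta j + (if i = j then xcoord else 0))"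
  "contact_bracket (theta i) (xcoord * xcoord) = xcoord * theta i"
  "contact_bracket xcoord (theta a * theta b) = 0"
  "contact_bracket xcoord (xcoord * theta i) = (1/2) *\<^sub>R (xcoord * theta i)"
  "contact_bracket (xcoord * theta i) (xcoord * theta i) = (1/2) *\<^sub>R (xcoord * xcoord)"
  "contact_bracket (theta a * theta b) (xcoord * theta i) =
    - (1/2) *\<^sub>R ((if a = i then xcoord * theta b else 0) - (if b = i then xcoord * theta a else 0))"
  "contact_bracket (theta k * theta l) (theta i * theta j) = - (1/2) *\<^sub>R
    ((if k = i then theta l * theta j else 0) - (if k = j then theta l * theta i else 0)
     - (if l = i then theta k * theta j else 0) + (if l = j then theta k * theta i else 0))"
proof -
  show "contact_bracket 1 G = dx G"
    by (simp add: contact_bracket_eq)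
  show "contact_bracket (theta i) (theta j) = (if i = j then (1/2) *\<^sub>R 1 else 0)"
    by (simp add: bracket_theta)
  show "contact_bracket (theta i) xcoord = (1/2) *\<^sub>R theta i"
    by (simp add: bracket_theta)
  show "contact_bracket (theta i) (theta a * theta b) =
    (1/2) *\<^sub>R ((if i = a then theta b else 0) - (if i = b then theta a else 0))"
    by (simp add: bracket_theta eta_theta_theta dx_mult)
  show "contact_bracket (theta i) (xcoord * theta j) = (1/2) *\<^sub>R (theta i * theta j + (if i = j then xcoord else 0))"
    by (simp add: bracket_theta eta_xcoord_theta dx_mult algebra_simps flip: scaleR_add_left)
  show "contact_bracket (theta i) (xcoord * xcoord) = xcoord * theta i"
    by (simp add: bracket_theta eta_xcoord_xcoord dx_mult theta_xcoord distrib_left)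
  show "contact_bracket xcoord (theta a * theta b) = 0"
    using theta_commute[of b a]
    by (simp add: bracket_xcoord eta_theta_theta dx_mult right_diff_distrib sum_subtractf if_zero_distrib
        flip: scaleR_2)
  show "contact_bracket xcoord (xcoord * theta i) = (1/2) *\<^sub>R (xcoord * theta i)"
    by (simp add: bracket_xcoord eta_xcoord_theta dx_mult right_diff_distrib sum_subtractf if_zero_distrib
        theta_xcoord)
  show "contact_bracket (xcoord * theta i) (xcoord * theta i) = (1/2) *\<^sub>R (xcoord * xcoord)"
    by (simp add: bracket_xcoord_theta eta_xcoord_theta dx_mult right_diff_distrib sum_subtractf
        if_zero_distrib mult.assoc xcoord_left_commute)
  show "contact_bracket (theta a * theta b) (xcoord * theta i) =
    - (1/2) *\<^sub>R ((if a = i then xcoord * theta b else 0) - (if b = i then xcoord * theta a else 0))"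
    using theta_commute[of b a]
    by (auto simp add: bracket_theta_theta eta_xcoord_theta dx_mult right_diff_distrib if_zero_distrib
        theta_xcoord algebra_simps simp flip: mult.assoc scaleR_add_left)
  show "contact_bracket (theta k * theta l) (theta i * theta j) = - (1/2) *\<^sub>R
    ((if k = i then theta l * theta j else 0) - (if k = j then theta l * theta i else 0)
     - (if l = i then theta k * theta j else 0) + (if l = j then theta k * theta i else 0))"
    by (simp add: bracket_theta_theta eta_theta_theta dx_mult right_diff_distrib if_zero_distrib
        algebra_simps)
qed

section \<open>Cochains with values in linear operators\<close>

lemma ap_fun_simps:
  "ap A \<circ> ap B = ap (A * B)" "ap A + ap B = ap (A + B)" "ap A - ap B = ap (A - B)"
  "- ap A = ap (- A)" "c *\<^sub>R ap A = ap (c *\<^sub>R A)"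
  by (rule ext; simp add: scaleR_fun_def)+

lemma ap_zero_fun: "ap 0 = 0"
  by (rule ext) simp

lemma mult_op_ap: "mult_op F = ap (Mul F)"
  by (rule ext) (simp add: mult_op_def)

definition hp :: "nat \<Rightarrow> 'n::{finite,linorder} lop" where
  "hp p = (1/2) *\<^sub>R (1 + (-1) ^ p *\<^sub>R Par)"

lemma hpart_ap: "hpart p = ap (hp p)"
  by (rule ext) (simp add: hp_def hpart_eq)

text \<open>The parity of an operator is its eigenvalue under conjugation by \<open>Par\<close>;
  weighting the parts q by (-1)^q therefore turns B into \<open>Par * B * Par\<close>.\<close>

lemma op_part_ap: "op_part p (ap B) = ap ((1/2) *\<^sub>R (B + (-1) ^ p *\<^sub>R (Par * B * Par)))"
  unfolding op_part_def hpart_ap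
  by (simp add: ap_fun_simps hp_def algebra_simps ap_eq_iff)
    (simp flip: scaleR_add_left)

lemma hpart_sum: "hpart 0 F + hpart 1 F = F"
  by (simp add: hpart_eq algebra_simps flip: scaleR_add_left)

lemma hpart_hpart:
  assumes "p \<in> {0, 1}" "q \<in> {0, 1}"
  shows "hpart p (hpart q F) = (if p = q then hpart q F else 0)"
  using assms by (auto intro!: sfun_eqI simp: coef_hpart)

lemma hpart_linear [simp]:
  "hpart p (F + G) = hpart p F + hpart p G" "hpart p (c *\<^sub>R F) = c *\<^sub>R hpart p F" "hpart p 0 = 0"
  by (simp_all add: hpart_ap)

lemma Lie_hpart: "Lie l F = Lie l (hpart 0 F) + Lie l (hpart 1 F)"
  using Lie_linear(1)[of l "hpart 0 F" "hpart 1 F"] by (simp only: hpart_sum)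

lemma op_action_ap:
  "op_action l m F (ap B) =
    ap (Lie m F * B - B * Lie l (hpart 0 F) - Par * B * Par * Lie l (hpart 1 F))"
  unfolding op_action_def op_part_ap ap_Lie ap_fun_simps Lie_hpart[of m F]
  by (simp add: ap_fun_simps ap_eq_iff algebra_simps)
    (simp flip: scaleR_add_left)

text \<open>The sign (-1)^(ux) in the coboundary of a 0-cochain moves the conjugation by
  \<open>Par\<close> from the second product of the action to the first, so the product with
  \<open>Lie l F\<close> needs no splitting by parity.\<close>

definition cob :: "real \<Rightarrow> real \<Rightarrow> 'n::{finite,linorder} lop \<Rightarrow> 'n sfun \<Rightarrow> 'n lop" where
  "cob l m B F = Lie m (hpart 0 F) * B + Lie m (hpart 1 F) * (Par * B * Par) - B * Lie l F"

lemma delta0_ap: "delta0 l m (ap B) F = ap (cob l m B F)"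
  unfolding delta0_def op_part_ap op_action_ap cob_def Lie_hpart[of l F]
  by (simp add: ap_fun_simps ap_eq_iff hpart_hpart Lie_linear algebra_simps)
    (simp flip: scaleR_add_left)

definition cj :: "nat \<Rightarrow> 'n::{finite,linorder} lop \<Rightarrow> 'n lop" where
  "cj q B = Par ^ q * B * Par ^ q"

lemma cj_simps [simp]: "cj 0 B = B" "cj (Suc 0) B = Par * B * Par" "cj q 0 = 0"
  by (simp_all add: cj_def)

definition homog :: "nat \<Rightarrow> 'n::{finite,linorder} sfun \<Rightarrow> bool" where
  "homog q F \<longleftrightarrow> q \<in> {0, 1} \<and> par F = (-1) ^ q *\<^sub>R F"

lemma hpart_homog: "homog q F \<Longrightarrow> p \<in> {0, 1} \<Longrightarrow> hpart p F = (if p = q then F else 0)"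
  by (auto simp: homog_def hpart_eq simp flip: scaleR_2)

lemma homog_hpart: "q \<in> {0, 1} \<Longrightarrow> homog q (hpart q F)"
  by (auto simp: homog_def hpart_eq algebra_simps)

lemma cob_homog: "homog q F \<Longrightarrow> cob l m B F = Lie m F * cj q B - B * Lie l F"
  using hpart_homog[of q F 0] hpart_homog[of q F 1]
  by (auto simp: cob_def homog_def Lie_linear)

text \<open>The coboundary of a 1-cochain, without the term containing the bracket, on arguments of
  parity \<open>q\<close> and \<open>r\<close>.\<close>

definition cob1 :: "real \<Rightarrow> real \<Rightarrow> ('n::{finite,linorder} sfun \<Rightarrow> 'n lop) \<Rightarrow> nat \<Rightarrow> nat \<Rightarrow>
    'n sfun \<Rightarrow> 'n sfun \<Rightarrow> 'n lop" where
  "cob1 l m \<phi> q r u v = (-1) ^ (q * r) *\<^sub>R (Lie m u * cj q (\<phi> v) - \<phi> v * Lie l u)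
     - (Lie m v * cj r (\<phi> u) - \<phi> u * Lie l v)"

text \<open>The representation of f by \<phi> is required only on the homogeneous components of the
  two arguments; the value on their bracket stays separate.\<close>

lemma delta1_ap:
  assumes F: "\<And>q. q \<in> {0, 1} \<Longrightarrow> f (hpart q F) = ap (\<phi> (hpart q F))"
    and G: "\<And>q. q \<in> {0, 1} \<Longrightarrow> f (hpart q G) = ap (\<phi> (hpart q G))" and f0: "f 0 = 0"
  shows "delta1 l m f F G =
    ap (\<Sum>q\<in>{0,1}. \<Sum>r\<in>{0,1}. cob1 l m \<phi> q r (hpart q F) (hpart r G)) - f (contact_bracket F G)"
proof -
  have 0: "op_part p 0 = 0" for p
    using op_part_ap[of p 0] by (simp add: ap_zero_fun)
  have F': "cochain_part p f (hpart q F) = op_part (p + q) (ap (\<phi> (hpart q F)))" if "q \<in> {0, 1}" for p q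
    using that by (auto simp: cochain_part_def hpart_hpart f0 0 F)
  have G': "cochain_part p f (hpart q G) = op_part (p + q) (ap (\<phi> (hpart q G)))" if "q \<in> {0, 1}" for p q
    using that by (auto simp: cochain_part_def hpart_hpart f0 0 G)
  show ?thesis
    unfolding delta1_def
    by (simp add: F' G' op_part_ap op_action_ap ap_fun_simps hpart_hpart Lie_linear cob1_def
        algebra_simps ap_eq_iff)
      (simp flip: scaleR_add_left)
qed

section \<open>Cocycles\<close>

text \<open>The cocycle condition is stated for homogeneous arguments, where it contains no
  projections; bilinearity gives the general case.\<close>

definition cocyc :: "real \<Rightarrow> real \<Rightarrow> ('n::{finite,linorder} sfun \<Rightarrow> 'n lop) set" where
  "cocyc l m = {\<phi>. (\<forall>F\<in>osp_fun. \<phi> F \<in> dops) \<and>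
     (\<forall>F\<in>osp_fun. \<forall>G\<in>osp_fun. \<phi> (F + G) = \<phi> F + \<phi> G) \<and>
     (\<forall>c. \<forall>F\<in>osp_fun. \<phi> (c *\<^sub>R F) = c *\<^sub>R \<phi> F) \<and>
     (\<forall>q r u v. homog q u \<longrightarrow> homog r v \<longrightarrow> u \<in> osp_fun \<longrightarrow> v \<in> osp_fun \<longrightarrow>
        \<phi> (contact_bracket u v) = cob1 l m \<phi> q r u v)}"

lemma cocycD:
  assumes "\<phi> \<in> cocyc l m"
  shows "F \<in> osp_fun \<Longrightarrow> \<phi> F \<in> dops"
    and "F \<in> osp_fun \<Longrightarrow> G \<in> osp_fun \<Longrightarrow> \<phi> (F + G) = \<phi> F + \<phi> G"
    and "F \<in> osp_fun \<Longrightarrow> \<phi> (c *\<^sub>R F) = c *\<^sub>R \<phi> F"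
    and "homog q u \<Longrightarrow> homog r v \<Longrightarrow> u \<in> osp_fun \<Longrightarrow> v \<in> osp_fun \<Longrightarrow>
        \<phi> (contact_bracket u v) = cob1 l m \<phi> q r u v"
  using assms unfolding cocyc_def by blast+

lemma cocyc_zero: "\<phi> \<in> cocyc l m \<Longrightarrow> \<phi> 0 = 0"
  using cocycD(3)[of \<phi> l m 0 0] by simp

lemma cocyc_minus: "\<phi> \<in> cocyc l m \<Longrightarrow> F \<in> osp_fun \<Longrightarrow> \<phi> (- F) = - \<phi> F"
  using cocycD(3)[of \<phi> l m F "-1"] by simp

lemma cocyc_diff_right:
  "\<phi> \<in> cocyc l m \<Longrightarrow> F \<in> osp_fun \<Longrightarrow> G \<in> osp_fun \<Longrightarrow> \<phi> (F - G) = \<phi> F - \<phi> G"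
  using cocycD(2)[of \<phi> l m F "- G"] cocyc_minus[of \<phi> l m G] by simp

lemma cj_linear:
  "cj q (A + B) = cj q A + cj q B" "cj q (A - B) = cj q A - cj q B" "cj q (c *\<^sub>R A) = c *\<^sub>R cj q A"
  by (simp_all add: cj_def algebra_simps)

lemma cob1_linear:
  "cob1 l m (\<lambda>F. \<phi> F - \<psi> F) q r u v = cob1 l m \<phi> q r u v - cob1 l m \<psi> q r u v"
  "cob1 l m (\<lambda>F. \<phi> F + \<psi> F) q r u v = cob1 l m \<phi> q r u v + cob1 l m \<psi> q r u v"
  "cob1 l m (\<lambda>F. c *\<^sub>R \<phi> F) q r u v = c *\<^sub>R cob1 l m \<phi> q r u v"
  by (simp_all add: cob1_def cj_linear algebra_simps)

lemma cocyc_diff: "\<phi> \<in> cocyc l m \<Longrightarrow> \<psi> \<in> cocyc l m \<Longrightarrow> (\<lambda>F. \<phi> F - \<psi> F) \<in> cocyc l m"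
  unfolding cocyc_def by (auto simp: cob1_linear scaleR_right_diff_distrib)

lemma cocyc_add: "\<phi> \<in> cocyc l m \<Longrightarrow> \<psi> \<in> cocyc l m \<Longrightarrow> (\<lambda>F. \<phi> F + \<psi> F) \<in> cocyc l m"
  unfolding cocyc_def by (auto simp: cob1_linear scaleR_right_distrib)

lemma cocyc_scaleR: "\<phi> \<in> cocyc l m \<Longrightarrow> (\<lambda>F. c *\<^sub>R \<phi> F) \<in> cocyc l m"
  unfolding cocyc_def by (auto simp: cob1_linear scaleR_right_distrib)

lemma contact_bracket_linear:
  "contact_bracket (F + G) H = contact_bracket F H + contact_bracket G H"
  "contact_bracket F (G + H) = contact_bracket F G + contact_bracket F H"
  "contact_bracket (- F) H = - contact_bracket F H"
  "contact_bracket F (- H) = - contact_bracket F H"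
  by (simp_all add: contact_bracket_eq algebra_simps sum.distrib sum_negf)

lemma par_contact_bracket: "par (contact_bracket F G) = contact_bracket (par F) (par G)"
  by (simp add: contact_bracket_eq par_eta dx_par)

lemma homog_contact_bracket:
  assumes "homog q u" "homog r v"
  shows "homog ((q + r) mod 2) (contact_bracket u v)"
  using assms
  by (auto simp: homog_def par_contact_bracket contact_bracket_linear)

lemma Lie_contact_bracket:
  assumes "homog q u" "homog r v"
  shows "Lie l (contact_bracket u v) = Lie l u * Lie l v - (-1) ^ (q * r) *\<^sub>R (Lie l v * Lie l u)"
  using Lie_bracket[of u "(-1) ^ q" v "(-1) ^ r" l] assms by (auto simp: homog_def)

lemma Par_Lie_homog: "homog q u \<Longrightarrow> Par * (Lie l u * A) = (-1) ^ q *\<^sub>R (Lie l u * (Par * A))"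
  by (auto simp: Par_Lie homog_def Lie_linear simp flip: mult.assoc)

text \<open>This is \<delta>\<delta> = 0. It rests only on \<open>Lie\<close> being a homomorphism
  and so holds for arbitrary homogeneous functions, not just in osp(n|2).\<close>

lemma cob_contact_bracket:
  assumes u: "homog q u" and v: "homog r v"
  shows "cob l m B (contact_bracket u v) = cob1 l m (cob l m B) q r u v"
proof -
  have q: "q = 0 \<or> q = 1" and r: "r = 0 \<or> r = 1"
    using u v by (auto simp: homog_def)
  note P = Par_Lie_homog[OF u] Par_Lie_homog[OF v]
  note P' = P[of _ 1, simplified]
  show ?thesis
    using q r unfolding cob_homog[OF homog_contact_bracket[OF u v]] Lie_contact_bracket[OF u v]
      cob1_def cob_homog[OF u] cob_homog[OF v]
    by (auto simp: algebra_simps P P')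
qed

lemma cob_dops: "B \<in> dops \<Longrightarrow> cob l m B F \<in> dops"
  unfolding cob_def by (intro dops_diff dops_add dops_mult) auto

lemma cob_linear:
  "cob l m B (F + G) = cob l m B F + cob l m B G" "cob l m B (c *\<^sub>R F) = c *\<^sub>R cob l m B F"
  "cob l m (A + B) F = cob l m A F + cob l m B F" "cob l m (c *\<^sub>R B) F = c *\<^sub>R cob l m B F"
  by (simp_all add: cob_def Lie_linear algebra_simps)

lemma cob_cocyc: "B \<in> dops \<Longrightarrow> cob l m B \<in> cocyc l m"
  unfolding cocyc_def by (simp add: cob_dops cob_linear cob_contact_bracket)

section \<open>The generators acting on monomials\<close>

lemma homog_gens [simp]:
  "homog 0 1" "homog 0 xcoord" "homog 0 (xcoord * xcoord)" "homog 0 (theta a * theta b)"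
  "homog (Suc 0) (theta i)" "homog (Suc 0) (xcoord * theta i)" "homog 1 (theta i)"
  by (simp_all add: homog_def)

lemma Lie_one: "Lie l 1 = Dx"
  by (simp add: Lie_def Mul_simps)

text \<open>\<open>dx (theta i)\<close> is zero, so the weight does not enter. The same holds for
  \<open>1\<close>, and the normalisation of cocycles on these fields is thus independent of l and
  m.\<close>

lemma Lie_theta: "Lie l (theta i) = (1/2) *\<^sub>R Q i"
  by (simp add: Lie_def if_distrib if_distribR Mul_simps Eta_def Q_def algebra_simps cong: if_cong)
    (simp flip: scaleR_add_left)

lemma ap_Lie_xcoord: "ap (Lie l xcoord) G =
    xcoord * dx G + (1/2) *\<^sub>R (\<Sum>k\<in>UNIV. theta k * dtheta k G) + l *\<^sub>R G"
  by (simp add: Lie_def eta_def right_diff_distrib)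

lemma ap_Lie_theta_theta: "ap (Lie l (theta a * theta b)) G =
    (1/2) *\<^sub>R (theta a * dtheta b G - theta b * dtheta a G)"
proof -
  have h: "theta b * (theta a * dx G) = - (theta a * (theta b * dx G))"
    by (simp add: theta_commute[of b a] flip: mult.assoc)
  have "ap (Lie l (theta a * theta b)) G = theta a * (theta b * dx G)
      - (1/2) *\<^sub>R (theta b * eta a G - theta a * eta b G)"
    by (simp add: Lie_def eta_theta_theta dx_mult left_diff_distrib sum_subtractf if_zero_distrib mult.assoc algebra_simps)
  also have "theta b * eta a G - theta a * eta b G = theta b * dtheta a G - theta a * dtheta b G
      + 2 *\<^sub>R (theta a * (theta b * dx G))"
    by (simp add: eta_def right_diff_distrib h scaleR_2)
  finally show ?thesis
    by (simp add: scaleR_right_distrib scaleR_right_diff_distrib)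
qed

lemma ap_Lie_xcoord_theta: "ap (Lie l (xcoord * theta i)) G = (1/2) *\<^sub>R (xcoord * (dtheta i G + theta i * dx G)
    + theta i * (\<Sum>k\<in>UNIV. theta k * dtheta k G)) + l *\<^sub>R (theta i * G)"
proof -
  have "theta k * theta i * eta k G = - (theta i * (theta k * dtheta k G))" for k
  proof -
    have h: "theta k * (theta i * F) = - (theta i * (theta k * F))" for F
      by (simp add: theta_commute[of k i] flip: mult.assoc)
    show ?thesis
      by (simp add: eta_def right_diff_distrib mult.assoc h[of "dtheta k G"]
          h[of "theta k * dx G"])
  qed
  then have "ap (Lie l (xcoord * theta i)) G = xcoord * (theta i * dx G)
      + (1/2) *\<^sub>R (xcoord * eta i G + theta i * (\<Sum>k\<in>UNIV. theta k * dtheta k G)) + l *\<^sub>R (theta i * G)"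
    by (simp add: Lie_def eta_xcoord_theta dx_mult left_diff_distrib sum_subtractf if_zero_distrib
        sum_negf sum.distrib sum_distrib_left mult.assoc)
  also have "xcoord * (theta i * dx G) + (1/2) *\<^sub>R (xcoord * eta i G + theta i * (\<Sum>k\<in>UNIV. theta k * dtheta k G))
     = (1/2) *\<^sub>R (xcoord * (dtheta i G + theta i * dx G) + theta i * (\<Sum>k\<in>UNIV. theta k * dtheta k G))"
    by (simp add: eta_def algebra_simps) (simp flip: scaleR_add_left)
  finally show ?thesis .
qed

lemma sum_theta_dtheta_smon: "(\<Sum>k\<in>UNIV. theta k * dtheta k (smon j I)) = real (card I) *\<^sub>R smon j I"
proof -
  have "theta k * dtheta k (smon j I) = (if k \<in> I then smon j I else 0)" for k
    by (auto simp: dtheta_smon theta_smon insert_absorb)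
  then show ?thesis
    by (simp add: sum.If_cases sum_constant_scaleR del: sum_constant)
qed

lemma Lie_xcoord_smon: "ap (Lie l xcoord) (smon j I) = (real j + real (card I) / 2 + l) *\<^sub>R smon j I"
  by (cases j) (simp_all add: ap_Lie_xcoord sum_theta_dtheta_smon xcoord_smon algebra_simps)

lemma Lie_theta_theta_smon:
  assumes "b \<in> I" "a \<notin> I"
  shows "ap (Lie l (theta a * theta b)) (smon j I) =
    (isgn b I * isgn a (I - {b}) / 2) *\<^sub>R smon j (insert a (I - {b}))"
  using assms by (simp add: ap_Lie_theta_theta dtheta_smon theta_smon)

lemma card_exchange:
  fixes I :: "'a::finite set"
  assumes "b \<in> I" "a \<notin> I"
  shows "card (insert a (I - {b})) = card I"
proof -
  have "card (insert a (I - {b})) = Suc (card (I - {b}))"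
    using assms by (intro card_insert_disjoint) auto
  then show ?thesis
    using card_Suc_Diff1[of I b] assms by simp
qed

text \<open>A rotation exchanges a and b if I contains exactly one of them and kills theta_I
  otherwise. A nonzero image therefore again contains exactly one of a and b, so the empty and the
  full product are never reached.\<close>

lemma Lie_theta_theta_smon_cases:
  obtains c J where "ap (Lie l (theta a * theta b)) (smon j I) = c *\<^sub>R smon j J" "card J = card I"
    "c = 0 \<or> J \<noteq> {} \<and> J \<noteq> UNIV"
proof (cases "a \<in> I \<longleftrightarrow> b \<in> I")
  case True
  \<comment> \<open>With coefficient 0 the set J = I is a mere default and may be empty or full;
    hence the disjunction in the conclusion.\<close>
  then have "ap (Lie l (theta a * theta b)) (smon j I) = 0 *\<^sub>R smon j I"
    by (cases "a = b") (auto simp: ap_Lie_theta_theta dtheta_smon theta_smon Lie_linear)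
  then show ?thesis
    using that by blast
next
  case False
  then consider "b \<in> I" "a \<notin> I" | "a \<in> I" "b \<notin> I"
    by blast
  then show ?thesis
  proof cases
    case 1
    then have "card (insert a (I - {b})) = card I" "b \<notin> insert a (I - {b})"
      using card_exchange[OF 1] by blast+
    then show ?thesis
      by (intro that[OF Lie_theta_theta_smon[OF 1]]) blast+
  next
    case 2
    have "Lie l (theta a * theta b) = (-1) *\<^sub>R Lie l (theta b * theta a)"
      by (metis Lie_linear(2) scaleR_minus1_left theta_commute)
    moreover have "card (insert b (I - {a})) = card I" "a \<notin> insert b (I - {a})"
      using 2 card_exchange[OF 2] by blast+
    moreover have "ap ((-1) *\<^sub>R Lie l (theta b * theta a)) (smon j I) =
        (- (isgn a I * isgn b (I - {a}) / 2)) *\<^sub>R smon j (insert b (I - {a}))"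
      using Lie_theta_theta_smon[OF 2, of l j] by simp
    ultimately show ?thesis
      by (intro that[of "- (isgn a I * isgn b (I - {a}) / 2)" "insert b (I - {a})"]) (simp only:, blast+)
  qed
qed

text \<open>The factor (j + |I|)/2 + l of the second case vanishes for j = k - 1 and |I| = n - 1
  exactly when l = -(k+n-2)/2; this is where the source weight comes from.\<close>

lemma Lie_xcoord_theta_smon:
  "ap (Lie l (xcoord * theta i)) (smon j I) =
    (if i \<in> I then (isgn i I / 2) *\<^sub>R smon (Suc j) (I - {i})
     else (isgn i I * ((real j + real (card I)) / 2 + l)) *\<^sub>R smon j (insert i I))"
  unfolding ap_Lie_xcoord_theta sum_theta_dtheta_smon
  by (cases j) (auto simp: dtheta_smon theta_smon xcoord_smon algebra_simps add_divide_distrib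
      simp flip: scaleR_add_left)

lemma ev_mult: "ev (F * G) = ev F * ev G"
  by (simp add: ev_def coef_mult)

lemma ev_gens [simp]: "ev xcoord = 0" "ev 1 = 1"
  by (simp_all add: ev_def coef_xcoord coef_one)

text \<open>These fields vanish at the origin, so after evaluation a composition on the left leaves
  at most a scalar, and cocycle identities turn into identities between linear forms.\<close>

lemma ev_Lie [simp]:
  "ev (ap (Lie l xcoord) G) = l * ev G" "ev (ap (Lie l (theta a * theta b)) G) = 0"
  "ev (ap (Lie l (xcoord * theta i)) G) = 0"
  by (simp_all add: ap_Lie_xcoord ap_Lie_theta_theta ap_Lie_xcoord_theta)

section \<open>Reduction of cocycles by coboundaries\<close>

lemma cocyc_bracket_one:
  assumes "\<phi> \<in> cocyc l m" "homog r v" "v \<in> osp_fun" "\<phi> 1 = 0"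
  shows "\<phi> (dx v) = Dx * \<phi> v - \<phi> v * Dx"
  using cocycD(4)[OF assms(1) homog_gens(1) assms(2) _ assms(3)] assms(4)
  by (simp add: bracket_table(1) cob1_def Lie_one)

lemma cocyc_bracket_theta:
  assumes "\<phi> \<in> cocyc l m" "homog r v" "v \<in> osp_fun"
  shows "\<phi> (contact_bracket (theta i) v) =
    (1/2) *\<^sub>R ((-1) ^ r *\<^sub>R (Q i * Par * \<phi> v * Par - \<phi> v * Q i))
    - (Lie m v * cj r (\<phi> (theta i)) - \<phi> (theta i) * Lie l v)"
  using cocycD(4)[OF assms(1) homog_gens(7) assms(2) _ assms(3)]
  by (simp add: cob1_def Lie_theta mult.assoc algebra_simps)

text \<open>If \<phi> vanishes on the brackets of v with 1 and theta_i, the cocycle identity says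
  that \<open>\<phi> v\<close> supercommutes with these fields. The lemma is applied upwards along
  the grading.\<close>

lemma cocyc_invar:
  assumes \<phi>: "\<phi> \<in> cocyc l m" and v: "homog r v" "v \<in> osp_fun"
    and 0: "\<phi> 1 = 0" "\<And>i. \<phi> (theta i) = 0"
    and b: "\<phi> (dx v) = 0" "\<And>i. \<phi> (contact_bracket (theta i) v) = 0"
  shows "\<phi> v \<in> invar"
proof -
  have "Q i * Par * \<phi> v = \<phi> v * (Q i * Par)" for i
  proof -
    have "Q i * Par * \<phi> v * Par = \<phi> v * Q i"
      using cocyc_bracket_theta[OF \<phi> v, of i] b(2)[of i] 0(2)[of i] by simp
    then have "Q i * Par * \<phi> v * Par * Par = \<phi> v * Q i * Par"
      by simp
    then show ?thesis
      by (simp add: mult.assoc)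
  qed
  then show ?thesis
    using cocyc_bracket_one[OF \<phi> v 0(1)] b(1) by (simp add: invar_def)
qed

lemma Par_Q_left: "Par * (Q i * A) = - (Q i * (Par * A))"
  by (simp add: Par_Q flip: mult.assoc)

lemma homog_one_theta: "homog (Suc 0) (theta i)"
  by simp

lemma kill_one:
  assumes "\<phi> \<in> cocyc l m"
  obtains B where "B \<in> dops" "cob l m B 1 = \<phi> 1"
proof -
  obtain B where "B \<in> dops" "Dx * B - B * Dx = \<phi> 1"
    using dops_commutator_Dx cocycD(1)[OF assms] osp_fun_mem(2) by metis
  then show ?thesis
    using that by (simp add: cob_homog[OF homog_gens(1)] Lie_one)
qed

text \<open>The odd part of the Poincare lemma: the values on theta_i are removed one index at a
  time. Vanishing on the earlier indices makes the next value supercommute with their fields, so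
  that the next primitive does not spoil them.\<close>

lemma kill_theta:
  assumes "\<phi> \<in> cocyc l m" "\<phi> 1 = 0"
  obtains B where "B \<in> dops" "cob l m B 1 = 0" "\<And>i. cob l m B (theta i) = \<phi> (theta i)"
proof -
  have "\<exists>B\<in>dops. cob l m B 1 = 0 \<and> (\<forall>i\<in>T. cob l m B (theta i) = \<phi> (theta i))" for T
  proof (induction T rule: finite_induct[OF finite])
    case 1
    show ?case
      by (intro bexI[of _ 0]) (auto simp: cob_def)
  next
    case (2 i T)
    then obtain B where B: "B \<in> dops" "cob l m B 1 = 0" "\<And>i. i \<in> T \<Longrightarrow> cob l m B (theta i) = \<phi> (theta i)"
      by blast
    define \<psi> where "\<psi> = (\<lambda>F. \<phi> F - cob l m B F)"
    have \<psi>: "\<psi> \<in> cocyc l m" "\<psi> 1 = 0" "\<And>j. j \<in> T \<Longrightarrow> \<psi> (theta j) = 0"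
      using assms B by (auto simp: \<psi>_def intro: cocyc_diff cob_cocyc)
    define q where "q = \<psi> (theta i)"
    have q: "q \<in> dops"
      unfolding q_def using cocycD(1)[OF \<psi>(1)] by simp
    have Dq: "Dx * q = q * Dx"
      using cocyc_bracket_one[OF \<psi>(1) homog_one_theta _ \<psi>(2), of i] cocyc_zero[OF \<psi>(1)]
      by (simp add: q_def)
    have Qq: "Q j * Par * q * Par = q * Q j" if "j \<in> insert i T" for j
    proof (cases "j = i")
      case True
      \<comment> \<open>The bracket of theta_i with itself is 1/2, where the cocycle vanishes, and
        the two equal halves of the cocycle identity must then vanish too.\<close>
      have "- (Q i * (Par * (q * Par)) - q * Q i) = 0"
        using cocyc_bracket_theta[OF \<psi>(1) homog_one_theta, of i i] cocycD(3)[OF \<psi>(1), of 1 "1/2"] \<psi>(2)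
        by (simp add: bracket_table(2) Lie_theta q_def mult.assoc algebra_simps flip: scaleR_add_left)
      then show ?thesis
        by (simp add: True mult.assoc)
    next
      case False
      then show ?thesis
        using that cocyc_bracket_theta[OF \<psi>(1) homog_one_theta, of i j] cocyc_zero[OF \<psi>(1)] \<psi>(3)[of j]
        by (simp add: bracket_table(2) q_def)
    qed
    \<comment> \<open>Multiplication by theta_i is a contracting homotopy, because
      \<open>Q j * Mul (theta i) + Mul (theta i) * Q j\<close> is 1 for j = i and 0 otherwise. The 2
      compensates for the field of theta_i being half of \<open>Q i\<close>; the conjugation by
      \<open>Par\<close> supplies the sign.\<close>
    define C where "C = - 2 *\<^sub>R (Mul (theta i) * Par * q * Par)"
    have C: "C \<in> dops"
      unfolding C_def by (intro dops_scaleR dops_mult dops_Mul1 dops_Par q)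
    have "cob l m C 1 = 0"
    proof -
      have "Dx * (Mul (theta i) * Par * q * Par) = Mul (theta i) * Par * q * Par * Dx"
        by (metis (no_types, lifting) Dx_theta Dq Par_Dx mult.assoc)
      then show ?thesis
        by (simp add: cob_homog[OF homog_gens(1)] Lie_one C_def)
    qed
    moreover have "cob l m C (theta j) = (if j = i then q else 0)" if "j \<in> insert i T" for j
    proof -
      have "Par * C * Par = 2 *\<^sub>R (Mul (theta i) * q)"
        by (simp add: C_def mult.assoc Par_theta_left)
      moreover have "C * Q j = 2 *\<^sub>R (- (Mul (theta i) * (Q j * q)))"
      proof -
        have "Par * q * Par * Q j = - (Par * (q * Q j) * Par)"
          by (simp add: mult.assoc Par_Q)
        also have "\<dots> = Q j * q"
          unfolding Qq[OF that, symmetric] by (simp add: mult.assoc Par_Q_left)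
        finally show ?thesis
          by (simp add: C_def mult.assoc)
      qed
      moreover have "Q j * Mul (theta i) = (if j = i then 1 else 0) - Mul (theta i) * Q j"
        using theta_theta[of j i]
        by (simp add: Q_def distrib_left distrib_right Dth_theta mult.assoc Dx_theta)
          (simp flip: mult.assoc)
      then have "Q j * (Mul (theta i) * q) = (if j = i then q else 0) - Mul (theta i) * (Q j * q)"
        by (simp add: left_diff_distrib flip: mult.assoc)
      ultimately show ?thesis
        by (simp add: cob_homog[OF homog_one_theta] Lie_theta)
    qed
    ultimately have "cob l m (B + C) 1 = 0" "\<forall>j\<in>insert i T. cob l m (B + C) (theta j) = \<phi> (theta j)"
      using B \<open>i \<notin> T\<close> by (auto simp: cob_linear q_def \<psi>_def)
    then show ?case
      using B(1) C by blast
  qed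
  from this[of UNIV] show ?thesis
    using that by blast
qed

definition ncocyc :: "real \<Rightarrow> real \<Rightarrow> ('n::{finite,linorder} sfun \<Rightarrow> 'n lop) set" where
  "ncocyc l m = {\<phi> \<in> cocyc l m. \<phi> 1 = 0 \<and> (\<forall>i. \<phi> (theta i) = 0)}"

lemma ncocycD:
  assumes "\<phi> \<in> ncocyc l m"
  shows "\<phi> \<in> cocyc l m" "\<phi> 1 = 0" "\<phi> (theta i) = 0"
  using assms by (auto simp: ncocyc_def)

text \<open>On these arguments the coboundary is, up to factors and parity, the supercommutator with
  \<open>Dx\<close> and \<open>Q i\<close>. Hence coboundaries of invariant operators can be
  subtracted without losing the normalisation.\<close>

lemma cob_invar:
  assumes "B \<in> invar"
  shows "cob l m B 1 = 0" "cob l m B (theta i) = 0"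
proof -
  have "Q i * Par * B = B * Q i * Par"
    using assms by (simp add: invar_def mult.assoc)
  then have "Q i * Par * B * Par = B * Q i"
    by (simp add: mult.assoc)
  then show "cob l m B (theta i) = 0"
    by (simp add: cob_homog[OF homog_one_theta] Lie_theta mult.assoc)
  show "cob l m B 1 = 0"
    using assms by (simp add: cob_homog[OF homog_gens(1)] Lie_one invar_def)
qed

lemma ncocyc_diff: "\<phi> \<in> ncocyc l m \<Longrightarrow> \<psi> \<in> ncocyc l m \<Longrightarrow> (\<lambda>F. \<phi> F - \<psi> F) \<in> ncocyc l m"
  by (auto simp: ncocyc_def intro: cocyc_diff)

lemma ncocyc_scaleR: "\<phi> \<in> ncocyc l m \<Longrightarrow> (\<lambda>F. c *\<^sub>R \<phi> F) \<in> ncocyc l m"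
  by (auto simp: ncocyc_def intro: cocyc_scaleR)

lemma cob_ncocyc: "B \<in> dops \<Longrightarrow> B \<in> invar \<Longrightarrow> cob l m B \<in> ncocyc l m"
  by (simp add: ncocyc_def cob_cocyc cob_invar)

text \<open>The eigenvalue of the Euler field on the form dual to x^j theta_I: the target weight m
  minus the weight l + j + |I|/2 of the monomial.\<close>

definition wt :: "real \<Rightarrow> real \<Rightarrow> nat \<Rightarrow> 'n set \<Rightarrow> real" where
  "wt l m j I = m - l - real j - real (card I) / 2"

lemma ev_cob:
  "ev (ap (cob l m B xcoord) (smon j I)) = wt l m j I * ev (ap B (smon j I))"
  "ev (ap (cob l m B (theta a * theta b)) G) = - ev (ap B (ap (Lie l (theta a * theta b)) G))"
  "ev (ap (cob l m B (xcoord * theta i)) G) = - ev (ap B (ap (Lie l (xcoord * theta i)) G))"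
  by (simp_all add: cob_homog[OF homog_gens(2)] cob_homog[OF homog_gens(4)] cob_homog[OF homog_gens(6)]
      Lie_xcoord_smon wt_def algebra_simps)

text \<open>Evaluating at the origin turns a normalised cocycle into a cocycle of the stabiliser of the
  origin with values in linear forms on polynomials (Shapiro's lemma).\<close>

lemma ncocyc_eqs:
  assumes "\<phi> \<in> ncocyc l m"
  shows "wt l m j I * ev (ap (\<phi> (theta a * theta b)) (smon j I)) +
      ev (ap (\<phi> xcoord) (ap (Lie l (theta a * theta b)) (smon j I))) = 0"
    and "(wt l m j I - 1/2) * ev (ap (\<phi> (xcoord * theta i)) (smon j I)) +
      ev (ap (\<phi> xcoord) (ap (Lie l (xcoord * theta i)) (smon j I))) = 0"
    and "ev (ap (\<phi> (contact_bracket (theta a * theta b) (xcoord * theta i))) G) =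
      ev (ap (\<phi> (theta a * theta b)) (ap (Lie l (xcoord * theta i)) G))
      - ev (ap (\<phi> (xcoord * theta i)) (ap (Lie l (theta a * theta b)) G))"
    and "ev (ap (\<phi> (contact_bracket (theta a * theta b) (theta c * theta d))) G) =
      ev (ap (\<phi> (theta a * theta b)) (ap (Lie l (theta c * theta d)) G))
      - ev (ap (\<phi> (theta c * theta d)) (ap (Lie l (theta a * theta b)) G))"
    and "ev (ap (\<phi> (xcoord * xcoord)) G) =
      4 * ev (ap (\<phi> (xcoord * theta i)) (ap (Lie l (xcoord * theta i)) G))"
proof -
  note \<phi> = ncocycD(1)[OF assms]
  show "wt l m j I * ev (ap (\<phi> (theta a * theta b)) (smon j I)) +
      ev (ap (\<phi> xcoord) (ap (Lie l (theta a * theta b)) (smon j I))) = 0"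
    using arg_cong[OF cocycD(4)[OF \<phi> homog_gens(2,4), of a b], of "\<lambda>A. ev (ap A (smon j I))"]
    by (simp add: bracket_table(7) cob1_def wt_def Lie_xcoord_smon cocyc_zero[OF \<phi>] algebra_simps)
  \<comment> \<open>The 1/2 is the degree of x theta_i, from {x, x theta_i} = (1/2) x
    theta_i.\<close>
  show "(wt l m j I - 1/2) * ev (ap (\<phi> (xcoord * theta i)) (smon j I)) +
      ev (ap (\<phi> xcoord) (ap (Lie l (xcoord * theta i)) (smon j I))) = 0"
    using arg_cong[OF cocycD(4)[OF \<phi> homog_gens(2,6), of i], of "\<lambda>A. ev (ap A (smon j I))"]
    by (simp add: bracket_table(8) cob1_def wt_def Lie_xcoord_smon cocycD(3)[OF \<phi>] algebra_simps)
  show "ev (ap (\<phi> (contact_bracket (theta a * theta b) (xcoord * theta i))) G) =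
      ev (ap (\<phi> (theta a * theta b)) (ap (Lie l (xcoord * theta i)) G))
      - ev (ap (\<phi> (xcoord * theta i)) (ap (Lie l (theta a * theta b)) G))"
    using cocycD(4)[OF \<phi> homog_gens(4,6), of a b i] by (simp add: cob1_def)
  show "ev (ap (\<phi> (contact_bracket (theta a * theta b) (theta c * theta d))) G) =
      ev (ap (\<phi> (theta a * theta b)) (ap (Lie l (theta c * theta d)) G))
      - ev (ap (\<phi> (theta c * theta d)) (ap (Lie l (theta a * theta b)) G))"
    using cocycD(4)[OF \<phi> homog_gens(4,4), of a b c d] by (simp add: cob1_def)
  \<comment> \<open>One factor 2 comes from {x theta_i, x theta_i} = x^2/2, the other from the two
    equal terms for an odd argument paired with itself.\<close>
  show "ev (ap (\<phi> (xcoord * xcoord)) G) =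
      4 * ev (ap (\<phi> (xcoord * theta i)) (ap (Lie l (xcoord * theta i)) G))"
    using arg_cong[OF cocycD(4)[OF \<phi> homog_gens(6,6), of i i], of "\<lambda>A. ev (ap A G)"]
    by (simp add: bracket_table(9) cob1_def cocycD(3)[OF \<phi>])
qed

text \<open>Bootstrapping along the grading: brackets with 1 and theta_i lower the degree, so each
  value is invariant once the lower ones vanish, and an invariant operator is zero when its form
  is.\<close>

lemma ncocyc_zeroI:
  assumes ncocyc: "\<phi> \<in> ncocyc l m"
    and x: "\<And>j I. ev (ap (\<phi> xcoord) (smon j I)) = 0"
    and M: "\<And>a b j I. ev (ap (\<phi> (theta a * theta b)) (smon j I)) = 0"
    and S: "\<And>i j I. ev (ap (\<phi> (xcoord * theta i)) (smon j I)) = 0"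
    and F: "F \<in> osp_fun"
  shows "\<phi> F = 0"
proof -
  note \<phi> = ncocycD[OF ncocyc]
  note lin = cocyc_zero[OF \<phi>(1)] cocycD(2,3)[OF \<phi>(1)] cocyc_minus[OF \<phi>(1)] cocyc_diff_right[OF \<phi>(1)]
  have zero: "\<phi> v = 0" if "homog r v" "v \<in> osp_fun" "\<phi> (dx v) = 0"
    "\<And>i. \<phi> (contact_bracket (theta i) v) = 0" "\<And>j I. ev (ap (\<phi> v) (smon j I)) = 0" for r v
    by (rule invar_zeroI[OF cocycD(1)[OF \<phi>(1) that(2)] cocyc_invar[OF \<phi>(1) that(1,2) \<phi>(2,3) that(3,4)] that(5)])
  have x0: "\<phi> xcoord = 0"
    by (rule zero[OF homog_gens(2)]) (simp_all add: \<phi> x bracket_table lin)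
  have M0: "\<phi> (theta a * theta b) = 0" for a b
    by (rule zero[OF homog_gens(4)]) (simp_all add: \<phi> M bracket_table lin dx_mult)
  have S0: "\<phi> (xcoord * theta i) = 0" for i
    by (rule zero[OF homog_gens(6)]) (simp_all add: \<phi> S bracket_table lin dx_mult x0 M0)
  \<comment> \<open>The form on x^2 is expressed by the one on x theta_i for any single index;
    \<open>undefined\<close> serves as that index.\<close>
  have xx0: "\<phi> (xcoord * xcoord) = 0"
    by (rule zero[OF homog_gens(3)])
      (simp_all add: \<phi> bracket_table lin dx_mult x0 S0 ncocyc_eqs(5)[OF ncocyc, where i = undefined])
  show ?thesis
    using F by (induction rule: osp_fun_induct) (simp_all add: \<phi> x0 M0 S0 xx0 lin)
qed

lemma dops_finite_order:
  assumes "B \<in> dops"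
  obtains N where "\<And>p J. p \<ge> N \<Longrightarrow> ev (ap B (smon p J)) = 0"
proof -
  obtain N a where B: "B = (\<Sum>j<N. \<Sum>I\<in>UNIV. Mul (a j I) * Dx ^ j * oprod Dth I)"
    using assms unfolding dops_def by blast
  have "ev (ap (Dx ^ j) (ap (oprod Dth I) (smon p J))) = 0" if "j < N" "p \<ge> N" for j p and I J :: "'a set"
    by (rule oprod_Dth_smon[of I p J]) (use that in \<open>auto simp: funpow_dx_smon ev_def coef_smon\<close>)
  then show ?thesis
    by (intro that[of N]) (auto simp: B ev_mult intro!: sum.neutral)
qed

text \<open>The coboundary multiplies the form of B by \<open>wt\<close>, so off weight zero the
  form on the Euler field can be divided by \<open>wt\<close>.\<close>

lemma kill_weights:
  assumes "\<phi> \<in> ncocyc l m"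
  obtains B where "B \<in> dops" "B \<in> invar"
    "\<And>j I. wt l m j I \<noteq> 0 \<Longrightarrow> ev (ap (\<phi> xcoord - cob l m B xcoord) (smon j I)) = 0"
proof -
  obtain N where N: "\<And>p J. p \<ge> N \<Longrightarrow> ev (ap (\<phi> xcoord) (smon p J)) = 0"
    using dops_finite_order cocycD(1)[OF ncocycD(1)[OF assms]] osp_fun_mem(3) by metis
  \<comment> \<open>At weight zero the quotient is 0 by convention, and finite order is inherited
    from \<phi>.\<close>
  obtain B where B: "B \<in> dops" "B \<in> invar"
    "\<And>p J. ev (ap B (smon p J)) = ev (ap (\<phi> xcoord) (smon p J)) / wt l m p J"
    by (rule invar_realize[of N "\<lambda>p J. ev (ap (\<phi> xcoord) (smon p J)) / wt l m p J"]) (auto simp: N)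
  then show ?thesis
    using that by (simp add: ev_cob)
qed

section \<open>The Casimir operator of so(n)\<close>

lemma Lie_minus: "Lie l (- F) = - Lie l F" and Lie_diff: "Lie l (F - G) = Lie l F - Lie l G"
  using Lie_linear(2)[of l "-1" F] Lie_linear(2)[of l "-1" G] Lie_linear(1)[of l F "- G"] by simp_all

lemma Lie_swap: "Lie l (theta b * theta a) = - Lie l (theta a * theta b)"
  by (metis Lie_linear(2) scaleR_minus1_left theta_commute)

text \<open>If I contains exactly one of a and b, two exchanges restore I with a sign, and each
  contributes a factor 1/2.\<close>

lemma Lie_theta_theta_twice:
  "ap (Lie l (theta a * theta b)) (ap (Lie l (theta a * theta b)) (smon j I)) =
    (if a \<in> I \<longleftrightarrow> b \<in> I then 0 else - (1/4)) *\<^sub>R smon j I"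
proof -
  have *: "ap (Lie l (theta a * theta b)) (ap (Lie l (theta a * theta b)) (smon j I)) = - (1/4) *\<^sub>R smon j I"
    if "b \<in> I" "a \<notin> I" for a b
  proof -
    define J where "J = I - {b}"
    have J: "a \<notin> J" "b \<notin> J" "a \<noteq> b" "I = insert b J"
      using that by (auto simp: J_def)
    then have J': "insert a J - {a} = J" "insert b J - {b} = J"
      by auto
    have "ap (Lie l (theta a * theta b)) (smon j (insert a J)) = - ap (Lie l (theta b * theta a)) (smon j (insert a J))"
      by (simp add: Lie_swap[of l b a])
    also have "\<dots> = - (isgn a J * isgn b J / 2) *\<^sub>R smon j (insert b J)"
      using Lie_theta_theta_smon[of a "insert a J" b l j] J by (simp add: J')
    finally show ?thesis
      using Lie_theta_theta_smon[of b "insert b J" a l j] J by (simp add: J' mult.assoc)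
  qed
  show ?thesis
  proof (cases "a \<in> I \<longleftrightarrow> b \<in> I")
    case True
    then have "ap (Lie l (theta a * theta b)) (smon j I) = 0"
      by (cases "a = b") (auto simp: ap_Lie_theta_theta dtheta_smon theta_smon Lie_linear)
    with True show ?thesis by simp
  next
    case False
    then show ?thesis
      using *[of b a] *[of a b] by (auto simp: Lie_swap[of l b a])
  qed
qed

text \<open>There are 2 |I| (n - |I|) ordered pairs with exactly one index in I, each contributing
  -1/4. The eigenvalue vanishes only for I empty or full.\<close>

lemma casimir_smon:
  "(\<Sum>a\<in>UNIV. \<Sum>b\<in>UNIV. ap (Lie l (theta a * theta b)) (ap (Lie l (theta a * theta b)) (smon j I))) =
    - (real (card I) * (real CARD('n) - real (card I)) / 2) *\<^sub>R smon j (I :: 'n::{finite,linorder} set)"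
proof -
  define ind :: "'n \<Rightarrow> real" where "ind = (\<lambda>a. if a \<in> I then 1 else 0)"
  have ind: "(\<Sum>a\<in>UNIV. ind a) = real (card I)"
    by (simp add: ind_def sum.If_cases)
  have "(\<Sum>a\<in>UNIV. \<Sum>b\<in>UNIV. ap (Lie l (theta a * theta b)) (ap (Lie l (theta a * theta b)) (smon j I))) =
      (\<Sum>a\<in>UNIV. \<Sum>b\<in>UNIV. (- (1/4) * (ind a * (1 - ind b) + ind b * (1 - ind a))) *\<^sub>R smon j I)"
    by (intro sum.cong refl) (auto simp: Lie_theta_theta_twice ind_def)
  also have "\<dots> = (- (1/4) * (\<Sum>a\<in>UNIV. \<Sum>b\<in>UNIV. ind a * (1 - ind b) + ind b * (1 - ind a))) *\<^sub>R smon j I"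
    by (simp only: scaleR_sum_left sum_distrib_left)
  also have "(\<Sum>a\<in>UNIV. \<Sum>b\<in>UNIV. ind a * (1 - ind b) + ind b * (1 - ind a)) =
      2 * (real (card I) * (real CARD('n) - real (card I)))"
    by (simp add: sum.distrib sum_subtractf ind right_diff_distrib flip: sum_distrib_left sum_distrib_right)
  finally show ?thesis
    by simp
qed

text \<open>The argument of Whitehead's lemma: the contraction of \<beta> with the rotations is a
  primitive of \<beta> composed with the Casimir operator. Commuting M_ab past M_cd produces bracket
  terms, whose sum vanishes by invariance of the Casimir tensor.\<close>

lemma casimir_homotopy:
  assumes \<phi>: "\<phi> \<in> ncocyc l m"
  defines "\<beta> \<equiv> \<lambda>a b G. ev (ap (\<phi> (theta a * theta b)) G)"
    and "M \<equiv> \<lambda>a b. ap (Lie l (theta a * theta b))"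
  shows "(\<Sum>a\<in>UNIV. \<Sum>b\<in>UNIV. \<beta> a b (M a b (M c d G))) =
    \<beta> c d (\<Sum>a\<in>UNIV. \<Sum>b\<in>UNIV. M a b (M a b G))"
proof -
  note \<phi>' = ncocycD(1)[OF \<phi>]
  note lin = cocyc_zero[OF \<phi>'] cocycD(2,3)[OF \<phi>'] cocyc_minus[OF \<phi>'] cocyc_diff_right[OF \<phi>']
  have swap: "\<beta> b a G = - \<beta> a b G" "M b a G = - M a b G" for a b G
  proof -
    have "\<phi> (theta b * theta a) = - \<phi> (theta a * theta b)"
      using cocyc_minus[OF \<phi>', of "theta a * theta b"] by (simp add: theta_commute[of b a])
    then show "\<beta> b a G = - \<beta> a b G" "M b a G = - M a b G"
      by (simp_all add: \<beta>_def M_def Lie_swap[of l b a])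
  qed
  define f where "f = (\<lambda>a b c d. \<beta> a b (M c d G))"
  have f_swap: "f b a c d = - f a b c d" "f a b d c = - f a b c d" for a b c d
    by (simp_all add: f_def swap(1)[of b a] swap(2)[of d c]) (simp add: \<beta>_def)
  have A: "M a b (M c d G) = M c d (M a b G) - ap (Lie l (contact_bracket (theta c * theta d) (theta a * theta b))) G" for a b
    using Lie_contact_bracket[OF homog_gens(4,4), of l c d a b] by (simp add: M_def)
  have B: "\<beta> c d (M a b (M a b G)) =
      ev (ap (\<phi> (contact_bracket (theta c * theta d) (theta a * theta b))) (M a b G)) + \<beta> a b (M c d (M a b G))" for a b
    using ncocyc_eqs(4)[OF \<phi>, of c d a b "M a b G"] by (simp add: \<beta>_def M_def)
  have C: "\<beta> a b (ap (Lie l (contact_bracket (theta c * theta d) (theta a * theta b))) G) =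
      - (1/2) * ((if c = a then f a b d b else 0) - (if c = b then f a b d a else 0)
        - (if d = a then f a b c b else 0) + (if d = b then f a b c a else 0))" for a b
    by (auto simp: bracket_table(11) Lie_linear f_def M_def \<beta>_def lin Lie_diff Lie_minus)
  have D: "ev (ap (\<phi> (contact_bracket (theta c * theta d) (theta a * theta b))) (M a b G)) =
      - (1/2) * ((if c = a then f d b a b else 0) - (if c = b then f d a a b else 0)
        - (if d = a then f c b a b else 0) + (if d = b then f c a a b else 0))" for a b
    by (auto simp: bracket_table(11) f_def M_def \<beta>_def lin)
  have sum1: "(\<Sum>a\<in>UNIV. \<Sum>b\<in>UNIV. (if e = a then g a b else 0)) = (\<Sum>b\<in>UNIV. g e b)"
    and sum2: "(\<Sum>a\<in>UNIV. \<Sum>b\<in>UNIV. (if e = b then g a b else 0)) = (\<Sum>a\<in>UNIV. g a e)"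
    for e :: 'a and g :: "'a \<Rightarrow> 'a \<Rightarrow> real"
    by (subst sum.swap) simp_all
  \<comment> \<open>Written out with the structure constants, the terms cancel in pairs because
    \<beta> and M are skew in their indices.\<close>
  have "(\<Sum>a\<in>UNIV. \<Sum>b\<in>UNIV. \<beta> a b (ap (Lie l (contact_bracket (theta c * theta d) (theta a * theta b))) G)
      + ev (ap (\<phi> (contact_bracket (theta c * theta d) (theta a * theta b))) (M a b G))) = 0"
  proof -
    have s: "f a c' d' a = - f c' a d' a" "f c' a a d' = - f c' a d' a" for a c' d'
      using f_swap(1)[of c' a d' a] f_swap(2)[of c' a d' a] by simp_all
    show ?thesis
      unfolding C D
      by (simp only: sum.distrib sum_subtractf sum1 sum2 s sum_negf flip: sum_distrib_left) (simp add: field_simps)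
  qed
  then have "(\<Sum>a\<in>UNIV. \<Sum>b\<in>UNIV. \<beta> a b (M a b (M c d G))) = (\<Sum>a\<in>UNIV. \<Sum>b\<in>UNIV. \<beta> c d (M a b (M a b G)))"
    unfolding A B by (simp add: sum.distrib \<beta>_def sum_subtractf algebra_simps)
  then show ?thesis
    by (simp add: \<beta>_def ap_sum_right)
qed

text \<open>Division by the Casimir eigenvalue gives a primitive away from the empty and the full
  product. It lives in weight zero, so its coboundary has zero form on the Euler field and the
  earlier reduction survives.\<close>

lemma kill_so:
  assumes \<phi>: "\<phi> \<in> ncocyc l (m :: real)" and n: "CARD('n::{finite,linorder}) \<ge> 3"
    and x: "\<And>j (I :: 'n set). wt l m j I \<noteq> 0 \<Longrightarrow> ev (ap (\<phi> xcoord) (smon j I)) = 0"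
  obtains B where "B \<in> dops" "B \<in> invar" "\<And>j I. ev (ap (cob l m B xcoord) (smon j I)) = 0"
    "\<And>a b j I. ev (ap (\<phi> (theta a * theta b) - cob l m B (theta a * theta b)) (smon j (I :: 'n set))) = 0"
proof -
  have M: "ev (ap (\<phi> (theta a * theta b)) (smon j I)) = 0" if "wt l m j I \<noteq> 0" for a b j I
  proof -
    obtain c J where "ap (Lie l (theta a * theta b)) (smon j I) = c *\<^sub>R smon j J" "card J = card I"
      using Lie_theta_theta_smon_cases[of l a b j I] by metis
    then show ?thesis
      using ncocyc_eqs(1)[OF \<phi>, of j I a b] x[of j J] that by (simp add: wt_def)
  qed
  define K where "K = (\<lambda>G. \<Sum>a\<in>UNIV. \<Sum>b\<in>UNIV. ev (ap (\<phi> (theta a * theta b)) (ap (Lie l (theta a * theta b)) G)))"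
  have K_linear: "K (c *\<^sub>R G) = c * K G" for c G
    by (simp add: K_def sum_distrib_left)
  have K: "K (smon j I) = 0" if "wt l m j I \<noteq> 0" for j I
  proof -
    have "ev (ap (\<phi> (theta a * theta b)) (ap (Lie l (theta a * theta b)) (smon j I))) = 0" for a b
    proof -
      obtain c J where "ap (Lie l (theta a * theta b)) (smon j I) = c *\<^sub>R smon j J" "card J = card I"
        using Lie_theta_theta_smon_cases[of l a b j I] by metis
      then show ?thesis
        using M[of j J a b] that by (simp add: wt_def)
    qed
    then show ?thesis by (simp add: K_def)
  qed
  define \<gamma> :: "'n set \<Rightarrow> real" where "\<gamma> = (\<lambda>I. real (card I) * (real CARD('n) - real (card I)) / 2)"
  \<comment> \<open>For I empty or full the divisor is zero and the value is 0 by
    convention.\<close>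
  define b where "b = (\<lambda>j I. K (smon j I) / \<gamma> I)"
  obtain N :: nat where N: "real N > m - l"
    using reals_Archimedean2 by blast
  then have "b j I = 0" if "j \<ge> N" for j I
  proof -
    have "wt l m j I < 0"
      using that N by (simp add: wt_def field_simps)
    then show ?thesis
      using K[of j I] by (simp add: b_def)
  qed
  then obtain B where B: "B \<in> dops" "B \<in> invar" "\<And>p J. ev (ap B (smon p J)) = b p J"
    using invar_realize[of N b] by metis
  have 1: "ev (ap (cob l m B xcoord) (smon j I)) = 0" for j I
    using K[of j I] by (cases "wt l m j I = 0") (simp_all add: ev_cob B(3) b_def)
  have 2: "ev (ap (\<phi> (theta c * theta d)) (smon j I)) = ev (ap (cob l m B (theta c * theta d)) (smon j I))"
    for c d j I
  proof (cases "I = {} \<or> I = UNIV")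
    case True
    then have M0: "ap (Lie l (theta a * theta b)) (smon j I) = 0" for a b
      by (cases "a = b") (auto simp: ap_Lie_theta_theta dtheta_smon theta_smon Lie_linear)
    \<comment> \<open>The third index: {theta_c theta_e, theta_e theta_d} is (1/2) theta_c theta_d,
      and as both rotations annihilate the monomial the cocycle identity makes the form
      zero.\<close>
    obtain e where e: "e \<noteq> c" "e \<noteq> d"
    proof -
      have "card {c, d} < CARD('n)"
        using n by (simp add: card_insert_if)
      then have "{c, d} \<noteq> UNIV"
        by auto
      then show ?thesis
        using that by blast
    qed
    have "ev (ap (\<phi> (theta c * theta d)) (smon j I)) = 0"
    proof (cases "c = d")
      case True
      then show ?thesis
        using cocyc_zero[OF ncocycD(1)[OF \<phi>]] by simp
    next
      case False
      have "contact_bracket (theta c * theta e) (theta e * theta d) = (1/2) *\<^sub>R (theta c * theta d)"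
        using e False by (simp add: bracket_table(11))
      then show ?thesis
        using ncocyc_eqs(4)[OF \<phi>, of c e e d "smon j I"] cocycD(3)[OF ncocycD(1)[OF \<phi>]]
        by (simp add: M0)
    qed
    then show ?thesis
      by (simp add: ev_cob M0)
  next
    case False
    then have "card I \<noteq> 0" "card I < CARD('n)"
      by (simp, intro psubset_card_mono, auto)
    then have \<gamma>: "\<gamma> I \<noteq> 0"
      by (simp add: \<gamma>_def)
    obtain c' J where J: "ap (Lie l (theta c * theta d)) (smon j I) = c' *\<^sub>R smon j J" "card J = card I"
      using Lie_theta_theta_smon_cases[of l c d j I] by metis
    have "K (ap (Lie l (theta c * theta d)) (smon j I)) = - \<gamma> I * ev (ap (\<phi> (theta c * theta d)) (smon j I))"
      using casimir_homotopy[OF \<phi>, of c d "smon j I"] by (simp add: K_def casimir_smon \<gamma>_def)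
    then show ?thesis
      using \<gamma> J by (simp add: ev_cob B(3) b_def K_linear \<gamma>_def field_simps)
  qed
  show ?thesis
    by (rule that[OF B(1,2)]) (simp_all add: 1 2)
qed

section \<open>The invariant operator and its two cocycles\<close>

definition Aop :: "nat \<Rightarrow> 'n::{finite,linorder} lop" where
  "Aop k = oprod Eta UNIV * Dx ^ (k - 1)"

lemma A_op_ap: "A_op k = ap (Aop k)"
proof -
  have "ap (Eta i) = eta i" for i :: 'a
    by (rule ext) simp
  then show ?thesis
    by (rule_tac ext) (simp add: A_op_def Aop_def ap_oprod ap_power ap_Dx)
qed

lemma Aop_dops [simp]: "Aop k \<in> dops" and Aop_invar [simp]: "Aop k \<in> invar"
  unfolding Aop_def by (auto intro!: dops_mult dops_oprod dops_power invar_mult invar_power)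

text \<open>The form of A_k is dual, up to a nonzero factor, to the top monomial x^(k-1)
  theta_1...theta_n.\<close>

lemma ev_Aop:
  obtains c :: real where "c \<noteq> 0"
    "\<And>p J. ev (ap (Aop k) (smon p (J :: 'n::{finite,linorder} set))) = (if p = k - 1 \<and> J = UNIV then c else 0)"
proof -
  obtain c where "c \<in> {1, -1}" "\<And>p (J :: 'n set). ev (ap (Aop k) (smon p J)) =
      (if p = k - 1 \<and> J = UNIV then c * fact (k - 1) else 0)"
    unfolding Aop_def using ev_oprod_Eta by metis
  then show ?thesis
    by (intro that[of "c * fact (k - 1)"]) auto
qed

section \<open>Derivatives of the coboundary with respect to the two weights\<close>

definition res1 :: "'n::{finite,linorder} lop \<Rightarrow> 'n sfun \<Rightarrow> 'n lop" where
  "res1 B F = - (B * Mul (dx F))"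

definition res2 :: "'n::{finite,linorder} lop \<Rightarrow> 'n sfun \<Rightarrow> 'n lop" where
  "res2 B F = Mul (dx (hpart 0 F)) * B + Mul (dx (hpart 1 F)) * (Par * B * Par)"

lemma Lie_shift: "Lie (l + \<sigma>) F = Lie l F + \<sigma> *\<^sub>R Mul (dx F)"
  by (simp add: Lie_def algebra_simps)

text \<open>The action is affine in the weights, so the coboundary is affine too, with slopes
  \<open>res1\<close> and \<open>res2\<close>. This is the formula for \<delta>^{\<sigma>,\<tau>}
  once the constant term vanishes.\<close>

lemma cob_shift: "cob (l + \<sigma>) (m + \<tau>) B F = cob l m B F + \<sigma> *\<^sub>R res1 B F + \<tau> *\<^sub>R res2 B F"
  unfolding cob_def res1_def res2_def Lie_shift by (simp add: algebra_simps)

lemma res_linear: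
  "res1 B (F + G) = res1 B F + res1 B G" "res1 B (c *\<^sub>R F) = c *\<^sub>R res1 B F"
  "res2 B (F + G) = res2 B F + res2 B G" "res2 B (c *\<^sub>R F) = c *\<^sub>R res2 B F"
  by (simp_all add: res1_def res2_def Mul_simps algebra_simps)

lemma res_dops: "B \<in> dops \<Longrightarrow> res1 B F \<in> dops" "B \<in> dops \<Longrightarrow> res2 B F \<in> dops"
  unfolding res1_def res2_def by (intro dops_minus dops_add dops_mult; simp)+

lemma res2_homog: "homog q F \<Longrightarrow> res2 B F = Mul (dx F) * cj q B"
  using hpart_homog[of q F 0] hpart_homog[of q F 1] by (auto simp: res2_def homog_def Mul_simps)

lemma Delta_ap: "Delta1 (ap B) F = ap (res1 B F)" "Delta2 (ap B) F = ap (res2 B F)"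
  unfolding Delta1_def Delta2_def mult_op_ap op_part_ap ap_fun_simps res1_def res2_def
  by (simp_all add: ap_fun_simps ap_eq_iff algebra_simps) (simp flip: scaleR_add_left)

lemma homog_dx: "homog q F \<Longrightarrow> homog q (dx F)"
  by (auto simp: homog_def simp flip: dx_par)

lemma homog_commute:
  assumes "homog q u" "homog r v"
  shows "u * v = (-1) ^ (q * r) *\<^sub>R (v * u)"
  using super_commute[of u "(-1) ^ q" v "(-1) ^ r"] assms by (auto simp: homog_def)

lemma Mul_dx_commute:
  assumes "homog q u" "homog r v"
  shows "Mul (dx u) * (Mul (dx v) * C) = (-1) ^ (q * r) *\<^sub>R (Mul (dx v) * (Mul (dx u) * C))"
proof -
  have "Mul (dx u) * Mul (dx v) = (-1) ^ (q * r) *\<^sub>R (Mul (dx v) * Mul (dx u))"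
    unfolding Mul_simps(4,7)[symmetric] homog_commute[OF homog_dx[OF assms(1)] homog_dx[OF assms(2)]] ..
  then show ?thesis
    by (simp flip: mult.assoc)
qed

lemma Par_Mul_homog: "homog q u \<Longrightarrow> Par * (Mul u * C) = (-1) ^ q *\<^sub>R (Mul u * (Par * C))"
  by (simp add: Par_Mul homog_def Mul_simps flip: mult.assoc)

lemma cob1_cong: "\<phi> u = \<psi> u \<Longrightarrow> \<phi> v = \<psi> v \<Longrightarrow> cob1 l m \<phi> q r u v = cob1 l m \<psi> q r u v"
  by (simp add: cob1_def)

text \<open>Because \<open>cob l m B\<close> vanishes, \<open>res1 B\<close> agrees on osp(n|2) with
  the coboundary for the source weight l + 1 and is a cocycle there. As the dependence on l is
  affine, a unit shift does the work of a derivative.\<close>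

lemma res1_cocyc:
  assumes B: "B \<in> dops" and inv: "\<And>F. F \<in> osp_fun \<Longrightarrow> cob l m B F = 0"
  shows "res1 B \<in> cocyc l m"
proof -
  have "res1 B (contact_bracket u v) = cob1 l m (res1 B) q r u v"
    if u: "homog q u" "u \<in> osp_fun" and v: "homog r v" "v \<in> osp_fun" for q r u v
  proof -
    have shift: "res1 B F = cob (l + 1) m B F - cob l m B F" for F
      using cob_shift[of l 1 m 0 B F] by simp
    have "res1 B (contact_bracket u v) = cob1 (l + 1) m (cob (l + 1) m B) q r u v"
      using cob_contact_bracket[OF u(1) v(1), of l m B] cob_contact_bracket[OF u(1) v(1), of "l + 1" m B] inv u v
      by (simp add: shift cob1_def)
    also have "\<dots> = cob1 (l + 1) m (res1 B) q r u v"
      by (rule cob1_cong) (simp_all add: shift inv u v)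
    \<comment> \<open>Returning to weight l changes the identity by products of B with
      multiplications by \<open>dx u\<close> and \<open>dx v\<close>, which cancel as these
      supercommute.\<close>
    also have "\<dots> = cob1 l m (res1 B) q r u v"
    proof -
      have "Mul (dx v) * Mul (dx u) = (-1) ^ (q * r) *\<^sub>R (Mul (dx u) * Mul (dx v))"
        using Mul_dx_commute[OF v(1) u(1), of 1] by (simp add: mult.commute)
      then show ?thesis
        using u(1) v(1) unfolding cob1_def Lie_shift res1_def
        by (auto simp: homog_def algebra_simps)
    qed
    finally show ?thesis .
  qed
  then show ?thesis
    using B by (simp add: cocyc_def res_linear res_dops)
qed

text \<open>The target weight is shifted instead; the extra multiplications now stand on the left,
  and conjugation by \<open>Par\<close> supplies the signs for them to cancel.\<close>

lemma res2_cocyc: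
  assumes B: "B \<in> dops" and inv: "\<And>F. F \<in> osp_fun \<Longrightarrow> cob l m B F = 0"
  shows "res2 B \<in> cocyc l m"
proof -
  have "res2 B (contact_bracket u v) = cob1 l m (res2 B) q r u v"
    if u: "homog q u" "u \<in> osp_fun" and v: "homog r v" "v \<in> osp_fun" for q r u v
  proof -
    have shift: "res2 B F = cob l (m + 1) B F - cob l m B F" for F
      using cob_shift[of l 0 m 1 B F] by simp
    have "res2 B (contact_bracket u v) = cob1 l (m + 1) (cob l (m + 1) B) q r u v"
      using cob_contact_bracket[OF u(1) v(1), of l m B] cob_contact_bracket[OF u(1) v(1), of l "m + 1" B] inv u v
      by (simp add: shift cob1_def)
    also have "\<dots> = cob1 l (m + 1) (res2 B) q r u v"
      by (rule cob1_cong) (simp_all add: shift inv u v)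
    also have "\<dots> = cob1 l m (res2 B) q r u v"
    proof -
      have "(-1) ^ (q * r) *\<^sub>R (Mul (dx u) * cj q (Mul (dx v) * cj r B)) - Mul (dx v) * cj r (Mul (dx u) * cj q B) = 0"
        using u(1) v(1) Mul_dx_commute[OF v(1) u(1)]
          Par_Mul_homog[OF homog_dx[OF u(1)]] Par_Mul_homog[OF homog_dx[OF v(1)]]
        by (auto simp: homog_def mult.assoc)
      then show ?thesis
        unfolding cob1_def Lie_shift res2_homog[OF u(1)] res2_homog[OF v(1)]
        by (simp add: algebra_simps)
    qed
    finally show ?thesis .
  qed
  then show ?thesis
    using B by (simp add: cocyc_def res_linear res_dops)
qed

lemma wt_resonant:
  assumes "k \<ge> 1"
  shows "wt (lambda_wt CARD('n) k) (mu_wt k) j (I :: 'n::finite set) =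
    real k - 1 + real CARD('n) / 2 - real j - real (card I) / 2"
  by (simp add: wt_def lambda_wt_def mu_wt_def field_simps)

text \<open>Rotations never reach the full product of the theta_a. The field of x theta_i could
  reach the top monomial only from x^(k-1) times the product without theta_i, where its coefficient
  vanishes by the choice of \<open>lambda_wt\<close>.\<close>

lemma ev_Aop_Lie:
  assumes "k \<ge> 1"
  shows "ev (ap (Aop k) (ap (Lie l (theta a * theta b)) (smon j I))) = 0"
    and "ev (ap (Aop k) (ap (Lie (lambda_wt CARD('n) k) (xcoord * theta i)) (smon j (I :: 'n::{finite,linorder} set)))) = 0"
proof -
  obtain c where c: "\<And>p (J :: 'n set). ev (ap (Aop k) (smon p J)) = (if p = k - 1 \<and> J = UNIV then c else 0)"
    using ev_Aop by metis
  obtain d and J :: "'n set" where "ap (Lie l (theta a * theta b)) (smon j I) = d *\<^sub>R smon j J" "d = 0 \<or> J \<noteq> {} \<and> J \<noteq> UNIV"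
    using Lie_theta_theta_smon_cases[of l a b j I] by metis
  then show "ev (ap (Aop k) (ap (Lie l (theta a * theta b)) (smon j I))) = 0"
    by (auto simp: c)
  show "ev (ap (Aop k) (ap (Lie (lambda_wt CARD('n) k) (xcoord * theta i)) (smon j I))) = 0"
  proof (cases "i \<in> I")
    case True
    then show ?thesis
      by (auto simp: Lie_xcoord_theta_smon c)
  next
    case False
    have "(real j + real (card I)) / 2 + lambda_wt CARD('n) k = 0" if "j = k - 1" "insert i I = UNIV"
    proof -
      have "Suc (card I) = CARD('n)"
        using False that(2) by (metis card_insert_disjoint finite)
      then show ?thesis
        using that(1) assms by (simp add: lambda_wt_def field_simps flip: of_nat_Suc)
    qed
    then show ?thesis
      using False by (simp add: Lie_xcoord_theta_smon c)
  qed
qed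

text \<open>Since A_k is built from invariant operators, its coboundary is a normalised cocycle and
  is tested by forms only. On the Euler field the top monomial has weight zero; on the other
  generators \<open>ev_Aop_Lie\<close> applies.\<close>

lemma cob_Aop:
  fixes F :: "'n::{finite,linorder} sfun"
  assumes k: "k \<ge> 1" and F: "F \<in> osp_fun"
  shows "cob (lambda_wt CARD('n) k) (mu_wt k) (Aop k) F = 0"
proof (rule ncocyc_zeroI[OF cob_ncocyc _ _ _ F])
  obtain c where c: "\<And>p (J :: 'n set). ev (ap (Aop k) (smon p J)) = (if p = k - 1 \<and> J = UNIV then c else 0)"
    using ev_Aop by metis
  fix j and I :: "'n set"
  show "ev (ap (cob (lambda_wt CARD('n) k) (mu_wt k) (Aop k) xcoord) (smon j I)) = 0"
    using k by (auto simp: ev_cob c wt_resonant)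
qed (simp_all add: ev_cob ev_Aop_Lie[OF k])

text \<open>After evaluation the two cocycles are opposite on the Euler field and vanish on
  rotations. Only x theta_i separates them: there \<open>res2\<close> has a factor theta_i on the
  left and dies at the origin.\<close>

lemma res_ev:
  "ev (ap (res1 B xcoord) G) = - ev (ap B G)" "ev (ap (res2 B xcoord) G) = ev (ap B G)"
  "res1 B (theta a * theta b) = 0" "res2 B (theta a * theta b) = 0"
  "ev (ap (res1 B (xcoord * theta i)) G) = - ev (ap B (theta i * G))"
  "ev (ap (res2 B (xcoord * theta i)) G) = 0"
  by (simp_all add: res1_def res2_homog[OF homog_gens(2)] res2_homog[OF homog_gens(4)]
      res2_homog[OF homog_gens(6)] dx_mult Mul_simps)

lemma res_ncocyc:
  fixes l m :: real
  assumes "k \<ge> 1"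
  defines "l \<equiv> lambda_wt CARD('n::{finite,linorder}) k" and "m \<equiv> mu_wt k"
  shows "res1 (Aop k :: 'n lop) \<in> ncocyc l m" "res2 (Aop k :: 'n lop) \<in> ncocyc l m"
  using res1_cocyc[of "Aop k :: 'n lop" l m] res2_cocyc[of "Aop k :: 'n lop" l m] cob_Aop[OF assms(1), where ?'n = 'n]
  by (auto simp: ncocyc_def l_def m_def res1_def res2_homog[OF homog_gens(1)]
      res2_homog[OF homog_gens(5)] Mul_simps)

section \<open>Every cocycle is a combination of the two cocycles up to a coboundary\<close>

context
  fixes k :: nat and l m :: real
  assumes n: "CARD('n::{finite,linorder}) \<ge> 3" and k: "k \<ge> 1"
    and l: "l = lambda_wt CARD('n) k" and m: "m = mu_wt k"
begin

lemma wt_eq: "wt l m j (I :: 'n set) = real k - 1 + real CARD('n) / 2 - real j - real (card I) / 2"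
  using wt_resonant[OF k] by (simp add: l m)

lemma res_ncocyc': "res1 (Aop k :: 'n lop) \<in> ncocyc l m" "res2 (Aop k :: 'n lop) \<in> ncocyc l m"
  using res_ncocyc[OF k, where ?'n = 'n] by (simp_all add: l m)

text \<open>In weight zero, a monomial neither empty nor full in the theta_a is the image of another
  under a rotation, and there the relation for rotations forces zero. For an empty one the relation
  for x theta_i does the same. A full one has j = k - 1.\<close>

lemma reduced_xcoord:
  assumes \<phi>: "\<phi> \<in> ncocyc l m"
    and x: "\<And>j (I :: 'n set). wt l m j I \<noteq> 0 \<Longrightarrow> ev (ap (\<phi> xcoord) (smon j I)) = 0"
    and M: "\<And>a b j (I :: 'n set). ev (ap (\<phi> (theta a * theta b)) (smon j I)) = 0"
    and jI: "\<not> (j = k - 1 \<and> I = UNIV)"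
  shows "ev (ap (\<phi> xcoord) (smon j I)) = 0"
proof (cases "wt l m j I = 0")
  case wt: True
  consider "I = {}" | "I = UNIV" | "I \<noteq> {}" "I \<noteq> UNIV"
    by blast
  then show ?thesis
  proof cases
    case 1
    \<comment> \<open>For I empty and j = 0 the weight would be k - 1 + n/2 > 0.\<close>
    have "j \<noteq> 0"
      using wt n k 1 by (auto simp: wt_eq)
    then obtain j' where j: "j = Suc j'"
      using not0_implies_Suc by blast
    \<comment> \<open>Passing from x^j to x^(j-1) theta_i raises \<open>wt\<close> from 0 to 1/2, so
      the unknown value on x theta_i drops out of the relation.\<close>
    have wt0: "wt l m j' {undefined :: 'n} - 1/2 = 0"
      using wt 1 j by (simp add: wt_eq field_simps)
    then show ?thesis
      using ncocyc_eqs(2)[OF \<phi>, of j' "{undefined}" undefined, unfolded wt0] 1 j by (simp add: Lie_xcoord_theta_smon)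
  next
    case 2
    then have "j = k - 1"
      using wt k by (simp add: wt_eq)
    with 2 jI show ?thesis by blast
  next
    case 3
    then obtain a b where ab: "a \<in> I" "b \<notin> I"
      by blast
    define J where "J = insert b (I - {a})"
    have J: "b \<in> J" "a \<notin> J" "insert a (J - {b}) = I"
      using ab by (auto simp: J_def)
    show ?thesis
      using ncocyc_eqs(1)[OF \<phi>, of j J a b] M Lie_theta_theta_smon[OF J(1,2), of l j]
      by (simp add: J(3))
  qed
qed (rule x)

text \<open>The Euler field forces weight 1/2. Rotations fixing i kill every set that splits the
  other indices; the empty and full sets are handled by a rotation moving i. The last relation
  transports the form from one index to another.\<close>

lemma reduced_xcoord_theta:
  assumes \<phi>: "\<phi> \<in> ncocyc l m"
    and x: "\<And>j (I :: 'n set). ev (ap (\<phi> xcoord) (smon j I)) = 0"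
    and M: "\<And>a b j (I :: 'n set). ev (ap (\<phi> (theta a * theta b)) (smon j I)) = 0"
  shows "wt l m j I \<noteq> 1/2 \<Longrightarrow> ev (ap (\<phi> (xcoord * theta i)) (smon j I)) = 0"
    and "I \<noteq> {i} \<Longrightarrow> I \<noteq> UNIV - {i} \<Longrightarrow> ev (ap (\<phi> (xcoord * theta i)) (smon j I)) = 0"
    and "i \<noteq> a \<Longrightarrow> ev (ap (\<phi> (xcoord * theta a)) G) =
      2 * ev (ap (\<phi> (xcoord * theta i)) (ap (Lie l (theta i * theta a)) G))
        - 2 * ev (ap (\<phi> (theta i * theta a)) (ap (Lie l (xcoord * theta i)) G))"
proof -
  note lin = cocyc_zero[OF ncocycD(1)[OF \<phi>]] cocycD(3)[OF ncocycD(1)[OF \<phi>]] cocyc_minus[OF ncocycD(1)[OF \<phi>]]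
  have xS: "ev (ap (\<phi> xcoord) (ap (Lie l (xcoord * theta i)) (smon j I))) = 0" for i j and I :: "'n set"
    by (simp add: Lie_xcoord_theta_smon x)
  have MS: "ev (ap (\<phi> (theta a * theta b)) (ap (Lie l (xcoord * theta i)) (smon j I))) = 0" for a b i j and I :: "'n set"
    by (simp add: Lie_xcoord_theta_smon M)
  show "wt l m j I \<noteq> 1/2 \<Longrightarrow> ev (ap (\<phi> (xcoord * theta i)) (smon j I)) = 0"
    using ncocyc_eqs(2)[OF \<phi>, of j I i] by (simp add: xS)
  show rel: "ev (ap (\<phi> (xcoord * theta a)) G) =
      2 * ev (ap (\<phi> (xcoord * theta i)) (ap (Lie l (theta i * theta a)) G))
        - 2 * ev (ap (\<phi> (theta i * theta a)) (ap (Lie l (xcoord * theta i)) G))" if "i \<noteq> a" for i a G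
    using ncocyc_eqs(3)[OF \<phi>, of i a i G] that by (simp add: bracket_table(10) lin)
  assume I: "I \<noteq> {i}" "I \<noteq> UNIV - {i}"
  show "ev (ap (\<phi> (xcoord * theta i)) (smon j I)) = 0"
  proof (cases "\<exists>a b. a \<noteq> i \<and> b \<noteq> i \<and> a \<in> I \<and> b \<notin> I")
    case True
    then obtain a b where ab: "a \<noteq> i" "b \<noteq> i" "a \<in> I" "b \<notin> I"
      by blast
    define J where "J = insert b (I - {a})"
    have J: "b \<in> J" "a \<notin> J" "insert a (J - {b}) = I"
      using ab by (auto simp: J_def)
    show ?thesis
      using ncocyc_eqs(3)[OF \<phi>, of a b i "smon j J"] Lie_theta_theta_smon[OF J(1,2), of l j] ab
      by (simp add: J(3) bracket_table(10) lin MS)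
  next
    case False
    then have "I = {} \<or> I = UNIV"
      using I by auto
    then have M0: "ap (Lie l (theta a * theta b)) (smon j I) = 0" for a b
      by (cases "a = b") (auto simp: ap_Lie_theta_theta dtheta_smon theta_smon Lie_linear)
    have "UNIV \<noteq> {i}"
    proof
      assume "UNIV = {i}"
      then have "CARD('n) = card {i}"
        by (rule arg_cong)
      with n show False
        by simp
    qed
    then obtain e where "e \<noteq> i"
      by blast
    then show ?thesis
      using rel[of e i "smon j I"] by (simp add: M0 MS)
  qed
qed

text \<open>After the reductions one number is left on the Euler field, and the form on x theta_i
  can live only on the complement of {i}, where it is a second parameter, or on {i}, where it is a
  coboundary.\<close>

lemma cocycle_decomposition:
  assumes \<phi>: "\<phi> \<in> cocyc l m"
  obtains a b and B :: "'n lop" where "B \<in> dops"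
    "\<And>F. F \<in> osp_fun \<Longrightarrow> \<phi> F = a *\<^sub>R res1 (Aop k) F + b *\<^sub>R res2 (Aop k) F + cob l m B F"
proof -
  obtain B1 where B1: "B1 \<in> dops" "cob l m B1 1 = \<phi> 1"
    using kill_one[OF \<phi>] by metis
  define \<phi>1 where "\<phi>1 = (\<lambda>F. \<phi> F - cob l m B1 F)"
  have \<phi>1: "\<phi>1 \<in> cocyc l m" "\<phi>1 1 = 0"
    unfolding \<phi>1_def using B1 by (auto intro: cocyc_diff \<phi> cob_cocyc)
  obtain B2 where B2: "B2 \<in> dops" "cob l m B2 1 = 0" "\<And>i. cob l m B2 (theta i) = \<phi>1 (theta i)"
    using kill_theta[OF \<phi>1] by metis
  define \<phi>2 where "\<phi>2 = (\<lambda>F. \<phi>1 F - cob l m B2 F)"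
  have \<phi>2: "\<phi>2 \<in> ncocyc l m"
    unfolding \<phi>2_def ncocyc_def using B2 \<phi>1 by (auto intro: cocyc_diff cob_cocyc)
  obtain B3 where B3: "B3 \<in> dops" "B3 \<in> invar"
    "\<And>j I. wt l m j I \<noteq> 0 \<Longrightarrow> ev (ap (\<phi>2 xcoord - cob l m B3 xcoord) (smon j I)) = 0"
    using kill_weights[OF \<phi>2] by metis
  define \<phi>3 where "\<phi>3 = (\<lambda>F. \<phi>2 F - cob l m B3 F)"
  have \<phi>3: "\<phi>3 \<in> ncocyc l m"
    unfolding \<phi>3_def using B3 by (intro ncocyc_diff \<phi>2 cob_ncocyc)
  have x3: "ev (ap (\<phi>3 xcoord) (smon j I)) = 0" if "wt l m j I \<noteq> 0" for j I
    using B3(3)[OF that] by (simp add: \<phi>3_def)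
  obtain B4 where B4: "B4 \<in> dops" "B4 \<in> invar" "\<And>j I. ev (ap (cob l m B4 xcoord) (smon j I)) = 0"
    "\<And>a b j I. ev (ap (\<phi>3 (theta a * theta b) - cob l m B4 (theta a * theta b)) (smon j (I :: 'n set))) = 0"
    using kill_so[OF \<phi>3 n x3] by metis
  define \<phi>4 where "\<phi>4 = (\<lambda>F. \<phi>3 F - cob l m B4 F)"
  have \<phi>4: "\<phi>4 \<in> ncocyc l m"
    unfolding \<phi>4_def using B4 by (intro ncocyc_diff \<phi>3 cob_ncocyc)
  have M4: "ev (ap (\<phi>4 (theta a * theta b)) (smon j I)) = 0" for a b j I
    using B4(4) by (simp add: \<phi>4_def)
  have x4: "ev (ap (\<phi>4 xcoord) (smon j I)) = 0" if "\<not> (j = k - 1 \<and> I = UNIV)" for j I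
    by (rule reduced_xcoord[OF \<phi>4 _ M4 that]) (simp add: \<phi>4_def x3 B4(3))
  obtain c where c: "c \<noteq> 0" "\<And>p (J :: 'n set). ev (ap (Aop k) (smon p J)) = (if p = k - 1 \<and> J = UNIV then c else 0)"
    using ev_Aop by metis
  \<comment> \<open>\<open>res2\<close> takes the value c on the Euler field at the top monomial,
    and zero on all other monomials.\<close>
  define \<alpha> where "\<alpha> = ev (ap (\<phi>4 xcoord) (smon (k - 1) UNIV)) / c"
  define \<phi>5 where "\<phi>5 = (\<lambda>F. \<phi>4 F - \<alpha> *\<^sub>R res2 (Aop k) F)"
  have \<phi>5: "\<phi>5 \<in> ncocyc l m"
    unfolding \<phi>5_def by (intro ncocyc_diff ncocyc_scaleR \<phi>4 res_ncocyc')
  have x5: "ev (ap (\<phi>5 xcoord) (smon j I)) = 0" for j I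
    using x4[of j I] c by (auto simp: \<phi>5_def \<alpha>_def res_ev)
  have M5: "ev (ap (\<phi>5 (theta a * theta b)) (smon j I)) = 0" for a b j I
    using M4 by (simp add: \<phi>5_def res_ev)
  define i :: 'n where "i = undefined"
  define I' where "I' = UNIV - {i}"
  have I': "i \<notin> I'" "insert i I' = UNIV"
    by (auto simp: I'_def)
  have "card I' \<ge> 2"
    using n by (simp add: I'_def card_Diff_singleton)
  then have "I' \<noteq> {i}"
    by auto
  have A_theta: "ev (ap (Aop k) (theta i * smon j I)) = (if j = k - 1 \<and> I = I' then isgn i I' * c else 0)" for j I
  proof -
    have "insert i I = UNIV \<longleftrightarrow> I = I'" if "i \<notin> I"
      using that by (auto simp: I'_def)
    then show ?thesis
      using I' by (auto simp: theta_smon c(2))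
  qed
  define \<beta> where "\<beta> = - ev (ap (\<phi>5 (xcoord * theta i)) (smon (k - 1) I')) / (isgn i I' * c)"
  \<comment> \<open>\<open>res1 + res2\<close> has zero form on the Euler field, so adding a
    multiple preserves what \<alpha> achieved. The double sign expresses the sum by differences,
    under which \<open>ncocyc\<close> is known to be closed.\<close>
  define \<phi>6 where "\<phi>6 = (\<lambda>F. \<phi>5 F - (\<beta> *\<^sub>R res1 (Aop k) F - (- \<beta>) *\<^sub>R res2 (Aop k) F))"
  have \<phi>6: "\<phi>6 \<in> ncocyc l m"
    unfolding \<phi>6_def by (intro ncocyc_diff ncocyc_scaleR \<phi>5 res_ncocyc')
  have x6: "ev (ap (\<phi>6 xcoord) (smon j I)) = 0" for j I
    using x5 by (simp add: \<phi>6_def res_ev)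
  have M6: "ev (ap (\<phi>6 (theta a * theta b)) (smon j I)) = 0" for a b j I
    using M5 by (simp add: \<phi>6_def res_ev)
  have S6': "ev (ap (\<phi>6 (xcoord * theta i)) (smon (k - 1) I')) = 0"
    using c(1) by (simp add: \<phi>6_def res_ev A_theta \<beta>_def)
  have S6: "ev (ap (\<phi>6 (xcoord * theta i)) (smon j I)) = 0" if "\<not> (I = {i} \<and> wt l m j I = 1/2)" for j I
  proof (cases "I = I' \<and> wt l m j I = 1/2")
    case True
    have "real (card I') = real CARD('n) - 1"
      using n by (simp add: I'_def card_Diff_singleton of_nat_diff)
    moreover have "I = I'" "real k - 1 + real CARD('n) / 2 - real j - real (card I) / 2 = 1/2"
      using True by (auto simp: wt_eq)
    ultimately have "real j = real k - 1"
      by (simp add: field_simps)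
    then have "j = k - 1"
      using k by linarith
    with S6' True show ?thesis by simp
  next
    case False
    then show ?thesis
      using that reduced_xcoord_theta(1,2)[OF \<phi>6 x6 M6, where i = i and j = j and I = I] unfolding I'_def by blast
  qed
  obtain N :: nat where N: "real N > m - l"
    using reals_Archimedean2 by blast
  \<comment> \<open>The field of x theta_i sends x^(p-1) theta_i to x^p/2 and the coboundary has a
    minus sign, whence the factor -2. Support in weight zero leaves the Euler field alone, and p
    \<ge> 1 makes p - 1 a true predecessor.\<close>
  define b where "b = (\<lambda>p (J :: 'n set). if J = {} \<and> p \<ge> 1 \<and> wt l m p J = 0
    then - 2 * ev (ap (\<phi>6 (xcoord * theta i)) (smon (p - 1) {i})) else 0)"
  have b_wt: "b p J = 0" if "wt l m p J \<noteq> 0" for p J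
    using that by (auto simp: b_def)
  have b_N: "b p J = 0" if "p \<ge> N" for p J
    using that N by (intro b_wt) (simp add: wt_def field_simps)
  obtain B5 where B5: "B5 \<in> dops" "B5 \<in> invar" "\<And>p J. ev (ap B5 (smon p J)) = b p J"
    using invar_realize[of N b] b_N by metis
  define \<phi>7 where "\<phi>7 = (\<lambda>F. \<phi>6 F - cob l m B5 F)"
  have \<phi>7: "\<phi>7 \<in> ncocyc l m"
    unfolding \<phi>7_def using B5 by (intro ncocyc_diff \<phi>6 cob_ncocyc)
  have x7: "ev (ap (\<phi>7 xcoord) (smon j I)) = 0" for j I
    using b_wt[of j I] by (auto simp: \<phi>7_def x6 ev_cob B5(3))
  have M7: "ev (ap (\<phi>7 (theta a * theta b)) (smon j I)) = 0" for a b j I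
  proof -
    obtain d J where "ap (Lie l (theta a * theta b)) (smon j I) = d *\<^sub>R smon j J" "d = 0 \<or> J \<noteq> {} \<and> J \<noteq> UNIV"
      using Lie_theta_theta_smon_cases[of l a b j I] by metis
    then show ?thesis
      by (auto simp: \<phi>7_def M6 ev_cob B5(3) b_def)
  qed
  have S7: "ev (ap (\<phi>7 (xcoord * theta i)) (smon j I)) = 0" for j I
  proof (cases "I = {i} \<and> wt l m j I = 1/2")
    case True
    then have "wt l m (Suc j) ({} :: 'n set) = 0"
      by (auto simp: wt_def)
    with True show ?thesis
      by (simp add: \<phi>7_def ev_cob Lie_xcoord_theta_smon B5(3) b_def)
  next
    case False
    have "ev (ap (cob l m B5 (xcoord * theta i)) (smon j I)) = 0"
    proof (cases "I = {i}")
      case True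
      with False have "wt l m (Suc j) ({} :: 'n set) \<noteq> 0"
        by (simp add: wt_def)
      with True show ?thesis
        by (simp add: ev_cob Lie_xcoord_theta_smon B5(3) b_wt)
    next
      case False
      then have "i \<in> I \<Longrightarrow> I - {i} \<noteq> {}"
        by blast
      then show ?thesis
        by (simp add: ev_cob Lie_xcoord_theta_smon B5(3) b_def)
    qed
    with S6[OF False] show ?thesis
      by (simp add: \<phi>7_def)
  qed
  \<comment> \<open>With zero forms on rotations, a rotation transports the vanishing from the
    chosen index i to every other index.\<close>
  have S7': "ev (ap (\<phi>7 (xcoord * theta a)) (smon j I)) = 0" for a j I
  proof (cases "a = i")
    case False
    obtain d J where "ap (Lie l (theta i * theta a)) (smon j I) = d *\<^sub>R smon j J"
      using Lie_theta_theta_smon_cases[of l i a j I] by metis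
    then show ?thesis
      using reduced_xcoord_theta(3)[OF \<phi>7 x7 M7, of i a "smon j I"] False
      by (simp add: S7 Lie_xcoord_theta_smon M7)
  qed (simp add: S7)
  have "\<phi>7 F = 0" if "F \<in> osp_fun" for F
    by (rule ncocyc_zeroI[OF \<phi>7 x7 M7 S7' that])
  then have "\<phi> F = \<beta> *\<^sub>R res1 (Aop k) F + (\<alpha> + \<beta>) *\<^sub>R res2 (Aop k) F + cob l m (B1 + B2 + B3 + B4 + B5) F"
    if "F \<in> osp_fun" for F
    using that by (simp add: \<phi>7_def \<phi>6_def \<phi>5_def \<phi>4_def \<phi>3_def \<phi>2_def \<phi>1_def cob_linear algebra_simps)
  then show ?thesis
    using B1(1) B2(1) B3(1) B4(1) B5(1) by (intro that) auto
qed

text \<open>Both tests use monomials on which every coboundary vanishes: the top one for the Euler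
  field, giving a = b, and the top one without theta_i for x theta_i, which only \<open>res1\<close>
  detects.\<close>

lemma res_independent:
  assumes B: "B \<in> dops"
    and eq: "\<And>F. F \<in> osp_fun \<Longrightarrow> a *\<^sub>R res1 (Aop k) F + b *\<^sub>R res2 (Aop k :: 'n lop) F = cob l m B F"
  shows "a = 0" "b = 0"
proof -
  obtain c where c: "c \<noteq> 0" "\<And>p (J :: 'n set). ev (ap (Aop k) (smon p J)) = (if p = k - 1 \<and> J = UNIV then c else 0)"
    using ev_Aop by metis
  have "(b - a) * c = 0"
    using arg_cong[OF eq[of xcoord], of "\<lambda>A. ev (ap A (smon (k - 1) UNIV))"] k
    by (simp add: res_ev c(2) ev_cob wt_eq algebra_simps)
  then have ba: "b = a"
    using c(1) by simp
  define i :: 'n where "i = undefined"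
  define I where "I = UNIV - {i}"
  have I: "i \<notin> I" "insert i I = UNIV"
    by (auto simp: I_def)
  have "real (card I) = real CARD('n) - 1"
    using n by (simp add: I_def card_Diff_singleton of_nat_diff)
  then have "(real (k - 1) + real (card I)) / 2 + l = 0"
    using k by (simp add: l lambda_wt_def of_nat_diff field_simps)
  then have "ap (Lie l (xcoord * theta i)) (smon (k - 1) I) = 0"
    using I by (simp add: Lie_xcoord_theta_smon)
  then have "a * (isgn i I * c) = 0"
    using arg_cong[OF eq[of "xcoord * theta i"], of "\<lambda>A. ev (ap A (smon (k - 1) I))"] I
    by (simp add: res_ev ev_cob theta_smon c(2))
  then show "a = 0"
    using c(1) by simp
  with ba show "b = 0" by simp
qed

end

section \<open>The explicit formulas for the two cocycles\<close>

lemma oprod_insert_min: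
  assumes "\<And>a. a \<in> A \<Longrightarrow> b < a"
  shows "oprod D (insert b A) = D b * oprod D A"
proof -
  have "b \<notin> A" "insort b (sorted_list_of_set A) = b # sorted_list_of_set A"
    using assms by (auto intro!: insort_is_Cons less_imp_le)
  then show ?thesis
    by (simp add: oprod_def sorted_list_of_set_insert)
qed

lemma isgn_min:
  fixes b :: "'n::{finite,linorder}"
  assumes "\<And>a. a \<in> A \<Longrightarrow> b < a"
  shows "isgn b A = 1" "a \<in> A \<Longrightarrow> isgn a (insert b A) = - isgn a A"
proof -
  have "{j \<in> A. j < b} = {}"
    using assms by force
  then show "isgn b A = 1"
    unfolding isgn_def by (simp only: card.empty power_0)
  have "b \<notin> A"
    using assms by blast
  then show "isgn a (insert b A) = - isgn a A" if "a \<in> A"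
    using assms[OF that] by (simp add: isgn_insert_notin)
qed

lemma Eta_theta_left: "Eta b * (Mul (theta i) * C) = (if b = i then C else 0) - Mul (theta i) * (Eta b * C)"
proof -
  have "Eta b * Mul (theta i) = (if b = i then 1 else 0) - Mul (theta i) * Eta b"
    by (simp add: Eta_Mul Mul_simps)
  then show ?thesis
    by (simp add: left_diff_distrib flip: mult.assoc)
qed

text \<open>Each \<open>Eta b\<close> anticommutes with theta_i except for a contraction at b = i.
  The least index is peeled off, so it stands at the left of the product and shifts the sign
  \<open>isgn\<close> of all larger ones.\<close>

lemma oprod_Eta_theta:
  "oprod Eta I * Mul (theta i) = (-1) ^ card I *\<^sub>R (Mul (theta i) * oprod Eta I)
    + (if i \<in> I then ((-1) ^ (card I - 1) * isgn i I) *\<^sub>R oprod Eta (I - {i}) else 0)"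
proof (induction I rule: finite_linorder_min_induct[OF finite])
  case 1
  show ?case by simp
next
  case (2 b A)
  then have b: "\<And>a. a \<in> A \<Longrightarrow> b < a" and "b \<notin> A"
    by auto
  have ins: "oprod Eta (insert b A) = Eta b * oprod Eta A"
    by (rule oprod_insert_min) (rule b)
  show ?case
  proof (cases "i \<in> A")
    case True
    then have "i \<noteq> b" "card A \<noteq> 0" "insert b A - {i} = insert b (A - {i})"
      using \<open>b \<notin> A\<close> by auto
    moreover have "oprod Eta (insert b (A - {i})) = Eta b * oprod Eta (A - {i})"
      by (rule oprod_insert_min) (use b in blast)
    moreover have "(-1 :: real) ^ card A = - ((-1) ^ (card A - 1))"
      using \<open>card A \<noteq> 0\<close> by (cases "card A") auto
    ultimately show ?thesis
      using True \<open>b \<notin> A\<close> 2 isgn_min(2)[of A b i, OF b True]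
      by (simp add: ins mult.assoc distrib_left right_diff_distrib scaleR_right_diff_distrib Eta_theta_left)
  next
    case False
    then show ?thesis
      using \<open>b \<notin> A\<close> 2 isgn_min(1)[of A b, OF b]
      by (auto simp add: ins mult.assoc distrib_left Eta_theta_left scaleR_right_diff_distrib)
  qed
qed

text \<open>Moving x to the left past \<open>Eta b\<close> leaves -theta_b. No second contraction
  arises, since the remaining factors have indices different from b.\<close>

lemma oprod_Eta_xcoord:
  "oprod Eta I * Mul xcoord = Mul xcoord * oprod Eta I
    - (\<Sum>i\<in>I. isgn i I *\<^sub>R (Mul (theta i) * oprod Eta (I - {i})))"
proof (induction I rule: finite_linorder_min_induct[OF finite])
  case 1
  show ?case by simp
next
  case (2 b A)
  then have b: "\<And>a. a \<in> A \<Longrightarrow> b < a" and "b \<notin> A"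
    by auto
  have ins: "oprod Eta (insert b A) = Eta b * oprod Eta A"
    by (rule oprod_insert_min) (rule b)
  have Eta_x: "Eta b * (Mul xcoord * C) = Mul xcoord * (Eta b * C) - Mul (theta b) * C" for C
    by (simp add: Eta_Mul Mul_simps distrib_right left_diff_distrib flip: mult.assoc)
  have summand: "isgn i (insert b A) *\<^sub>R (Mul (theta i) * oprod Eta (insert b A - {i})) =
      Eta b * (isgn i A *\<^sub>R (Mul (theta i) * oprod Eta (A - {i})))" if "i \<in> A" for i
  proof -
    have "insert b A - {i} = insert b (A - {i})" "b \<noteq> i"
      using that \<open>b \<notin> A\<close> by auto
    moreover have "oprod Eta (insert b (A - {i})) = Eta b * oprod Eta (A - {i})"
      by (rule oprod_insert_min) (use b in blast)
    ultimately show ?thesis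
      using isgn_min(2)[of A b i, OF b that] by (simp add: Eta_theta_left)
  qed
  have "(\<Sum>i\<in>insert b A. isgn i (insert b A) *\<^sub>R (Mul (theta i) * oprod Eta (insert b A - {i}))) =
      Mul (theta b) * oprod Eta A + Eta b * (\<Sum>i\<in>A. isgn i A *\<^sub>R (Mul (theta i) * oprod Eta (A - {i})))"
    using \<open>b \<notin> A\<close> isgn_min(1)[of A b, OF b]
    by (simp add: sum_distrib_left summand del: mult_scaleR_right)
  then show ?case
    using 2 by (simp add: ins mult.assoc right_diff_distrib Eta_x)
qed

lemma Dx_power_xcoord:
  "Dx ^ p * Mul (xcoord :: 'n::{finite,linorder} sfun) = Mul xcoord * Dx ^ p + real p *\<^sub>R Dx ^ (p - 1)"
proof (induction p)
  case (Suc p)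
  have "Dx ^ Suc p * Mul (xcoord :: 'n sfun) = Dx * (Mul xcoord * Dx ^ p + real p *\<^sub>R Dx ^ (p - 1))"
    by (simp only: power_Suc mult.assoc Suc)
  also have "\<dots> = Mul xcoord * Dx ^ Suc p + Dx ^ p + real p *\<^sub>R Dx ^ p"
  proof -
    have "Dx * (Mul (xcoord :: 'n sfun) * Dx ^ p) = Dx ^ p + Mul xcoord * Dx ^ Suc p"
      unfolding mult.assoc[symmetric] Dx_Mul by (simp add: Mul_simps distrib_right mult.assoc)
    moreover have "real p *\<^sub>R (Dx * Dx ^ (p - 1)) = real p *\<^sub>R (Dx ^ p :: 'n lop)"
      by (cases p) simp_all
    ultimately show ?thesis
      by (simp add: distrib_left)
  qed
  finally show ?case
    by (simp add: algebra_simps)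
qed simp

lemma Dx_power_theta: "Dx ^ p * Mul (theta i) = Mul (theta i) * Dx ^ p"
  using power_commuting_commutes[of Dx "Mul (theta i)" p] by (simp add: Dx_theta)

lemma Par_Eta_left: "Par * (Eta i * A) = - (Eta i * (Par * A))"
  by (simp add: Par_Eta flip: mult.assoc)

text \<open>A product of n odd operators and an even one; this is the origin of the sign (-1)^(nF)
  in the first cocycle.\<close>

lemma Par_Aop: "Par * Aop k * Par = (-1) ^ CARD('n) *\<^sub>R (Aop k :: 'n::{finite,linorder} lop)"
proof -
  have P: "Par * prod_list (map Eta xs) = (-1) ^ length xs *\<^sub>R (prod_list (map Eta xs) * Par)" for xs :: "'n list"
    by (induction xs) (simp_all add: Par_Eta_left mult.assoc)
  have "Par * Dx ^ j = Dx ^ j * (Par :: 'n lop)" for j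
    using power_commuting_commutes[of Dx "Par :: 'n lop" j] by (simp add: Par_Dx)
  then have "Par * (Aop k * Par) = (-1) ^ CARD('n) *\<^sub>R (Aop k :: 'n lop)"
    using P[of "sorted_list_of_set UNIV"]
    by (simp add: Aop_def oprod_def) (metis (no_types, lifting) Par_Par mult.assoc mult.right_neutral mult_scaleR_left)
  then show ?thesis
    by (simp add: mult.assoc)
qed

lemma ordered_comp_eta: "ordered_comp eta I = ap (oprod Eta I)"
proof -
  have "(\<lambda>i. ap (Eta i)) = (eta :: 'a \<Rightarrow> _)"
    by (intro ext) simp
  then show ?thesis
    by (simp add: ap_oprod)
qed

lemma dx_power_ap: "dx ^^ j = ap (Dx ^ j)"
  by (rule ext) (simp add: ap_power ap_Dx)

definition h_lop :: "nat \<Rightarrow> 'n::{finite,linorder} sfun \<Rightarrow> 'n lop" where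
  "h_lop k F = (Mul (dx (hpart 0 F)) + (-1) ^ CARD('n) *\<^sub>R Mul (dx (hpart 1 F))) * Aop k"

definition ht_lop :: "nat \<Rightarrow> 'n::{finite,linorder} sfun \<Rightarrow> 'n lop" where
  "ht_lop k F = (real k - 1) *\<^sub>R (Mul (dx (dx F)) * oprod Eta UNIV * Dx ^ (k - 2))
    + (\<Sum>i\<in>UNIV. isgn i UNIV *\<^sub>R ((Mul (eta i (dx (hpart 0 F))) + (-1) ^ (CARD('n) - 1) *\<^sub>R Mul (eta i (dx (hpart 1 F))))
        * oprod Eta (UNIV - {i}) * Dx ^ (k - 1)))"

lemma h_ap: "h k F = ap (h_lop k F)"
  unfolding h_def mult_op_ap ordered_comp_eta dx_power_ap ap_fun_simps h_lop_def Aop_def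
  by (simp add: ap_fun_simps ap_eq_iff algebra_simps)

lemma h_tilde_ap: "h_tilde k F = ap (ht_lop k F)"
proof -
  have sum_ap: "(\<Sum>i\<in>UNIV. ap (f i)) = ap (\<Sum>i\<in>UNIV. f i)" for f :: "'a \<Rightarrow> 'a lop"
    by (rule ext) (simp add: sum_fun_apply)
  show ?thesis
    unfolding h_tilde_def mult_op_ap ordered_comp_eta dx_power_ap ap_fun_simps ht_lop_def isgn_def sum_ap
    by (simp add: ap_fun_simps ap_eq_iff algebra_simps sum.distrib scaleR_sum_right)
qed

lemma h_eq_res2: "h_lop k F = res2 (Aop k) F"
  unfolding h_lop_def res2_def Par_Aop by (simp add: algebra_simps)

lemma h_lop_linear:
  "h_lop k (F + G) = h_lop k F + h_lop k G" "h_lop k (c *\<^sub>R F) = c *\<^sub>R h_lop k F" "h_lop k 0 = 0"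
  by (simp_all add: h_lop_def Mul_simps algebra_simps)

lemma ht_lop_linear:
  "ht_lop k (F + G) = ht_lop k F + ht_lop k G" "ht_lop k (c *\<^sub>R F) = c *\<^sub>R ht_lop k F" "ht_lop k 0 = 0"
  by (simp_all add: ht_lop_def Mul_simps algebra_simps sum.distrib scaleR_sum_right)

lemma hpart_gens:
  "hpart 0 1 = 1" "hpart (Suc 0) 1 = 0" "hpart 0 xcoord = xcoord" "hpart (Suc 0) xcoord = 0"
  "hpart 0 (xcoord * xcoord) = xcoord * xcoord" "hpart (Suc 0) (xcoord * xcoord) = 0"
  "hpart 0 (theta i) = 0" "hpart (Suc 0) (theta i) = theta i"
  "hpart 0 (xcoord * theta i) = 0" "hpart (Suc 0) (xcoord * theta i) = xcoord * theta i"
  "hpart 0 (theta a * theta b) = theta a * theta b" "hpart (Suc 0) (theta a * theta b) = 0"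
  by (simp_all add: hpart_homog[OF homog_gens(1)] hpart_homog[OF homog_gens(2)] hpart_homog[OF homog_gens(3)]
      hpart_homog[OF homog_gens(4)] hpart_homog[OF homog_gens(5)] hpart_homog[OF homog_gens(6)])

text \<open>For osp(n|2) the derivative F' lies in the span of 1, x and theta_i, so the Leibniz
  expansion of A_k composed with F' stops after single contractions. The uncontracted term is
  \<open>h_lop\<close>, the contracted ones are \<open>ht_lop\<close>.\<close>

lemma h_ht_sum:
  fixes F :: "'n::{finite,linorder} sfun"
  assumes k: "k \<ge> 1" and "F \<in> osp_fun"
  shows "h_lop k F + ht_lop k F = Aop k * Mul (dx F)"
  using assms(2)
proof (induction rule: osp_fun_induct)
  case xcoord
  then show ?case
    by (simp add: h_lop_def ht_lop_def hpart_gens Mul_simps)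
next
  case xx
  \<comment> \<open>S collects the contractions of x with the factors \<open>Eta i\<close>; as
    \<open>eta i\<close> maps 2x to -2 theta_i, it reappears as the sum in
    \<open>ht_lop\<close>.\<close>
  define S where "S = (\<Sum>i\<in>UNIV. isgn i UNIV *\<^sub>R (Mul (theta i) * (oprod Eta (UNIV - {i}) * Dx ^ (k - 1))) :: 'n lop)"
  have "oprod Eta UNIV * (Dx ^ (k - 1) * Mul xcoord) = oprod Eta UNIV * Mul xcoord * Dx ^ (k - 1)
      + (real k - 1) *\<^sub>R (oprod Eta UNIV * Dx ^ (k - 2) :: 'n lop)"
    using k by (simp add: Dx_power_xcoord distrib_left of_nat_diff numeral_2_eq_2 mult.assoc)
  also have "oprod Eta UNIV * Mul xcoord * Dx ^ (k - 1) = Mul xcoord * (oprod Eta UNIV * Dx ^ (k - 1)) - S"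
    unfolding oprod_Eta_xcoord S_def by (simp add: left_diff_distrib sum_distrib_right mult.assoc)
  finally have "Aop k * Mul (dx (xcoord * xcoord)) = 2 *\<^sub>R (Mul xcoord * (oprod Eta UNIV * Dx ^ (k - 1)) - S
      + (real k - 1) *\<^sub>R (oprod Eta UNIV * Dx ^ (k - 2) :: 'n lop))"
    by (simp add: Aop_def dx_mult scaleR_2[symmetric] Mul_simps mult.assoc)
  moreover have "h_lop k (xcoord * xcoord) = 2 *\<^sub>R (Mul xcoord * (oprod Eta UNIV * Dx ^ (k - 1)) :: 'n lop)"
    by (simp add: h_lop_def hpart_gens dx_mult scaleR_2[symmetric] Mul_simps Aop_def mult.assoc)
  moreover have "ht_lop k (xcoord * xcoord) = (2 * (real k - 1)) *\<^sub>R (oprod Eta UNIV * Dx ^ (k - 2)) - 2 *\<^sub>R S"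
    unfolding S_def
    by (simp add: ht_lop_def hpart_gens dx_mult scaleR_2[symmetric] Mul_simps mult.assoc sum_negf
        scaleR_sum_right mult.commute)
  ultimately show ?case
    by (simp add: scaleR_right_distrib scaleR_right_diff_distrib)
next
  case (xtheta i)
  have "Mul (if j = i then 1 else 0) * C = (if j = i then C else 0)" for j and C :: "'n lop"
    by (simp add: Mul_simps)
  then show ?case
    by (simp add: h_lop_def ht_lop_def hpart_gens Mul_simps dx_mult Aop_def mult.assoc Dx_power_theta
        oprod_Eta_theta distrib_right if_zero_distrib if_distrib[of "\<lambda>C. c *\<^sub>R C" for c] cong: if_cong
        flip: mult.assoc[of "oprod _ _" "Mul _"])
next
  case (add F G)
  show ?case
    unfolding h_lop_linear ht_lop_linear dx_add Mul_simps distrib_left add(3,4)[symmetric] by simp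
next
  case (scaleR c F)
  show ?case
    unfolding h_lop_linear ht_lop_linear dx_scaleR Mul_simps mult_scaleR_right scaleR(2)[symmetric]
    by (simp add: scaleR_right_distrib)
qed (simp_all add: h_lop_def ht_lop_def Mul_simps dx_mult hpart_gens)

section \<open>The first cohomology\<close>

lemma ap_in_diff_ops: "ap B \<in> diff_ops \<longleftrightarrow> B \<in> dops"
  by (auto simp: diff_ops_eq ap_eq_iff)

text \<open>Linearity on all functions lets the four values on homogeneous brackets be added up
  directly, without asking whether those brackets lie in \<open>osp_fun\<close>.\<close>

lemma ap_cocycles1:
  assumes \<phi>: "\<phi> \<in> cocyc l m"
    and lin: "\<And>F G. \<phi> (F + G) = \<phi> F + \<phi> G" "\<And>c F. \<phi> (c *\<^sub>R F) = c *\<^sub>R \<phi> F"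
  shows "(\<lambda>F. ap (\<phi> F)) \<in> cocycles1 l m"
proof -
  have "delta1 l m (\<lambda>F. ap (\<phi> F)) F G = 0" if "F \<in> osp_fun" "G \<in> osp_fun" for F G
  proof -
    have "\<phi> 0 = 0"
      using lin(2)[of 0 0] by simp
    then have "delta1 l m (\<lambda>F. ap (\<phi> F)) F G =
        ap (\<Sum>q\<in>{0,1}. \<Sum>r\<in>{0,1}. cob1 l m \<phi> q r (hpart q F) (hpart r G)) - ap (\<phi> (contact_bracket F G))"
      by (intro delta1_ap) (simp_all add: ap_zero_fun)
    also have "(\<Sum>q\<in>{0,1}. \<Sum>r\<in>{0,1}. cob1 l m \<phi> q r (hpart q F) (hpart r G)) =
        (\<Sum>q\<in>{0,1}. \<Sum>r\<in>{0,1}. \<phi> (contact_bracket (hpart q F) (hpart r G)))"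
      using that by (intro sum.cong refl cocycD(4)[OF \<phi>, symmetric] homog_hpart hpart_osp)
    also have "\<dots> = \<phi> (contact_bracket (hpart 0 F + hpart 1 F) (hpart 0 G + hpart 1 G))"
      by (simp add: contact_bracket_linear lin)
    finally show ?thesis
      by (simp only: hpart_sum diff_self)
  qed
  then show ?thesis
    using cocycD(1)[OF \<phi>]
    by (simp add: cocycles1_def cochains1_def ap_in_diff_ops lin ap_fun_simps)
qed

lemma cocycles1_ap:
  assumes f: "f \<in> cocycles1 l m"
  obtains \<phi> where "\<phi> \<in> cocyc l m" "\<And>F. F \<in> osp_fun \<Longrightarrow> f F = ap (\<phi> F)"
proof -
  define \<phi> where "\<phi> = (\<lambda>F. Lop (f F))"
  have D: "f F \<in> diff_ops" if "F \<in> osp_fun" for F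
    using f that by (simp add: cocycles1_def cochains1_def)
  have ap: "f F = ap (\<phi> F)" if "F \<in> osp_fun" for F
  proof -
    have "linear (f F)"
      using D[OF that] linear_ap by (auto simp: diff_ops_eq)
    then show ?thesis
      by (simp add: \<phi>_def ap_Lop)
  qed
  have f0: "f 0 = 0"
  proof -
    have "f (0 *\<^sub>R 0) = 0 *\<^sub>R f 0"
      using f osp_fun_mem(1) unfolding cocycles1_def cochains1_def by blast
    then show ?thesis by simp
  qed
  have "\<phi> F \<in> dops" if "F \<in> osp_fun" for F
    using D[OF that] ap[OF that] by (simp add: ap_in_diff_ops)
  moreover have "\<phi> (F + G) = \<phi> F + \<phi> G" if "F \<in> osp_fun" "G \<in> osp_fun" for F G
    using f that ap by (simp add: cocycles1_def cochains1_def ap_fun_simps flip: ap_eq_iff)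
  moreover have "\<phi> (c *\<^sub>R F) = c *\<^sub>R \<phi> F" if "F \<in> osp_fun" for c F
    using f that ap by (simp add: cocycles1_def cochains1_def ap_fun_simps flip: ap_eq_iff)
  moreover have "\<phi> (contact_bracket u v) = cob1 l m \<phi> q r u v"
    if "homog q u" "homog r v" "u \<in> osp_fun" "v \<in> osp_fun" for q r u v
  proof -
    have \<phi>0: "\<phi> 0 = 0"
      using ap[OF osp_fun_mem(1)] f0 by (simp add: ap_zero_fun flip: ap_eq_iff)
    have qr: "q \<in> {0, 1}" "r \<in> {0, 1}"
      using that by (auto simp: homog_def)
    have "delta1 l m f u v = 0"
      using f that by (simp add: cocycles1_def)
    also have "delta1 l m f u v =
        ap (\<Sum>q'\<in>{0,1}. \<Sum>r'\<in>{0,1}. cob1 l m \<phi> q' r' (hpart q' u) (hpart r' v)) - f (contact_bracket u v)"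
      using that by (intro delta1_ap ap hpart_osp f0)
    also have "(\<Sum>q'\<in>{0,1}. \<Sum>r'\<in>{0,1}. cob1 l m \<phi> q' r' (hpart q' u) (hpart r' v)) = cob1 l m \<phi> q r u v"
      using qr by (auto simp: hpart_homog[OF that(1)] hpart_homog[OF that(2)] cob1_def Lie_linear \<phi>0)
    finally have "f (contact_bracket u v) = ap (cob1 l m \<phi> q r u v)"
      by (simp only: right_minus_eq)
    \<comment> \<open>The value on the bracket is already of the form \<open>ap _\<close>, so
      \<open>Lop\<close> recovers it without membership of the bracket in
      \<open>osp_fun\<close>.\<close>
    then show ?thesis
      by (simp add: \<phi>_def ap_inverse)
  qed
  ultimately have "\<phi> \<in> cocyc l m"
    by (simp add: cocyc_def)
  then show ?thesis
    using ap that by blast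
qed

lemma cohomologous_iff:
  "(f, g) \<in> cohomologous l m \<longleftrightarrow> f \<in> cocycles1 l m \<and> g \<in> cocycles1 l m \<and>
    (\<exists>B\<in>dops. \<forall>F\<in>osp_fun. f F - g F = ap (cob l m B F))"
  by (auto simp: cohomologous_def diff_ops_eq delta0_ap)

lemma equiv_cohomologous: "equiv (cocycles1 l m) (cohomologous l m)"
proof (rule equivI)
  show "cohomologous l m \<subseteq> cocycles1 l m \<times> cocycles1 l m"
    by (auto simp: cohomologous_iff)
  show "refl_on (cocycles1 l m) (cohomologous l m)"
    by (auto simp: refl_on_def cohomologous_iff cob_def ap_zero_fun intro!: bexI[of _ 0])
  show "sym (cohomologous l m)"
  proof (rule symI)
    fix f g
    assume "(f, g) \<in> cohomologous l m"
    then obtain B where fg: "f \<in> cocycles1 l m" "g \<in> cocycles1 l m" and "B \<in> dops"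
      and B: "\<And>F. F \<in> osp_fun \<Longrightarrow> f F - g F = ap (cob l m B F)"
      by (auto simp: cohomologous_iff)
    have "g F - f F = ap (cob l m (- 1 *\<^sub>R B) F)" if "F \<in> osp_fun" for F
    proof -
      have "g F - f F = - (f F - g F)"
        by simp
      then show ?thesis
        unfolding B[OF that] ap_fun_simps cob_linear by simp
    qed
    moreover have "- 1 *\<^sub>R B \<in> dops"
      using \<open>B \<in> dops\<close> by (rule dops_scaleR)
    ultimately show "(g, f) \<in> cohomologous l m"
      using fg unfolding cohomologous_iff by blast
  qed
  show "trans (cohomologous l m)"
  proof (rule transI)
    fix f g h'
    assume "(f, g) \<in> cohomologous l m" "(g, h') \<in> cohomologous l m"
    then obtain B C where fgh: "f \<in> cocycles1 l m" "h' \<in> cocycles1 l m" and "B \<in> dops" "C \<in> dops"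
      and B: "\<And>F. F \<in> osp_fun \<Longrightarrow> f F - g F = ap (cob l m B F)"
      and C: "\<And>F. F \<in> osp_fun \<Longrightarrow> g F - h' F = ap (cob l m C F)"
      by (auto simp: cohomologous_iff)
    have "f F - h' F = ap (cob l m (B + C) F)" if "F \<in> osp_fun" for F
    proof -
      have "f F - h' F = (f F - g F) + (g F - h' F)"
        by simp
      then show ?thesis
        unfolding B[OF that] C[OF that] ap_fun_simps cob_linear .
    qed
    moreover have "B + C \<in> dops"
      using \<open>B \<in> dops\<close> \<open>C \<in> dops\<close> by (rule dops_add)
    ultimately show "(f, h') \<in> cohomologous l m"
      using fgh unfolding cohomologous_iff by blast
  qed
qed

text \<open>Independence gives injectivity of the parametrisation and the decomposition its
  surjectivity. Agreement on \<open>osp_fun\<close> up to a coboundary suffices for equality of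
  classes, so arbitrary values elsewhere do no harm.\<close>

lemma classes_form_basis_res:
  assumes n: "CARD('n::{finite,linorder}) \<ge> 3" and k: "k \<ge> 1"
  defines "l \<equiv> lambda_wt CARD('n) k" and "m \<equiv> mu_wt k"
  shows "classes_form_basis l m (\<lambda>F. ap (res1 (Aop k) F)) (\<lambda>F. ap (res2 (Aop k :: 'n lop) F))"
proof -
  let ?f = "\<lambda>F. ap (res1 (Aop k :: 'n lop) F)" and ?g = "\<lambda>F. ap (res2 (Aop k :: 'n lop) F)"
  have lm: "l = lambda_wt CARD('n) k" "m = mu_wt k"
    by (simp_all add: l_def m_def)
  have res: "res1 (Aop k :: 'n lop) \<in> cocyc l m" "res2 (Aop k :: 'n lop) \<in> cocyc l m"
    using res_ncocyc[OF k, where ?'n = 'n] by (simp_all add: lm ncocyc_def)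
  have comb: "a *\<^sub>R ?f + b *\<^sub>R ?g = (\<lambda>F. ap (a *\<^sub>R res1 (Aop k) F + b *\<^sub>R res2 (Aop k) F))" for a b
    by (simp add: fun_eq_iff scaleR_fun_def)
  have comb_cocycle: "a *\<^sub>R ?f + b *\<^sub>R ?g \<in> cocycles1 l m" for a b
    unfolding comb
    by (rule ap_cocycles1) (intro cocyc_add cocyc_scaleR res, simp_all add: res_linear algebra_simps)
  have fg: "?f \<in> cocycles1 l m" "?g \<in> cocycles1 l m"
    by (rule ap_cocycles1; simp add: res res_linear)+
  let ?c = "\<lambda>(a, b). cohomology_class l m (a *\<^sub>R ?f + b *\<^sub>R ?g)"
  have "inj ?c"
  proof (rule injI, clarify)
    fix a b a' b'
    assume "cohomology_class l m (a *\<^sub>R ?f + b *\<^sub>R ?g) = cohomology_class l m (a' *\<^sub>R ?f + b' *\<^sub>R ?g)"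
    then have "(a *\<^sub>R ?f + b *\<^sub>R ?g, a' *\<^sub>R ?f + b' *\<^sub>R ?g) \<in> cohomologous l m"
      using eq_equiv_class[OF _ equiv_cohomologous] comb_cocycle unfolding cohomology_class_def by blast
    then obtain B where B: "B \<in> dops" and "\<And>F. F \<in> osp_fun \<Longrightarrow>
        (a *\<^sub>R ?f + b *\<^sub>R ?g) F - (a' *\<^sub>R ?f + b' *\<^sub>R ?g) F = ap (cob l m B F)"
      by (auto simp: cohomologous_iff)
    then have eq: "(a - a') *\<^sub>R res1 (Aop k) F + (b - b') *\<^sub>R res2 (Aop k) F = cob l m B F" if "F \<in> osp_fun" for F
      using that unfolding comb by (simp add: ap_fun_simps ap_eq_iff algebra_simps)
    have "a - a' = 0" "b - b' = 0"
      by (rule res_independent[OF n k lm B eq]; assumption)+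
    then show "a = a' \<and> b = b'"
      by simp
  qed
  moreover have "range ?c = H1 l m"
  proof
    show "range ?c \<subseteq> H1 l m"
      using comb_cocycle by (auto simp: H1_def cohomology_class_def quotient_def)
    show "H1 l m \<subseteq> range ?c"
    proof
      fix X :: "'n cochain set"
      assume "X \<in> H1 l m"
      then obtain f where f: "f \<in> cocycles1 l m" and X: "X = cohomologous l m `` {f}"
        by (auto simp: H1_def quotient_def)
      obtain \<phi> where \<phi>: "\<phi> \<in> cocyc l m" "\<And>F. F \<in> osp_fun \<Longrightarrow> f F = ap (\<phi> F)"
        using cocycles1_ap[OF f] by blast
      obtain a b and B :: "'n lop" where B: "B \<in> dops"
        "\<And>F. F \<in> osp_fun \<Longrightarrow> \<phi> F = a *\<^sub>R res1 (Aop k) F + b *\<^sub>R res2 (Aop k) F + cob l m B F"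
        by (rule cocycle_decomposition[OF n k lm \<phi>(1)]) blast
      have "(f, a *\<^sub>R ?f + b *\<^sub>R ?g) \<in> cohomologous l m"
        using f comb_cocycle B(1) unfolding cohomologous_iff comb
        by (auto simp: \<phi>(2) B(2) ap_fun_simps intro!: bexI[of _ B])
      then have "X = ?c (a, b)"
        using equiv_class_eq[OF equiv_cohomologous] by (simp add: X cohomology_class_def)
      then show "X \<in> range ?c"
        by blast
    qed
  qed
  ultimately show ?thesis
    using fg by (simp add: classes_form_basis_def bij_betw_def)
qed

theorem proposition5p3:
  fixes k m :: nat and l \<mu> :: real
    and A :: "'n::{finite,linorder} operator"
    and a1 a2 :: "'n cochain"
  assumes "CARD('n) \<ge> 3" and "m \<ge> 1" and "1 \<le> k" and "k \<le> m"
    and l: "l = lambda_wt CARD('n) k" and mu: "\<mu> = mu_wt k"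
    and A: "A = A_op k"
    and a1: "a1 = Delta1 A" and a2: "a2 = Delta2 A"
  shows "A \<in> diff_ops
    \<and> (\<forall>F\<in>osp_fun. a2 F = h k F \<and> a1 F = - (h k F + h_tilde k F))
    \<and> (\<forall>F\<in>osp_fun. \<forall>p. hpart p F = F \<longrightarrow> h k F = (-1) ^ (CARD('n) * p) *\<^sub>R (mult_op (dx F) \<circ> A))
    \<and> (\<forall>F\<in>osp_fun. h k F + h_tilde k F = A \<circ> mult_op (dx F))
    \<and> classes_form_basis l \<mu> a1 a2
    \<and> (\<forall>\<sigma> \<tau>. \<forall>F\<in>osp_fun. delta0 (l + \<sigma>) (\<mu> + \<tau>) A F = \<sigma> *\<^sub>R a1 F + \<tau> *\<^sub>R a2 F)"
proof -
  have A': "A = ap (Aop k)"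
    by (simp add: A A_op_ap)
  have a: "a1 = (\<lambda>F. ap (res1 (Aop k) F))" "a2 = (\<lambda>F. ap (res2 (Aop k) F))"
    by (rule ext, simp add: a1 a2 A' Delta_ap)+
  have sum: "h k F + h_tilde k F = ap (Aop k * Mul (dx F))" if "F \<in> osp_fun" for F :: "'n sfun"
    using h_ht_sum[OF \<open>1 \<le> k\<close> that] by (simp add: h_ap h_tilde_ap ap_fun_simps)
  have h_eq: "h k F = (-1) ^ (CARD('n) * p) *\<^sub>R (mult_op (dx F) \<circ> A)" if "hpart p F = F" for F :: "'n sfun" and p
  proof -
    \<comment> \<open>The parity p is an arbitrary natural number here, while \<open>homog\<close>
      admits only 0 and 1.\<close>
    have "hpart (p mod 2) F = hpart p F"
      by (rule sfun_eqI) (simp add: coef_hpart)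
    then have F: "hpart (p mod 2) F = F" and p: "p mod 2 \<in> {0, 1}"
      using that by auto
    have "homog (p mod 2) F"
      using homog_hpart[OF p, of F] by (simp only: F)
    moreover have "cj (p mod 2) (Aop k) = (-1) ^ (CARD('n) * p) *\<^sub>R (Aop k :: 'n lop)"
      using p by (auto simp: cj_def Par_Aop mod_2_eq_odd power_mult uminus_power_if)
    ultimately have "res2 (Aop k) F = (-1) ^ (CARD('n) * p) *\<^sub>R (Mul (dx F) * Aop k)"
      by (simp add: res2_homog)
    then show ?thesis
      by (simp add: h_ap h_eq_res2 A' mult_op_ap ap_fun_simps)
  qed
  have delta: "delta0 (l + \<sigma>) (\<mu> + \<tau>) A F = \<sigma> *\<^sub>R a1 F + \<tau> *\<^sub>R a2 F" if "F \<in> osp_fun" for \<sigma> \<tau> F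
    using cob_Aop[OF \<open>1 \<le> k\<close> that]
    by (simp add: A' delta0_ap cob_shift a ap_fun_simps l mu)
  have classes: "classes_form_basis l \<mu> a1 a2"
    unfolding a l mu by (rule classes_form_basis_res) fact+
  have a_eq: "a2 F = h k F" "a1 F = - (h k F + h_tilde k F)" if "F \<in> osp_fun" for F
    using sum[OF that] by (simp_all add: a h_ap h_eq_res2 res1_def ap_fun_simps)
  have A_diff: "A \<in> diff_ops"
    by (simp add: A' ap_in_diff_ops)
  have comp: "h k F + h_tilde k F = A \<circ> mult_op (dx F)" if "F \<in> osp_fun" for F
    using sum[OF that] by (simp add: A' mult_op_ap ap_fun_simps)
  show ?thesis
    by (intro conjI ballI allI impI A_diff classes) (rule a_eq h_eq comp delta; assumption)+
qed

end
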